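(* Let $\mathbf{Z}_1,\ldots,\mathbf{Z}_n$ be a random sample from the distribution of a random matrix $\mathbf{Z}\in\mathbb{R}^{p\times q}$ having finite eighth moments, whose components $z_{kl}$ are mutually independent with $\mathrm{E}(z_{kl})=0$ and $\mathrm{var}(z_{kl})=1$, and such that, with $\beta_{kl}=\mathrm{E}(z_{kl}^4)$, the row averages $\bar\beta_{1\cdot},\ldots,\bar\beta_{p\cdot}$ are distinct and the column averages $\bar\beta_{\cdot1},\ldots,\bar\beta_{\cdot q}$ are distinct. Assume that $\boldsymbol{\Omega}_L=\mathbf{I}_p$ and $\boldsymbol{\Omega}_R=\mathbf{I}_q$ (so that the observed matrices are $\mathbf{X}_i=\mathbf{Z}_i$), and that the left and right standardization matrices $\bar{\mathbf{S}}_L^{-1/2}$ and $\bar{\mathbf{S}}_R^{-1/2}$ are chosen to be symmetric. Let $N\in\{0,1\}$. Then there exists a sequence of left MFOBI estimates $\hat{\boldsymbol{\Gamma}}=(\hat\gamma_{kk'})$ (based on the matrix $\bar{\mathbf{B}}_L^N$) such that, as $n\to\infty$, $\hat{\boldsymbol{\Gamma}}\to_P\mathbf{I}_p$ and $$\sqrt n(\hat\gamma_{kk}-1)=-\tfrac12\sqrt n(\bar s_{kk}-1)+o_P(1),$$ $$\sqrt n\,\hat\gamma_{kk'}=\frac{\sqrt n\,\bar Q+\sqrt n\,\bar R^N-(\bar\beta_{k\cdot}+b_N)\sqrt n\,\bar s_{kk'}}{\bar\beta_{k\cdot}-\bar\beta_{k'\cdot}}+o_P(1),\qquad k\neq k',$$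 where $\bar Q=\bar q_{kk'}+\bar q_{k'k}+\sum_{m\neq k,k'}\bar q_{mkk'}$, $\bar R^N=\bar r_{kk'}+\bar r_{k'k}+\sum_{m\neq k,k'}\bar r^N_{mkk'}$, $b_0=2q+p-1$ and $b_1=qp+1$.
   Context: Left MFOBI estimate. Observed i.i.d. matrices are $\mathbf{X}_i=\boldsymbol{\Omega}_L\mathbf{Z}_i\boldsymbol{\Omega}_R^\top$; here $\mathbf{X}_i=\mathbf{Z}_i$. Let $\tilde{\mathbf{X}}_i=\mathbf{X}_i-\bar{\mathbf{X}}$ with $\bar{\mathbf X}=\frac1n\sum_i\mathbf X_i$, $\bar{\mathbf{S}}_L=\frac1{nq}\sum_i\tilde{\mathbf{X}}_i\tilde{\mathbf{X}}_i^\top$, $\bar{\mathbf{S}}_R=\frac1{np}\sum_i\tilde{\mathbf{X}}_i^\top\tilde{\mathbf{X}}_i$ (positive definite with probability tending to 1), and $\mathbf{Y}_i=\bar{\mathbf{S}}_L^{-1/2}\tilde{\mathbf{X}}_i(\bar{\mathbf{S}}_R^{-1/2})^\top$, with the symmetric inverse square roots. Define $$\bar{\mathbf{B}}_L^0=\frac1{nq}\sum_{i=1}^n\mathbf{Y}_i\mathbf{Y}_i^\top\mathbf{Y}_i\mathbf{Y}_i^\top,\qquad\bar{\mathbf{B}}_L^1=\frac1{nq}\sum_{i=1}^n\|\mathbf{Y}_i\|_F^2\,\mathbf{Y}_i\mathbf{Y}_i^\top.$$ A left MFOBI estimate is any $\hat{\boldsymbol{\Gamma}}=\hat{\mathbf{W}}_L^\top\bar{\mathbf{S}}_L^{-1/2}$,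 where $\hat{\mathbf{W}}_L$ is an orthogonal matrix whose columns are eigenvectors of $\bar{\mathbf{B}}_L^N$ (in any order and with any signs). Moment notation: $\gamma_{kl}=\mathrm{E}(z_{kl}^3)$, $\beta_{kl}=\mathrm{E}(z_{kl}^4)$, $\bar\beta_{k\cdot}=\frac1q\sum_{l}\beta_{kl}$, $\bar\beta_{\cdot l}=\frac1p\sum_k\beta_{kl}$. Sample quantities ($z_{i,kl}$ is the $(k,l)$ entry of $\mathbf{Z}_i$; $k,k',m$ distinct, except that $k=k'$ is allowed in $\bar s_{kk'}$): $$\bar s_{kk'}=\frac1q\sum_{l=1}^q\frac1n\sum_{i=1}^n z_{i,kl}z_{i,k'l},\quad \bar q_{kk'}=\frac1q\sum_{l=1}^q\frac1n\sum_{i=1}^n(z_{i,kl}^3-\gamma_{kl})z_{i,k'l},\quad \bar q_{mkk'}=\frac1q\sum_{l=1}^q\frac1n\sum_{i=1}^n z_{i,ml}^2z_{i,kl}z_{i,k'l},$$ $$\bar r_{kk'}=\frac1q\sum_{l\neq l'}\frac1n\sum_{i=1}^n z_{i,kl}^2z_{i,kl'}z_{i,k'l'},\quad \bar r^0_{mkk'}=\frac1q\sum_{l\neq l'}\frac1n\sum_{i=1}^n z_{i,kl}z_{i,ml}z_{i,ml'}z_{i,k'l'},\quad \bar r^1_{mkk'}=\frac1q\sum_{l\neq l'}\frac1n\sum_{i=1}^n z_{i,ml}^2z_{i,kl'}z_{i,k'l'},$$ where $\sum_{l\neq l'}$ is over ordered pairs $(l,l')$ in $\{1,\ldots,q\}^2$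 with $l\neq l'$. *)

theory Defs
  imports "HOL-Probability.Probability"
begin

section \<open>Convergence in probability\<close>

text \<open>Measurability is part of the definition because \<open>measure M\<close> is \<open>0\<close> on non-measurable sets.\<close>

definition tendsto_in_prob ::
  "'w measure \<Rightarrow> (nat \<Rightarrow> 'w \<Rightarrow> 'a::{second_countable_topology, metric_space}) \<Rightarrow> 'a \<Rightarrow> bool"
  where "tendsto_in_prob M X c \<longleftrightarrow>
    (\<forall>n. X n \<in> borel_measurable M) \<and>
    (\<forall>e>0. (\<lambda>n. measure M {\<omega> \<in> space M. dist (X n \<omega>) c > e}) \<longlonglongrightarrow> 0)"

definition little_oP1 :: "'w measure \<Rightarrow> (nat \<Rightarrow> 'w \<Rightarrow> real) \<Rightarrow> bool"
  where "little_oP1 M X \<longleftrightarrow> tendsto_in_prob M X 0"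

section \<open>Symmetric inverse square roots\<close>

definition pos_def_matrix :: "real^'n^'n \<Rightarrow> bool"
  where "pos_def_matrix A \<longleftrightarrow> transpose A = A \<and> (\<forall>v. v \<noteq> 0 \<longrightarrow> v \<bullet> (A *v v) > 0)"

text \<open>Meaningful for positive definite \<open>A\<close> only, where it is the unique positive definite
  square root of the inverse of \<open>A\<close>.\<close>

definition inv_sqrt_matrix :: "real^'n^'n \<Rightarrow> real^'n^'n"
  where "inv_sqrt_matrix A = (THE R. pos_def_matrix R \<and> R ** R = matrix_inv A)"

section \<open>Left MFOBI estimates\<close>

text \<open>A data set is a function \<open>x :: nat \<Rightarrow> real^'q^'p\<close>; the sample of size \<open>n\<close> consists of
  \<open>x 0, \<dots>, x (n - 1)\<close>. Elements of \<open>real^'q^'p\<close> are matrices with \<open>p = CARD('p)\<close> rows and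
  \<open>q = CARD('q)\<close> columns.\<close>

definition sample_mean :: "nat \<Rightarrow> (nat \<Rightarrow> real^'q^'p) \<Rightarrow> real^'q^'p"
  where "sample_mean n x = (1 / real n) *\<^sub>R (\<Sum>i<n. x i)"

definition centered :: "nat \<Rightarrow> (nat \<Rightarrow> real^'q^'p) \<Rightarrow> nat \<Rightarrow> real^'q^'p"
  where "centered n x i = x i - sample_mean n x"

definition S_left :: "nat \<Rightarrow> (nat \<Rightarrow> real^'q^'p) \<Rightarrow> real^'p^'p"
  where "S_left n x =
    (1 / (real n * real CARD('q))) *\<^sub>R (\<Sum>i<n. centered n x i ** transpose (centered n x i))"

definition S_right :: "nat \<Rightarrow> (nat \<Rightarrow> real^'q^'p) \<Rightarrow> real^'q^'q"
  where "S_right n x =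
    (1 / (real n * real CARD('p))) *\<^sub>R (\<Sum>i<n. transpose (centered n x i) ** centered n x i)"

definition standardizable :: "nat \<Rightarrow> (nat \<Rightarrow> real^'q^'p) \<Rightarrow> bool"
  where "standardizable n x \<longleftrightarrow> pos_def_matrix (S_left n x) \<and> pos_def_matrix (S_right n x)"

definition standardized :: "nat \<Rightarrow> (nat \<Rightarrow> real^'q^'p) \<Rightarrow> nat \<Rightarrow> real^'q^'p"
  where "standardized n x i =
    inv_sqrt_matrix (S_left n x) ** centered n x i ** transpose (inv_sqrt_matrix (S_right n x))"

definition B0_left :: "nat \<Rightarrow> (nat \<Rightarrow> real^'q^'p) \<Rightarrow> real^'p^'p"
  where "B0_left n x =
    (1 / (real n * real CARD('q))) *\<^sub>R
      (\<Sum>i<n. let Y = standardized n x i in Y ** transpose Y ** Y ** transpose Y)"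

text \<open>On \<open>real^'q^'p\<close> the library's \<open>norm\<close> is the Frobenius norm.\<close>

definition B1_left :: "nat \<Rightarrow> (nat \<Rightarrow> real^'q^'p) \<Rightarrow> real^'p^'p"
  where "B1_left n x =
    (1 / (real n * real CARD('q))) *\<^sub>R
      (\<Sum>i<n. let Y = standardized n x i in (norm Y)\<^sup>2 *\<^sub>R (Y ** transpose Y))"

definition B_left :: "nat \<Rightarrow> nat \<Rightarrow> (nat \<Rightarrow> real^'q^'p) \<Rightarrow> real^'p^'p"
  where "B_left N n x = (if N = 0 then B0_left n x else B1_left n x)"

text \<open>The columns of an orthogonal matrix are nonzero, so the condition below makes each of them
  an eigenvector.\<close>

definition left_MFOBI_estimate :: "nat \<Rightarrow> nat \<Rightarrow> (nat \<Rightarrow> real^'q^'p) \<Rightarrow> real^'p^'p \<Rightarrow> bool"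
  where "left_MFOBI_estimate N n x G \<longleftrightarrow>
    (\<exists>W. orthogonal_matrix W \<and>
         (\<forall>k. \<exists>c. B_left N n x *v column k W = c *\<^sub>R column k W) \<and>
         G = transpose W ** inv_sqrt_matrix (S_left n x))"

section \<open>Moments\<close>

definition gamma_mom :: "'w measure \<Rightarrow> ('w \<Rightarrow> real^'q^'p) \<Rightarrow> 'p \<Rightarrow> 'q \<Rightarrow> real"
  where "gamma_mom M Z k l = integral\<^sup>L M (\<lambda>\<omega>. (Z \<omega> $ k $ l) ^ 3)"

definition beta_mom :: "'w measure \<Rightarrow> ('w \<Rightarrow> real^'q^'p) \<Rightarrow> 'p \<Rightarrow> 'q \<Rightarrow> real"
  where "beta_mom M Z k l = integral\<^sup>L M (\<lambda>\<omega>. (Z \<omega> $ k $ l) ^ 4)"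

definition beta_row :: "'w measure \<Rightarrow> ('w \<Rightarrow> real^'q^'p) \<Rightarrow> 'p \<Rightarrow> real"
  where "beta_row M Z k = (1 / real CARD('q)) * (\<Sum>l\<in>UNIV. beta_mom M Z k l)"

definition beta_col :: "'w measure \<Rightarrow> ('w \<Rightarrow> real^'q^'p) \<Rightarrow> 'q \<Rightarrow> real"
  where "beta_col M Z l = (1 / real CARD('p)) * (\<Sum>k\<in>UNIV. beta_mom M Z k l)"

section \<open>Sample quantities of the limiting expansion\<close>

text \<open>These use the uncentered observations \<open>z\<close>, with divisor \<open>n\<close>. In \<open>q_bar2\<close>, \<open>g\<close> is the
  matrix of third moments.\<close>

definition s_bar :: "nat \<Rightarrow> (nat \<Rightarrow> real^'q^'p) \<Rightarrow> 'p \<Rightarrow> 'p \<Rightarrow> real"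
  where "s_bar n z k k' = (1 / real CARD('q)) *
    (\<Sum>l\<in>UNIV. (1 / real n) * (\<Sum>i<n. z i $ k $ l * z i $ k' $ l))"

definition q_bar2 :: "('p \<Rightarrow> 'q \<Rightarrow> real) \<Rightarrow> nat \<Rightarrow> (nat \<Rightarrow> real^'q^'p) \<Rightarrow> 'p \<Rightarrow> 'p \<Rightarrow> real"
  where "q_bar2 g n z k k' = (1 / real CARD('q)) *
    (\<Sum>l\<in>UNIV. (1 / real n) * (\<Sum>i<n. ((z i $ k $ l) ^ 3 - g k l) * z i $ k' $ l))"

definition q_bar3 :: "nat \<Rightarrow> (nat \<Rightarrow> real^'q^'p) \<Rightarrow> 'p \<Rightarrow> 'p \<Rightarrow> 'p \<Rightarrow> real"
  where "q_bar3 n z m k k' = (1 / real CARD('q)) *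
    (\<Sum>l\<in>UNIV. (1 / real n) * (\<Sum>i<n. (z i $ m $ l)\<^sup>2 * z i $ k $ l * z i $ k' $ l))"

definition r_bar2 :: "nat \<Rightarrow> (nat \<Rightarrow> real^'q^'p) \<Rightarrow> 'p \<Rightarrow> 'p \<Rightarrow> real"
  where "r_bar2 n z k k' = (1 / real CARD('q)) *
    (\<Sum>(l, l') \<in> {(l, l'). l \<noteq> l'}.
      (1 / real n) * (\<Sum>i<n. (z i $ k $ l)\<^sup>2 * z i $ k $ l' * z i $ k' $ l'))"

definition r0_bar3 :: "nat \<Rightarrow> (nat \<Rightarrow> real^'q^'p) \<Rightarrow> 'p \<Rightarrow> 'p \<Rightarrow> 'p \<Rightarrow> real"
  where "r0_bar3 n z m k k' = (1 / real CARD('q)) *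
    (\<Sum>(l, l') \<in> {(l, l'). l \<noteq> l'}.
      (1 / real n) * (\<Sum>i<n. z i $ k $ l * z i $ m $ l * z i $ m $ l' * z i $ k' $ l'))"

definition r1_bar3 :: "nat \<Rightarrow> (nat \<Rightarrow> real^'q^'p) \<Rightarrow> 'p \<Rightarrow> 'p \<Rightarrow> 'p \<Rightarrow> real"
  where "r1_bar3 n z m k k' = (1 / real CARD('q)) *
    (\<Sum>(l, l') \<in> {(l, l'). l \<noteq> l'}.
      (1 / real n) * (\<Sum>i<n. (z i $ m $ l)\<^sup>2 * z i $ k $ l' * z i $ k' $ l'))"

definition r_bar3 :: "nat \<Rightarrow> nat \<Rightarrow> (nat \<Rightarrow> real^'q^'p) \<Rightarrow> 'p \<Rightarrow> 'p \<Rightarrow> 'p \<Rightarrow> real"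
  where "r_bar3 N n z m k k' = (if N = 0 then r0_bar3 n z m k k' else r1_bar3 n z m k k')"

definition Q_bar :: "('p \<Rightarrow> 'q \<Rightarrow> real) \<Rightarrow> nat \<Rightarrow> (nat \<Rightarrow> real^'q^'p) \<Rightarrow> 'p \<Rightarrow> 'p \<Rightarrow> real"
  where "Q_bar g n z k k' =
    q_bar2 g n z k k' + q_bar2 g n z k' k + (\<Sum>m \<in> UNIV - {k, k'}. q_bar3 n z m k k')"

definition R_bar :: "nat \<Rightarrow> nat \<Rightarrow> (nat \<Rightarrow> real^'q^'p) \<Rightarrow> 'p \<Rightarrow> 'p \<Rightarrow> real"
  where "R_bar N n z k k' =
    r_bar2 n z k k' + r_bar2 n z k' k + (\<Sum>m \<in> UNIV - {k, k'}. r_bar3 N n z m k k')"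

definition b_const :: "nat \<Rightarrow> nat \<Rightarrow> nat \<Rightarrow> real"
  where "b_const N p q = (if N = 0 then 2 * real q + real p - 1 else real q * real p + 1)"

end

theory Submission
  imports Defs
begin

text \<open>All statistics are smooth functions of finitely many sample moments of order at most four, each
  of which is \<open>O\<^sub>P(n\<^bsup>-1/2\<^esup>)\<close>-close to its expectation by Chebyshev's inequality, so it suffices to
  carry first-order expansions through the definitions. The inverse square root has derivative
  \<open>D \<mapsto> - D / 2\<close> at the identity. The limit of \<open>B_left N\<close> is diagonal with the distinct entries
  \<open>beta_row k + const\<close>; at such a matrix \<open>\<Lambda>\<close> the orthogonal diagonaliser that is nearest to the
  identity has derivative \<open>E \<mapsto> (E\<^sub>i\<^sub>k / (\<Lambda>\<^sub>k - \<Lambda>\<^sub>i))\<^sub>i\<^sub>k\<close> off the diagonal and \<open>0\<close> on it. The first-order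
  effect of the right standardisation on the off-diagonal entries of \<open>B_left N\<close> vanishes because
  distinct rows are independent with mean zero. The estimate is measurable on the whole probability space since the nearest
  diagonaliser is chosen by a measurable selection.\<close>

text \<open>Origin of \<open>b_const\<close>: the left root \<open>A\<close> enters
  \<open>B_left N\<close> twice outside and once squared inside. To first order \<open>A\<close> is
  \<open>I - s/2\<close>. Off the diagonal the two outer copies multiply \<open>- s/2\<close> by the
  limiting eigenvalues \<Lambda>_k and \<Lambda>_k', and the inner square multiplies it by
  \<open>s_coeff N\<close>. After division by \<Lambda>_k - \<Lambda>_k', the remaining
  \<open>- s/2\<close> of the root in \<open>transpose W ** A\<close> is put over the same
  denominator. The total factor of \<open>- s/2\<close> is then \<open>s_coeff N\<close> +
  \<Lambda>_k + \<Lambda>_k' + (\<Lambda>_k - \<Lambda>_k'); the index k' cancels, and half of this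
  is \<open>beta_row k + b_const\<close>. The subtraction of \<open>gamma_mom\<close> in
  \<open>q_bar2\<close> is the trace left by centring at the sample mean.

  The obstacle is measurability for every sample size on the whole space, although the inverse roots
  exist only on an event and eigenvectors may jump. Each construction is therefore extended to a
  total Borel function, and the delta method is used in a form that asks for differentiability at a
  single point, within the symmetric matrices, and for no continuity elsewhere.\<close>

section \<open>Symmetric matrices\<close>

lemma norm_matrix_sq_rows: "(norm (A :: real^'n^'m))\<^sup>2 = (\<Sum>i\<in>UNIV. \<Sum>j\<in>UNIV. (A $ i $ j)\<^sup>2)"
  by (simp add: power2_norm_eq_inner inner_vec_def) (simp add: power2_eq_square)

lemma norm_matrix_sq_columns: "(norm (A :: real^'n^'m))\<^sup>2 = (\<Sum>j\<in>UNIV. (norm (column j A))\<^sup>2)"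
  unfolding norm_matrix_sq_rows
  by (subst sum.swap) (simp add: power2_norm_eq_inner inner_vec_def column_def, simp add: power2_eq_square)

lemma norm_matrix_le_columns:
  fixes A :: "real^'n^'m" and B :: "real^'n^'k"
  assumes "\<And>j. norm (column j A) \<le> norm (column j B)"
  shows "norm A \<le> norm B"
proof (rule power2_le_imp_le)
  show "(norm A)\<^sup>2 \<le> (norm B)\<^sup>2"
    unfolding norm_matrix_sq_columns by (intro sum_mono power_mono assms) auto
qed auto

lemma column_matrix_mult: "column j (A ** B) = A *v column j (B :: real^'n^'m)"
  by (simp add: column_def matrix_matrix_mult_def matrix_vector_mult_def vec_eq_iff)

lemma norm_matrix_mult_le:
  fixes A :: "real^'m^'k" and B :: "real^'n^'m"
  shows "norm (A ** B) \<le> norm A * norm B"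
proof (rule power2_le_imp_le)
  have "((A ** B) $ i $ j)\<^sup>2 \<le> (norm (A $ i))\<^sup>2 * (norm (column j B))\<^sup>2" for i j
  proof -
    have "(A ** B) $ i $ j = A $ i \<bullet> column j B"
      by (simp add: matrix_matrix_mult_def inner_vec_def column_def)
    then show ?thesis
      using Cauchy_Schwarz_ineq2[of "A $ i" "column j B"]
      by (metis abs_le_square_iff abs_mult abs_norm_cancel power_mult_distrib)
  qed
  then have "(norm (A ** B))\<^sup>2
      \<le> (\<Sum>i\<in>UNIV. \<Sum>j\<in>UNIV. (norm (A $ i))\<^sup>2 * (norm (column j B))\<^sup>2)"
    unfolding norm_matrix_sq_rows by (intro sum_mono)
  also have "\<dots> = (\<Sum>i\<in>UNIV. (norm (A $ i))\<^sup>2) * (norm B)\<^sup>2"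
    by (simp add: norm_matrix_sq_columns[of B] sum_product)
  also have "(\<Sum>i\<in>UNIV. (norm (A $ i))\<^sup>2) = (norm A)\<^sup>2"
    by (simp add: power2_norm_eq_inner inner_vec_def)
  finally show "(norm (A ** B))\<^sup>2 \<le> (norm A * norm B)\<^sup>2"
    by (simp add: power_mult_distrib)
qed auto

lemma continuous_on_matrix_mult [continuous_intros]:
  fixes f :: "'a::topological_space \<Rightarrow> real^'m^'k" and g :: "'a \<Rightarrow> real^'n^'m"
  assumes "continuous_on S f" "continuous_on S g"
  shows "continuous_on S (\<lambda>x. f x ** g x)"
  unfolding matrix_matrix_mult_def by (intro continuous_intros assms)

lemma continuous_on_transpose [continuous_intros]:
  fixes f :: "'a::topological_space \<Rightarrow> real^'m^'k"
  assumes "continuous_on S f"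
  shows "continuous_on S (\<lambda>x. transpose (f x))"
  unfolding transpose_def by (intro continuous_intros assms)

lemma symmetric_inner_commute:
  assumes "transpose (B :: real^'n^'n) = B"
  shows "x \<bullet> (B *v y) = y \<bullet> (B *v x)"
  by (metis assms dot_lmul_matrix inner_commute transpose_matrix_vector)

lemma matrix_cong_entry:
  "(transpose W ** B ** W) $ a $ b = column a (W :: real^'n^'n) \<bullet> (B *v column b W)"
proof -
  have "(transpose W ** B ** W) $ a $ b = (transpose W ** (B ** W)) $ a $ b"
    by (simp add: matrix_mul_assoc)
  also have "\<dots> = (\<Sum>j\<in>UNIV. transpose W $ a $ j * column b (B ** W) $ j)"
    by (simp add: matrix_matrix_mult_def column_def)
  also have "\<dots> = column a W \<bullet> (B *v column b W)"
    by (simp only: column_matrix_mult) (simp add: inner_vec_def column_def transpose_def)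
  finally show ?thesis .
qed

lemma compact_orthogonal_matrices: "compact {W :: real^'n^'n. orthogonal_matrix W}"
proof -
  have "closed {W :: real^'n^'n. transpose W ** W = mat 1}"
    by (intro closed_Collect_eq continuous_intros)
  moreover have "norm W \<le> sqrt (real CARD('n))" if "orthogonal_matrix W" for W :: "real^'n^'n"
    using that by (intro real_le_rsqrt)
      (simp add: norm_matrix_sq_columns orthogonal_matrix_orthonormal_columns)
  then have "bounded {W :: real^'n^'n. orthogonal_matrix W}"
    by (auto intro!: boundedI)
  ultimately show ?thesis
    by (simp add: compact_eq_bounded_closed orthogonal_matrix)
qed

text \<open>Stated through polynomial equations in \<open>B\<close> and \<open>W\<close>, with no
  quantified eigenvalue, so that closedness in the pair is immediate.\<close>

definition diagonalizers :: "real^'n^'n \<Rightarrow> (real^'n^'n) set"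
  where "diagonalizers B =
    {W. orthogonal_matrix W \<and> (\<forall>i j. i \<noteq> j \<longrightarrow> (transpose W ** B ** W) $ i $ j = 0)}"

text \<open>Spectral theorem. A maximiser over the orthogonal group of \<open>\<Sum>k. c k * (W\<^sup>T B W)\<^sub>k\<^sub>k\<close>, for
  distinct weights \<open>c\<close>, diagonalises \<open>B\<close>: the derivative along the rotation in the plane of the
  columns \<open>i\<close> and \<open>j\<close> is \<open>2 * (c i - c j) * (W\<^sup>T B W)\<^sub>i\<^sub>j\<close>.\<close>

lemma diagonalizers_nonempty:
  fixes B :: "real^'n^'n"
  assumes sym: "transpose B = B"
  shows "diagonalizers B \<noteq> {}"
proof -
  obtain c0 :: "'n \<Rightarrow> nat" where "inj c0"
    using finite_imp_inj_to_nat_seg[of "UNIV :: 'n set"] by auto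
  define c where "c k = real (c0 k)" for k
  have c: "c i \<noteq> c j" if "i \<noteq> j" for i j
    using that \<open>inj c0\<close> by (auto simp: c_def inj_def)
  define \<phi> where "\<phi> W = (\<Sum>k\<in>UNIV. c k * (transpose W ** B ** W) $ k $ k)" for W
  have "continuous_on {W :: real^'n^'n. orthogonal_matrix W} \<phi>"
    unfolding \<phi>_def by (intro continuous_intros)
  moreover have "{W :: real^'n^'n. orthogonal_matrix W} \<noteq> {}"
    using orthogonal_matrix_id by blast
  ultimately obtain W where W: "orthogonal_matrix W"
    and max: "\<And>V. orthogonal_matrix V \<Longrightarrow> \<phi> V \<le> \<phi> W"
    using continuous_attains_sup[OF compact_orthogonal_matrices, of \<phi>] by auto
  define w where "w k = column k W" for k
  have w: "w a \<bullet> w b = (if a = b then 1 else 0)" for a b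
    using W unfolding orthogonal_matrix_orthonormal_columns w_def
    by (auto simp: orthogonal_def dot_square_norm)
  have "(transpose W ** B ** W) $ i $ j = 0" if "i \<noteq> j" for i j
  proof -
    define b where "b a b' = w a \<bullet> (B *v w b')" for a b'
    have bsym: "b a b' = b b' a" for a b'
      unfolding b_def using sym by (rule symmetric_inner_commute)
    define u where "u t k = (if k = i then cos t *\<^sub>R w i + sin t *\<^sub>R w j
      else if k = j then - sin t *\<^sub>R w i + cos t *\<^sub>R w j else w k)" for t k
    \<comment> \<open>The gain of the objective after a rotation by the angle \<open>t\<close>; only
      the two rotated columns contribute, and \<open>f 0 = 0\<close>.\<close>
    define f where "f t = (c i - c j) * (2 * sin t * cos t * b i j + (sin t)\<^sup>2 * (b j j - b i i))" for t
    have le: "f t \<le> f 0" for t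
    proof -
      define V where "V = (\<chi> r k. u t k $ r)"
      have col: "column k V = u t k" for k
        by (simp add: V_def column_def vec_eq_iff)
      have "cos t * cos t + sin t * sin t = 1"
        using sin_cos_squared_add2[of t] by (simp add: power2_eq_square)
      then have "u t k \<bullet> u t k' = (if k = k' then 1 else 0)" for k k'
        using \<open>i \<noteq> j\<close>
        by (auto simp: u_def w inner_add_left inner_add_right algebra_simps)
      then have "orthogonal_matrix V"
        unfolding orthogonal_matrix_orthonormal_columns col
        by (auto simp: orthogonal_def norm_eq_1)
      then have "\<phi> V \<le> \<phi> W" by (rule max)
      have "\<phi> V - \<phi> W = (\<Sum>k\<in>UNIV. c k * (u t k \<bullet> (B *v u t k) - b k k))"
        unfolding \<phi>_def matrix_cong_entry col b_def w_def
        by (simp add: sum_subtractf right_diff_distrib)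
      also have "\<dots> = (\<Sum>k\<in>{i, j}. c k * (u t k \<bullet> (B *v u t k) - b k k))"
        by (rule sum.mono_neutral_right) (auto simp: u_def b_def)
      also have "\<dots> = c i * ((cos t)\<^sup>2 * b i i + 2 * sin t * cos t * b i j + (sin t)\<^sup>2 * b j j - b i i)
          + c j * ((sin t)\<^sup>2 * b i i - 2 * sin t * cos t * b i j + (cos t)\<^sup>2 * b j j - b j j)"
        using \<open>i \<noteq> j\<close> bsym[of i j]
        by (simp add: u_def b_def[symmetric] matrix_vector_right_distrib inner_add_left
          inner_add_right matrix_vector_mult_scaleR power2_eq_square algebra_simps
          matrix_vector_mult_diff_distrib inner_diff_left inner_diff_right)
      also have "\<dots> = f t"
        by (simp add: f_def cos_squared_eq algebra_simps)
      finally show ?thesis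
        using \<open>\<phi> V \<le> \<phi> W\<close> by (simp add: f_def)
    qed
    have "(f has_real_derivative (c i - c j) * (2 * b i j)) (at 0)"
      unfolding f_def by (auto intro!: derivative_eq_intros)
    then have "(c i - c j) * (2 * b i j) = 0"
      by (rule DERIV_local_max[where d = 1]) (use le in auto)
    then show ?thesis
      using c[OF \<open>i \<noteq> j\<close>] by (simp add: matrix_cong_entry b_def w_def)
  qed
  then show ?thesis
    using W by (auto simp: diagonalizers_def)
qed

lemma diagonalizers_eigenvector:
  assumes "W \<in> diagonalizers B"
  shows "B *v column k W = (transpose W ** B ** W) $ k $ k *\<^sub>R column k W"
proof -
  let ?D = "transpose W ** B ** W"
  have "W ** transpose W = mat 1"
    using assms by (auto simp: diagonalizers_def orthogonal_matrix_def)
  then have "B ** W = W ** ?D"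
    by (simp add: matrix_mul_assoc)
  then have "B *v column k W = W *v column k ?D"
    by (metis column_matrix_mult)
  also have "\<dots> = ?D $ k $ k *\<^sub>R column k W"
  proof (subst vec_eq_iff, intro allI)
    fix r
    have "(W *v column k ?D) $ r = (\<Sum>j\<in>UNIV. W $ r $ j * ?D $ j $ k)"
      by (simp add: matrix_vector_mult_def column_def)
    also have "\<dots> = (\<Sum>j\<in>{k}. W $ r $ j * ?D $ j $ k)"
      by (rule sum.mono_neutral_right) (use assms in \<open>auto simp: diagonalizers_def\<close>)
    finally show "(W *v column k ?D) $ r = (?D $ k $ k *\<^sub>R column k W) $ r"
      by (simp add: column_def)
  qed
  finally show ?thesis .
qed

lemma matrix_eq_0_if_columns:
  fixes C W :: "real^'n^'n"
  assumes "orthogonal_matrix W" "\<And>k. C *v column k W = 0"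
  shows "C = 0"
proof -
  have "C ** W = 0"
    using assms(2) column_matrix_mult[of _ C W]
    by (simp add: vec_eq_iff column_def)
  then have "C ** (W ** transpose W) = 0"
    by (simp add: matrix_mul_assoc)
  then show ?thesis
    using assms(1) by (simp add: orthogonal_matrix_def)
qed

section \<open>The inverse square root\<close>

text \<open>Let \<open>x\<close> be a unit eigenvector of \<open>R - S\<close> with eigenvalue
  \<mu>. Equal squares give \<open>R *v x\<close> and \<open>S *v x\<close> the same length, so
  their difference \<mu> \<open>x\<close> is orthogonal to their sum. As \<open>S\<close>
  contributes a positive amount to the inner product of \<open>x\<close> with that sum, \<mu> is 0,
  and \<open>R - S\<close> vanishes on an orthonormal basis.\<close>

lemma psd_pd_square_root_unique:
  fixes R S :: "real^'n^'n"
  assumes R: "transpose R = R" "\<And>v. v \<bullet> (R *v v) \<ge> 0"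
    and S: "pos_def_matrix S" and eq: "R ** R = S ** S"
  shows "R = S"
proof -
  have symS: "transpose S = S" using S by (simp add: pos_def_matrix_def)
  have "transpose (R - S) = R - S"
    using R(1) symS by (simp add: transpose_def vec_eq_iff)
  then obtain W where W: "W \<in> diagonalizers (R - S)"
    using diagonalizers_nonempty by blast
  then have orth: "orthogonal_matrix W" by (simp add: diagonalizers_def)
  have "(R - S) *v column k W = 0" for k
  proof -
    define x where "x = column k W"
    define \<mu> where "\<mu> = (transpose W ** (R - S) ** W) $ k $ k"
    have "norm x = 1"
      using orth by (simp add: x_def orthogonal_matrix_orthonormal_columns)
    then have "x \<noteq> 0" by auto
    then have "x \<bullet> (S *v x) > 0"
      using S by (simp add: pos_def_matrix_def)
    then have pos: "x \<bullet> (R *v x) + x \<bullet> (S *v x) > 0"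
      using R(2)[of x] by linarith
    have ev: "R *v x - S *v x = \<mu> *\<^sub>R x"
      using diagonalizers_eigenvector[OF W, of k]
      by (simp add: x_def \<mu>_def matrix_vector_mult_diff_rdistrib)
    have "(R *v x) \<bullet> (R *v x) = x \<bullet> ((R ** R) *v x)" "(S *v x) \<bullet> (S *v x) = x \<bullet> ((S ** S) *v x)"
      using R(1) symS by (metis symmetric_inner_commute matrix_vector_mul_assoc)+
    then have "(R *v x) \<bullet> (R *v x) = (S *v x) \<bullet> (S *v x)"
      using eq by simp
    then have "(R *v x - S *v x) \<bullet> (R *v x + S *v x) = 0"
      by (simp add: algebra_simps inner_commute)
    then have "\<mu> * (x \<bullet> (R *v x) + x \<bullet> (S *v x)) = 0"
      by (simp add: ev inner_add_right distrib_left)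
    then show ?thesis
      using pos ev by (simp add: x_def matrix_vector_mult_diff_rdistrib)
  qed
  then have "R - S = 0"
    by (rule matrix_eq_0_if_columns[OF orth])
  then show ?thesis by simp
qed

lemma matrix_inv_eqI:
  fixes A X :: "real^'n^'n"
  assumes "X ** A = mat 1"
  shows "matrix_inv A = X"
proof -
  have AX: "A ** X = mat 1"
    using assms matrix_left_right_inverse by blast
  have "A ** matrix_inv A = mat 1 \<and> matrix_inv A ** A = mat 1"
    unfolding matrix_inv_def by (rule someI[of _ X]) (simp add: AX assms)
  then have "X ** (A ** matrix_inv A) = X" by simp
  then show ?thesis
    by (simp add: matrix_mul_assoc assms)
qed

text \<open>In an orthonormal eigenbasis the root is the diagonal matrix of the reciprocal square
  roots of the eigenvalues.\<close>

lemma inv_sqrt_matrix_exists: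
  fixes A :: "real^'n^'n"
  assumes A: "pos_def_matrix A"
  shows "\<exists>R. pos_def_matrix R \<and> R ** R ** A = mat 1"
proof -
  obtain W where W: "W \<in> diagonalizers A"
    using A diagonalizers_nonempty by (auto simp: pos_def_matrix_def)
  then have orth: "W ** transpose W = mat 1" "transpose W ** W = mat 1"
    and orthW: "orthogonal_matrix W"
    by (auto simp: diagonalizers_def orthogonal_matrix_def)
  define D where "D = transpose W ** A ** W"
  define diag where "diag d = (\<chi> i j. if i = j then d i else 0)" for d :: "'n \<Rightarrow> real"
  have diag_mult: "diag d ** diag e = diag (\<lambda>i. d i * e i)" for d e
    by (simp add: diag_def matrix_matrix_mult_def vec_eq_iff if_distrib[of "\<lambda>x. x * _"]
      cong: if_cong)
  define \<mu> where "\<mu> k = D $ k $ k" for k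
  have D: "D = diag \<mu>"
    using W by (auto simp: diag_def vec_eq_iff \<mu>_def D_def diagonalizers_def)
  have pos: "\<mu> k > 0" for k
  proof -
    have "norm (column k W) = 1"
      using orthW by (simp add: orthogonal_matrix_orthonormal_columns)
    then have "column k W \<noteq> 0" by auto
    then show ?thesis
      using A by (simp add: \<mu>_def D_def matrix_cong_entry pos_def_matrix_def)
  qed
  define E where "E = diag (\<lambda>k. 1 / sqrt (\<mu> k))"
  define R where "R = W ** E ** transpose W"
  have nonzero: "\<mu> k \<noteq> 0" for k using pos[of k] by simp
  have "E ** E ** D = mat 1"
    using nonzero abs_of_pos[OF pos]
    by (simp add: E_def D diag_mult) (simp add: diag_def mat_def vec_eq_iff)
  moreover have "W ** D ** transpose W = A"
  proof -
    have "W ** D ** transpose W = (W ** transpose W) ** A ** (W ** transpose W)"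
      by (simp add: D_def matrix_mul_assoc)
    then show ?thesis by (simp add: orth)
  qed
  moreover have "R ** R ** (W ** D ** transpose W) = W ** (E ** E ** D) ** transpose W"
    using orth(2) by (metis R_def matrix_mul_assoc matrix_mul_lid)
  ultimately have "R ** R ** A = mat 1"
    by (simp add: orth)
  moreover have "pos_def_matrix R"
    unfolding pos_def_matrix_def
  proof (intro conjI allI impI)
    have "transpose E = E"
      by (auto simp: E_def diag_def transpose_def vec_eq_iff)
    then show "transpose R = R"
      by (simp add: R_def matrix_transpose_mul matrix_mul_assoc)
    fix v :: "real^'n" assume "v \<noteq> 0"
    define y where "y = transpose W *v v"
    have "W *v y = v"
      unfolding y_def by (simp only: matrix_vector_mul_assoc orth matrix_vector_mul_lid)
    then have "y \<noteq> 0" using \<open>v \<noteq> 0\<close> by auto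
    then obtain k where k: "y $ k \<noteq> 0" by (auto simp: vec_eq_iff)
    have "v \<bullet> (R *v v) = v \<bullet> (W *v (E *v y))"
      unfolding R_def y_def by (simp only: matrix_vector_mul_assoc matrix_mul_assoc)
    also have "\<dots> = y \<bullet> (E *v y)"
      by (metis y_def dot_lmul_matrix transpose_matrix_vector)
    also have "\<dots> = (\<Sum>i\<in>UNIV. (y $ i)\<^sup>2 / sqrt (\<mu> i))"
      by (simp add: E_def diag_def matrix_vector_mult_def inner_vec_def if_distrib[of "\<lambda>x. x * _"]
          power2_eq_square cong: if_cong)
    also have "\<dots> > 0"
      by (rule sum_pos2[of _ k]) (use k pos less_imp_le[OF pos] in simp_all)
    finally show "v \<bullet> (R *v v) > 0" .
  qed
  ultimately show ?thesis by blast
qed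

lemma inv_sqrt_matrix_props:
  assumes A: "pos_def_matrix A"
  shows "pos_def_matrix (inv_sqrt_matrix A)" "inv_sqrt_matrix A ** inv_sqrt_matrix A ** A = mat 1"
proof -
  obtain R where R: "pos_def_matrix R" "R ** R ** A = mat 1"
    using inv_sqrt_matrix_exists[OF A] by blast
  have inv: "matrix_inv A = R ** R"
    using R(2) by (rule matrix_inv_eqI)
  have "S = R" if "pos_def_matrix S" "S ** S = R ** R" for S
  proof (rule psd_pd_square_root_unique[OF _ _ R(1) that(2)])
    show "transpose S = S" using that by (simp add: pos_def_matrix_def)
    show "v \<bullet> (S *v v) \<ge> 0" for v
      using that(1) by (cases "v = 0") (auto simp: pos_def_matrix_def less_imp_le)
  qed
  then have "inv_sqrt_matrix A = R"
    unfolding inv_sqrt_matrix_def inv using R(1) by (intro the_equality) auto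
  then show "pos_def_matrix (inv_sqrt_matrix A)" "inv_sqrt_matrix A ** inv_sqrt_matrix A ** A = mat 1"
    using R by auto
qed

text \<open>The conditions that tie \<open>R\<close> to \<open>A\<close> are equations and weak
  inequalities, hence closed. This gives the inverse root a closed graph over the positive definite
  matrices, on which its measurability rests.\<close>

lemma inv_sqrt_matrix_unique:
  assumes A: "pos_def_matrix A" and R: "transpose R = R" "\<And>v. v \<bullet> (R *v v) \<ge> 0" "R ** R ** A = mat 1"
  shows "R = inv_sqrt_matrix A"
proof (rule psd_pd_square_root_unique[OF R(1,2) inv_sqrt_matrix_props(1)[OF A]])
  show "R ** R = inv_sqrt_matrix A ** inv_sqrt_matrix A"
    using matrix_inv_eqI[OF R(3)] matrix_inv_eqI[OF inv_sqrt_matrix_props(2)[OF A]] by simp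
qed

text \<open>The junk value \<open>mat 1\<close> outside the positive definite matrices makes this total function
  Borel measurable and differentiable at \<open>mat 1\<close> within the symmetric matrices.\<close>

definition inv_sqrt_total :: "real^'n^'n \<Rightarrow> real^'n^'n"
  where "inv_sqrt_total S = (if pos_def_matrix S then inv_sqrt_matrix S else mat 1)"

lemma transpose_inv_sqrt_total: "transpose (inv_sqrt_total S) = inv_sqrt_total S"
  using inv_sqrt_matrix_props(1)[of S]
  by (auto simp: inv_sqrt_total_def pos_def_matrix_def)

lemma borel_measurable_closed_vimage:
  fixes f :: "'a \<Rightarrow> 'b::topological_space"
  assumes "\<And>A. closed A \<Longrightarrow> {x \<in> space M. f x \<in> A} \<in> sets M"
  shows "f \<in> borel_measurable M"
proof (rule borel_measurableI)
  fix S :: "'b set" assume "open S"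
  then have "{x \<in> space M. f x \<in> - S} \<in> sets M"
    by (intro assms) auto
  then have "space M - {x \<in> space M. f x \<in> - S} \<in> sets M"
    by blast
  moreover have "f -` S \<inter> space M = space M - {x \<in> space M. f x \<in> - S}"
    by auto
  ultimately show "f -` S \<inter> space M \<in> sets M" by simp
qed

text \<open>Failure of positivity at some unit vector is the projection of a closed set along the
  compact sphere, hence closed. The positive definite matrices are thus a difference of two closed
  sets.\<close>

lemma borel_pos_def: "{A :: real^'n^'n. pos_def_matrix A} \<in> sets borel"
proof -
  let ?C = "{A :: real^'n^'n. \<exists>v. v \<in> sphere 0 1 \<and> (v, A) \<in> {(v, A). v \<bullet> (A *v v) \<le> 0}}"
  have "closed {z :: (real^'n) \<times> (real^'n^'n). fst z \<bullet> (snd z *v fst z) \<le> 0}"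
    unfolding matrix_vector_mult_def inner_vec_def by (intro closed_Collect_le continuous_intros)
  then have "closed ?C"
    by (intro closed_compact_projection) (simp_all add: case_prod_beta')
  moreover have "closed {A :: real^'n^'n. transpose A = A}"
    by (intro closed_Collect_eq continuous_intros)
  moreover have "{A :: real^'n^'n. pos_def_matrix A} = {A. transpose A = A} - ?C"
  proof (intro set_eqI iffI)
    fix A :: "real^'n^'n" assume A: "A \<in> {A. transpose A = A} - ?C"
    have "v \<bullet> (A *v v) > 0" if "v \<noteq> 0" for v
    proof -
      define u where "u = (1 / norm v) *\<^sub>R v"
      have "u \<in> sphere 0 1" using that by (simp add: u_def)
      then have "u \<bullet> (A *v u) > 0" using A by force
      then show ?thesis
        using that by (simp add: u_def matrix_vector_mult_scaleR zero_less_mult_iff zero_less_divide_iff)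
    qed
    then show "A \<in> {A. pos_def_matrix A}"
      using A by (simp add: pos_def_matrix_def)
  next
    fix A :: "real^'n^'n" assume A: "A \<in> {A. pos_def_matrix A}"
    have "v \<bullet> (A *v v) > 0" if "norm v = 1" for v
    proof -
      have "v \<noteq> 0" using that by auto
      then show ?thesis using A by (simp add: pos_def_matrix_def)
    qed
    then show "A \<in> {A. transpose A = A} - ?C"
      using A by (fastforce simp: pos_def_matrix_def)
  qed
  ultimately show ?thesis
    by (simp add: borel_closed sets.Diff)
qed

text \<open>Over the positive definite matrices the preimage of a closed set is a projection of the
  closed relation \<open>T\<close>. Since the inverse root is unbounded, the target is exhausted by
  balls, each giving a projection along a compact set, and the preimage becomes a countable union of
  closed sets \<open>C k\<close>.\<close>

lemma borel_measurable_inv_sqrt_total: "(inv_sqrt_total :: real^'n^'n \<Rightarrow> _) \<in> borel_measurable borel"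
proof (rule borel_measurable_closed_vimage)
  fix A :: "(real^'n^'n) set" assume "closed A"
  let ?P = "{S :: real^'n^'n. pos_def_matrix S}"
  define T where "T = {z :: (real^'n^'n) \<times> (real^'n^'n). transpose (fst z) = fst z
    \<and> (\<forall>v. v \<bullet> (fst z *v v) \<ge> 0) \<and> fst z ** fst z ** snd z = mat 1}"
  have "closed T"
    unfolding T_def matrix_vector_mult_def inner_vec_def
    by (intro closed_Collect_eq closed_Collect_le closed_Collect_all closed_Collect_conj continuous_intros)
  define C where "C k = {S. \<exists>R. R \<in> A \<inter> cball 0 (real k) \<and> (R, S) \<in> T}" for k
  have C: "closed (C k)" for k
    unfolding C_def
    by (intro closed_compact_projection \<open>closed T\<close>) (use \<open>closed A\<close> in auto)
  have pd: "inv_sqrt_matrix S \<in> A \<longleftrightarrow> S \<in> (\<Union>k. C k)" if S: "pos_def_matrix S" for S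
  proof
    assume "inv_sqrt_matrix S \<in> A"
    moreover obtain k where "norm (inv_sqrt_matrix S) \<le> real k"
      using real_arch_simple by blast
    moreover have "v \<bullet> (inv_sqrt_matrix S *v v) \<ge> 0" for v
      using inv_sqrt_matrix_props(1)[OF S] by (cases "v = 0") (auto simp: pos_def_matrix_def less_imp_le)
    then have "(inv_sqrt_matrix S, S) \<in> T"
      using inv_sqrt_matrix_props[OF S] by (simp add: T_def pos_def_matrix_def)
    ultimately show "S \<in> (\<Union>k. C k)"
      unfolding C_def by auto
  next
    assume "S \<in> (\<Union>k. C k)"
    then obtain R where "R \<in> A" "(R, S) \<in> T"
      by (auto simp: C_def)
    then show "inv_sqrt_matrix S \<in> A"
      using inv_sqrt_matrix_unique[OF S, of R] by (auto simp: T_def)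
  qed
  have "{S \<in> space borel. inv_sqrt_total S \<in> A}
    = ?P \<inter> (\<Union>k. C k) \<union> (if mat 1 \<in> A then - ?P else {})"
    using pd by (auto simp: inv_sqrt_total_def split: if_splits)
  moreover have "?P \<inter> (\<Union>k. C k) \<in> sets borel"
    using C borel_pos_def by (intro sets.Int sets.countable_UN) (auto intro: borel_closed)
  ultimately show "{S \<in> space borel. inv_sqrt_total S \<in> A} \<in> sets borel"
    using borel_pos_def by (auto intro!: sets.Un borel_comp)
qed

lemma pos_def_matrix_near_1:
  fixes S :: "real^'n^'n"
  assumes sym: "transpose S = S" and near: "norm (S - mat 1) < 1"
  shows "pos_def_matrix S"
  unfolding pos_def_matrix_def
proof (intro conjI allI impI sym)
  fix v :: "real^'n" assume "v \<noteq> 0"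
  have "norm ((S - mat 1) *v v) \<le> norm (S - mat 1) * norm v"
  proof -
    \<comment> \<open>Viewing \<open>v\<close> as a matrix with one column makes the
      submultiplicativity of the Frobenius norm applicable to a matrix-vector product.\<close>
    have "norm ((S - mat 1) *v v) = norm ((S - mat 1) ** (columnvector v :: real^1^'n))"
      by (intro antisym)
        (auto simp: norm_eq_sqrt_inner inner_vec_def columnvector_def matrix_matrix_mult_def matrix_vector_mult_def)
    also have "\<dots> \<le> norm (S - mat 1) * norm (columnvector v :: real^1^'n)"
      by (rule norm_matrix_mult_le)
    also have "norm (columnvector v :: real^1^'n) = norm v"
      by (simp add: norm_eq_sqrt_inner inner_vec_def columnvector_def)
    finally show ?thesis .
  qed
  then have "\<bar>v \<bullet> ((S - mat 1) *v v)\<bar> \<le> norm v * (norm (S - mat 1) * norm v)"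
    by (meson Cauchy_Schwarz_ineq2 mult_left_mono norm_ge_zero order_trans)
  also have "\<dots> < norm v * norm v"
    using near \<open>v \<noteq> 0\<close> by simp
  also have "\<dots> = v \<bullet> v"
    by (simp add: dot_square_norm power2_eq_square)
  finally have "\<bar>v \<bullet> ((S - mat 1) *v v)\<bar> < v \<bullet> v" .
  then show "v \<bullet> (S *v v) > 0"
    by (simp add: matrix_vector_mult_diff_rdistrib inner_diff_right)
qed

lemma matrix_add_rdistrib:
  fixes A B :: "'a::semiring_1^'m^'k" and C :: "'a^'n^'m"
  shows "(A + B) ** C = A ** C + B ** C"
  by (simp add: vec_eq_iff matrix_matrix_mult_def sum.distrib distrib_right)

text \<open>With \<open>R = S\<^bsup>-1/2\<^esup>\<close>, \<open>\<Delta> = S - I\<close>, \<open>g = R\<^sup>2 - I\<close>, \<open>a = R - I\<close>: from \<open>(I + g) (I + \<Delta>) = I\<close> one has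
  \<open>g + \<Delta> = - g \<Delta>\<close>, and \<open>(R + I) a = g\<close> with \<open>R + I \<ge> I\<close> bounds \<open>a\<close> by \<open>g\<close>.\<close>

lemma inv_sqrt_total_expansion:
  fixes S :: "real^'n^'n"
  assumes sym: "transpose S = S" and near: "norm (S - mat 1) \<le> 1/2"
  shows "norm (inv_sqrt_total S - mat 1 + (1/2) *\<^sub>R (S - mat 1)) \<le> 3 * (norm (S - mat 1))\<^sup>2"
proof -
  have S: "pos_def_matrix S"
    using pos_def_matrix_near_1[OF sym] near by simp
  define R where "R = inv_sqrt_total S"
  have R: "pos_def_matrix R" "R ** R ** S = mat 1"
    using inv_sqrt_matrix_props[OF S] S by (auto simp: R_def inv_sqrt_total_def)
  define \<Delta> where "\<Delta> = S - mat 1"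
  define g where "g = R ** R - mat 1"
  define a where "a = R - mat 1"
  have 1: "g + \<Delta> = - (g ** \<Delta>)"
  proof -
    have "(mat 1 + g) ** (mat 1 + \<Delta>) = mat 1"
      using R(2) by (simp add: g_def \<Delta>_def)
    moreover have "(mat 1 + g) ** (mat 1 + \<Delta>) = mat 1 + g + (\<Delta> + g ** \<Delta>)"
      by (simp only: matrix_add_ldistrib matrix_add_rdistrib matrix_mul_lid matrix_mul_rid)
    ultimately have "g + \<Delta> + g ** \<Delta> = 0"
      by (metis add.assoc add_cancel_left_right)
    then show ?thesis
      by (simp only: eq_neg_iff_add_eq_0)
  qed
  have 2: "g = 2 *\<^sub>R a + a ** a"
  proof -
    have "R ** R = (mat 1 + a) ** (mat 1 + a)" by (simp add: a_def)
    also have "\<dots> = mat 1 + a + (a + a ** a)"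
      by (simp only: matrix_add_ldistrib matrix_add_rdistrib matrix_mul_lid matrix_mul_rid)
    finally show ?thesis by (simp add: g_def scaleR_2)
  qed
  have le: "norm a \<le> norm g"
  proof (rule norm_matrix_le_columns)
    fix j
    define x where "x = column j a"
    have "R + mat 1 = 2 *\<^sub>R mat 1 + a"
      by (simp add: a_def scaleR_2)
    then have "g = (R + mat 1) ** a"
      unfolding 2 by (simp add: matrix_add_rdistrib scalar_matrix_assoc[symmetric])
    then have "column j g = R *v x + x"
      by (simp add: column_matrix_mult x_def matrix_vector_mult_add_rdistrib)
    moreover have "(norm x)\<^sup>2 \<le> (norm (R *v x + x))\<^sup>2"
    proof -
      have "x \<bullet> (R *v x) \<ge> 0"
        using R(1) by (cases "x = 0") (auto simp: pos_def_matrix_def less_imp_le)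
      moreover have "(norm (R *v x + x))\<^sup>2 = (norm (R *v x))\<^sup>2 + 2 * (x \<bullet> (R *v x)) + (norm x)\<^sup>2"
        by (simp add: power2_norm_eq_inner inner_add_left inner_add_right inner_commute)
      ultimately show ?thesis by simp
    qed
    ultimately show "norm (column j a) \<le> norm (column j g)"
      by (metis norm_ge_zero power2_le_imp_le x_def)
  qed
  define d where "d = norm \<Delta>"
  have d: "0 \<le> d" "d \<le> 1/2" using near by (auto simp: d_def \<Delta>_def)
  have gD: "norm (g ** \<Delta>) \<le> norm g * d"
    by (simp add: d_def norm_matrix_mult_le)
  have "norm g = norm (- (g ** \<Delta>) - \<Delta>)"
    by (simp only: 1[symmetric] add_diff_cancel_right')
  also have "\<dots> \<le> norm (g ** \<Delta>) + d"
    unfolding d_def by (metis norm_minus_cancel norm_triangle_ineq4)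
  finally have "norm g \<le> d + norm g * d"
    using gD by linarith
  moreover have "norm g * d \<le> norm g * (1/2)" by (intro mult_left_mono d) auto
  ultimately have g2: "norm g \<le> 2 * d" by simp
  have "g ** \<Delta> + a ** a = - (2 *\<^sub>R a + \<Delta>)"
  proof -
    have "g ** \<Delta> = - (g + \<Delta>)" by (simp only: 1 minus_minus)
    then show ?thesis by (simp add: 2)
  qed
  then have "norm (g ** \<Delta> + a ** a) = norm (2 *\<^sub>R (a + (1/2) *\<^sub>R \<Delta>))"
    by (simp only: norm_minus_cancel scaleR_add_right) simp
  then have "norm (a + (1/2) *\<^sub>R \<Delta>) = norm (g ** \<Delta> + a ** a) / 2" by simp
  moreover have "norm (g ** \<Delta> + a ** a) \<le> norm (g ** \<Delta>) + norm (a ** a)"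
    by (rule norm_triangle_ineq)
  moreover have "norm g * d \<le> 2 * d * d"
    using g2 d(1) by (rule mult_right_mono)
  moreover have "norm (a ** a) \<le> (2 * d) * (2 * d)"
  proof -
    have "norm a \<le> 2 * d" using le g2 by linarith
    then have "norm a * norm a \<le> (2 * d) * (2 * d)" by (intro mult_mono) (use d in auto)
    then show ?thesis using norm_matrix_mult_le[of a a] by linarith
  qed
  \<comment> \<open>The constant 3 is half of 2 + 4: the product \<open>g ** \<Delta>\<close> is at
    most \<open>2 * d * d\<close> and the square \<open>a ** a\<close> at most
    \<open>4 * d * d\<close>.\<close>
  ultimately have "norm (a + (1/2) *\<^sub>R \<Delta>) \<le> 3 * (d * d)"
    using gD by linarith
  then show ?thesis
    by (simp only: R_def[symmetric] a_def \<Delta>_def[symmetric] d_def[symmetric] power2_eq_square)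
qed

lemma has_derivative_inv_sqrt_total:
  "((inv_sqrt_total :: real^'n^'n \<Rightarrow> _) has_derivative (\<lambda>D. - ((1/2) *\<^sub>R D)))
    (at (mat 1) within {S. transpose S = S})"
proof -
  have one: "inv_sqrt_total (mat 1 :: real^'n^'n) = mat 1"
    using inv_sqrt_total_expansion[of "mat 1 :: real^'n^'n"] by simp
  have "bounded_linear (\<lambda>D :: real^'n^'n. - ((1/2) *\<^sub>R D))"
    by (intro bounded_linear_minus bounded_linear_scaleR_right)
  moreover have "\<exists>d>0. \<forall>S\<in>{S :: real^'n^'n. transpose S = S}. norm (S - mat 1) < d \<longrightarrow>
      norm (inv_sqrt_total S - inv_sqrt_total (mat 1) - - ((1/2) *\<^sub>R (S - mat 1))) \<le> e * norm (S - mat 1)"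
    if "e > 0" for e
  proof (intro exI conjI ballI impI)
    \<comment> \<open>Radius 1/2 is the range of the quadratic estimate; \<open>e/3\<close> turns
      its bound into \<open>e\<close> times the distance.\<close>
    show "0 < min (1/2) (e/3)" using that by simp
    fix S :: "real^'n^'n" assume S: "S \<in> {S. transpose S = S}" "norm (S - mat 1) < min (1/2) (e/3)"
    then have "3 * (norm (S - mat 1))\<^sup>2 \<le> e * norm (S - mat 1)"
      using mult_right_mono[of "3 * norm (S - mat 1)" e "norm (S - mat 1)"]
      by (simp add: power2_eq_square)
    then show "norm (inv_sqrt_total S - inv_sqrt_total (mat 1) - - ((1/2) *\<^sub>R (S - mat 1))) \<le> e * norm (S - mat 1)"
      using inv_sqrt_total_expansion[of S] S by (simp add: one)
  qed
  ultimately show ?thesis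
    unfolding has_derivative_within_alt by blast
qed

section \<open>Measurable selection of a diagonalising matrix\<close>

text \<open>Measurability of a multifunction tested on closed hitting sets. For singleton values the
  second condition is ordinary Borel measurability, which is how a selection is finally
  obtained.\<close>

definition measurable_compact_valued :: "'a measure \<Rightarrow> ('a \<Rightarrow> 'b::euclidean_space set) \<Rightarrow> bool"
  where "measurable_compact_valued N T \<longleftrightarrow>
    (\<forall>s\<in>space N. compact (T s) \<and> T s \<noteq> {}) \<and>
    (\<forall>A. closed A \<longrightarrow> {s \<in> space N. T s \<inter> A \<noteq> {}} \<in> sets N)"

definition minimizers :: "('b \<Rightarrow> real) \<Rightarrow> 'b set \<Rightarrow> 'b set"
  where "minimizers \<phi> K = {x \<in> K. \<forall>y\<in>K. \<phi> x \<le> \<phi> y}"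

text \<open>A minimiser lies in \<open>A\<close> iff, for every rational level, \<open>T s\<close>
  can meet the sublevel set only if \<open>T s \<inter> A\<close> does too. Only countably many
  closed sets are tested, so measurability is inherited.\<close>

lemma measurable_compact_valued_minimizers:
  fixes T :: "'a \<Rightarrow> 'b::euclidean_space set"
  assumes T: "measurable_compact_valued N T" and \<phi>: "continuous_on UNIV \<phi>"
  shows "measurable_compact_valued N (\<lambda>s. minimizers \<phi> (T s))"
  unfolding measurable_compact_valued_def
proof (intro conjI ballI allI impI)
  fix s assume "s \<in> space N"
  then have K: "compact (T s)" "T s \<noteq> {}"
    using T by (auto simp: measurable_compact_valued_def)
  obtain x where x: "x \<in> T s" "\<forall>y\<in>T s. \<phi> x \<le> \<phi> y"
    using continuous_attains_inf[OF K continuous_on_subset[OF \<phi>]] by auto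
  then have "minimizers \<phi> (T s) = T s \<inter> {y. \<phi> y \<le> \<phi> x}"
    by (auto simp: minimizers_def intro: order_trans)
  moreover have "closed {y. \<phi> y \<le> \<phi> x}"
    by (intro closed_Collect_le \<phi> continuous_intros)
  ultimately show "compact (minimizers \<phi> (T s))"
    using K by (auto intro: compact_Int_closed)
  show "minimizers \<phi> (T s) \<noteq> {}"
    using x by (auto simp: minimizers_def)
next
  fix A :: "'b set" assume A: "closed A"
  define L where "L c = {x. \<phi> x \<le> c}" for c
  have L: "closed (L c)" for c
    unfolding L_def by (intro closed_Collect_le \<phi> continuous_intros)
  have "minimizers \<phi> (T s) \<inter> A \<noteq> {}
      \<longleftrightarrow> (\<forall>c::rat. T s \<inter> L (of_rat c) \<noteq> {} \<longrightarrow> T s \<inter> (A \<inter> L (of_rat c)) \<noteq> {})"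
    if s: "s \<in> space N" for s
  proof
    assume "minimizers \<phi> (T s) \<inter> A \<noteq> {}"
    then show "\<forall>c::rat. T s \<inter> L (of_rat c) \<noteq> {} \<longrightarrow> T s \<inter> (A \<inter> L (of_rat c)) \<noteq> {}"
      by (fastforce simp: minimizers_def L_def)
  next
    assume *: "\<forall>c::rat. T s \<inter> L (of_rat c) \<noteq> {} \<longrightarrow> T s \<inter> (A \<inter> L (of_rat c)) \<noteq> {}"
    have K: "compact (T s)" "T s \<noteq> {}"
      using T s by (auto simp: measurable_compact_valued_def)
    obtain y where y: "y \<in> T s" "\<forall>z\<in>T s. \<phi> y \<le> \<phi> z"
      using continuous_attains_inf[OF K continuous_on_subset[OF \<phi>]] by auto
    have ex: "\<exists>x\<in>T s \<inter> A. \<phi> x \<le> of_rat c" if "\<phi> y < of_rat c" for c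
    proof -
      have "y \<in> T s \<inter> L (of_rat c)" using y that by (simp add: L_def)
      then show ?thesis using * by (fastforce simp: L_def)
    qed
    obtain c0 where "\<phi> y < of_rat c0"
      using of_rat_dense[of "\<phi> y" "\<phi> y + 1"] by auto
    then have "T s \<inter> A \<noteq> {}" using ex by blast
    then obtain x where x: "x \<in> T s \<inter> A" "\<forall>z\<in>T s \<inter> A. \<phi> x \<le> \<phi> z"
      using continuous_attains_inf[OF compact_Int_closed[OF K(1) A] _ continuous_on_subset[OF \<phi>]] by auto
    \<comment> \<open>Here \<open>x\<close> is best within \<open>A\<close> and \<open>y\<close> is
      best overall. A rational level strictly between their values would be reached by
      \<open>y\<close> but by no point of \<open>A\<close>.\<close>
    have "\<phi> x \<le> \<phi> y"
    proof (rule ccontr)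
      assume "\<not> \<phi> x \<le> \<phi> y"
      then obtain c where "\<phi> y < of_rat c" "of_rat c < \<phi> x"
        using of_rat_dense[of "\<phi> y" "\<phi> x"] by auto
      then show False using ex[of c] x(2) by force
    qed
    then have "x \<in> minimizers \<phi> (T s)"
      using x(1) y by (auto simp: minimizers_def intro: order_trans)
    then show "minimizers \<phi> (T s) \<inter> A \<noteq> {}" using x(1) by blast
  qed
  then have "{s \<in> space N. minimizers \<phi> (T s) \<inter> A \<noteq> {}} =
      {s \<in> space N. \<forall>c::rat. T s \<inter> L (of_rat c) \<noteq> {} \<longrightarrow> T s \<inter> (A \<inter> L (of_rat c)) \<noteq> {}}"
    by blast
  also have "\<dots> \<in> sets N"
    using T A L
    by (intro sets.sets_Collect_countable_All sets.sets_Collect_imp)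
      (use closed_Int[OF A L] in \<open>auto simp: measurable_compact_valued_def\<close>)
  finally show "{s \<in> space N. minimizers \<phi> (T s) \<inter> A \<noteq> {}} \<in> sets N" .
qed

text \<open>Minimising the coordinates one after the other shrinks a compact set to a single point.\<close>

lemma measurable_compact_valued_refine:
  fixes T :: "'a \<Rightarrow> 'b::euclidean_space set" and fs :: "('b \<Rightarrow> real) list"
  assumes "measurable_compact_valued N T" "\<And>\<phi>. \<phi> \<in> set fs \<Longrightarrow> continuous_on UNIV \<phi>"
  shows "\<exists>T'. measurable_compact_valued N T' \<and>
    (\<forall>s. T' s \<subseteq> T s \<and> (\<forall>\<phi>\<in>set fs. \<forall>x\<in>T' s. \<forall>y\<in>T' s. \<phi> x = \<phi> y))"
  using assms
proof (induction fs arbitrary: T)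
  case Nil
  then show ?case by auto
next
  case (Cons \<phi> fs)
  have "measurable_compact_valued N (\<lambda>s. minimizers \<phi> (T s))"
    using Cons.prems by (intro measurable_compact_valued_minimizers) auto
  then obtain T' where T': "measurable_compact_valued N T'" "\<And>s. T' s \<subseteq> minimizers \<phi> (T s)"
    "\<And>s. \<forall>\<psi>\<in>set fs. \<forall>x\<in>T' s. \<forall>y\<in>T' s. \<psi> x = \<psi> y"
    using Cons.IH[of "\<lambda>s. minimizers \<phi> (T s)"] Cons.prems(2) by auto
  have eq: "\<phi> x = \<phi> y" if "x \<in> T' s" "y \<in> T' s" for s x y
  proof -
    have "x \<in> minimizers \<phi> (T s)" "y \<in> minimizers \<phi> (T s)"
      using that T'(2) by auto
    then show ?thesis by (auto simp: minimizers_def intro: antisym)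
  qed
  show ?case
  proof (intro exI[of _ T'] conjI allI ballI)
    fix s \<psi> x y assume "\<psi> \<in> set (\<phi> # fs)" "x \<in> T' s" "y \<in> T' s"
    then show "\<psi> x = \<psi> y"
      using eq[of x s y] T'(3)[of s, rule_format, of \<psi> x y] by auto
  qed (use T'(1,2) in \<open>auto simp: minimizers_def\<close>)
qed

text \<open>After \<phi> the coordinates are minimised, which leaves singletons; for these, meeting
  a closed set is the same as the selected point lying in it.\<close>

lemma measurable_selection_minimizer:
  fixes T :: "'a \<Rightarrow> 'b::euclidean_space set"
  assumes T: "measurable_compact_valued N T" and \<phi>: "continuous_on UNIV \<phi>"
  shows "\<exists>g\<in>borel_measurable N. \<forall>s\<in>space N. g s \<in> minimizers \<phi> (T s)"
proof -
  obtain bs :: "'b list" where bs: "set bs = Basis"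
    using finite_list finite_Basis by blast
  have "continuous_on UNIV \<psi>" if "\<psi> \<in> set (map (\<lambda>b x. x \<bullet> b) bs)" for \<psi> :: "'b \<Rightarrow> real"
    using that by (auto intro!: continuous_intros)
  then obtain T' where T': "measurable_compact_valued N T'" "\<And>s. T' s \<subseteq> minimizers \<phi> (T s)"
    "\<And>s. \<forall>\<psi>\<in>set (map (\<lambda>b x. x \<bullet> b) bs). \<forall>x\<in>T' s. \<forall>y\<in>T' s. \<psi> x = \<psi> y"
    using measurable_compact_valued_refine[OF measurable_compact_valued_minimizers[OF T \<phi>],
        of "map (\<lambda>b x. x \<bullet> b) bs"]
    by metis
  have single: "x = y" if "x \<in> T' s" "y \<in> T' s" for x y s
  proof (rule euclidean_eqI)
    fix b :: 'b assume "b \<in> Basis"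
    then have "(\<lambda>x. x \<bullet> b) \<in> set (map (\<lambda>b x. x \<bullet> b) bs)" using bs by simp
    then show "x \<bullet> b = y \<bullet> b"
      using T'(3)[of s, rule_format, of "\<lambda>x. x \<bullet> b" x y] that by simp
  qed
  define g where "g s = (SOME x. x \<in> T' s)" for s
  have g: "g s \<in> T' s" if "s \<in> space N" for s
    using T'(1) that unfolding g_def measurable_compact_valued_def by (simp add: some_in_eq)
  have "g \<in> borel_measurable N"
  proof (rule borel_measurable_closed_vimage)
    fix A :: "'b set" assume "closed A"
    then have "{s \<in> space N. T' s \<inter> A \<noteq> {}} \<in> sets N"
      using T'(1) by (simp add: measurable_compact_valued_def)
    moreover have "{s \<in> space N. T' s \<inter> A \<noteq> {}} = {s \<in> space N. g s \<in> A}"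
      using g single by blast
    ultimately show "{s \<in> space N. g s \<in> A} \<in> sets N" by simp
  qed
  then show ?thesis
    using g T'(2) by blast
qed

text \<open>Symmetrising first gives every matrix a diagonaliser, so the selection below is total,
  and nothing changes on symmetric arguments.\<close>

definition sym_part :: "real^'n^'n \<Rightarrow> real^'n^'n"
  where "sym_part B = (1/2) *\<^sub>R (B + transpose B)"

lemma transpose_sym_part: "transpose (sym_part B) = sym_part B"
  by (simp add: sym_part_def transpose_def vec_eq_iff)

lemma sym_part_symmetric: "transpose B = B \<Longrightarrow> sym_part B = B"
  by (simp add: sym_part_def scaleR_2[symmetric])

text \<open>The matrices that have a diagonaliser in a closed set form the projection of a closed
  set of pairs along the compact orthogonal group, so they even form a closed set.\<close>

lemma measurable_compact_valued_diagonalizers: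
  "measurable_compact_valued borel (\<lambda>B :: real^'n^'n. diagonalizers (sym_part B))"
  unfolding measurable_compact_valued_def
proof (intro conjI ballI allI impI)
  let ?O = "{W :: real^'n^'n. orthogonal_matrix W}"
  define P where "P = {z :: (real^'n^'n) \<times> (real^'n^'n). \<forall>i j. i \<noteq> j \<longrightarrow>
    (transpose (fst z) ** sym_part (snd z) ** fst z) $ i $ j = 0}"
  have P: "closed P"
    unfolding P_def sym_part_def
    by (intro closed_Collect_all closed_Collect_imp closed_Collect_eq continuous_intros open_Collect_const)
  have eq: "diagonalizers (sym_part B) = ?O \<inter> (\<lambda>W. (W, B)) -` P" for B :: "real^'n^'n"
    by (auto simp: diagonalizers_def P_def)
  fix B :: "real^'n^'n"
  have "closed ((\<lambda>W. (W, B)) -` P)"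
    by (intro closed_vimage P continuous_intros)
  then show "compact (diagonalizers (sym_part B))"
    unfolding eq by (intro compact_Int_closed compact_orthogonal_matrices)
  show "diagonalizers (sym_part B) \<noteq> {}"
    by (rule diagonalizers_nonempty[OF transpose_sym_part])
  fix A :: "(real^'n^'n) set" assume "closed A"
  then have "closed {B. \<exists>W. W \<in> ?O \<inter> A \<and> (W, B) \<in> P}"
    by (intro closed_compact_projection P compact_Int_closed compact_orthogonal_matrices)
  moreover have "{B. \<exists>W. W \<in> ?O \<inter> A \<and> (W, B) \<in> P} = {B. diagonalizers (sym_part B) \<inter> A \<noteq> {}}"
    unfolding eq by auto
  ultimately show "{B \<in> space borel. diagonalizers (sym_part B) \<inter> A \<noteq> {}} \<in> sets borel"
    by (simp add: borel_closed)
qed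

text \<open>The choice is made once among measurable functions, not separately for each matrix:
  several diagonalisers may be equally near, and an arbitrary choice between them carries no
  measurability.\<close>

definition nearest_diagonalizer :: "real^'n^'n \<Rightarrow> real^'n^'n"
  where "nearest_diagonalizer = (SOME g. g \<in> borel_measurable borel \<and>
    (\<forall>B. g B \<in> minimizers (\<lambda>W. norm (W - mat 1)) (diagonalizers (sym_part B))))"

lemma nearest_diagonalizer:
  fixes B :: "real^'n^'n"
  shows borel_measurable_nearest_diagonalizer:
      "(nearest_diagonalizer :: real^'n^'n \<Rightarrow> _) \<in> borel_measurable borel"
    and nearest_diagonalizer_minimizes: "transpose B = B \<Longrightarrow>
      nearest_diagonalizer B \<in> minimizers (\<lambda>W. norm (W - mat 1)) (diagonalizers B)"
proof -
  have "continuous_on UNIV (\<lambda>W :: real^'n^'n. norm (W - mat 1))"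
    by (intro continuous_intros)
  then have "\<exists>g :: real^'n^'n \<Rightarrow> _. g \<in> borel_measurable borel \<and>
    (\<forall>B. g B \<in> minimizers (\<lambda>W. norm (W - mat 1)) (diagonalizers (sym_part B)))"
    using measurable_selection_minimizer[OF measurable_compact_valued_diagonalizers] by auto
  then have *: "(nearest_diagonalizer :: real^'n^'n \<Rightarrow> _) \<in> borel_measurable borel \<and>
    (\<forall>B :: real^'n^'n. nearest_diagonalizer B
      \<in> minimizers (\<lambda>W. norm (W - mat 1)) (diagonalizers (sym_part B)))"
    unfolding nearest_diagonalizer_def by (rule someI_ex)
  then show "(nearest_diagonalizer :: real^'n^'n \<Rightarrow> _) \<in> borel_measurable borel" by blast
  show "nearest_diagonalizer B \<in> minimizers (\<lambda>W. norm (W - mat 1)) (diagonalizers B)"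
    if "transpose B = B"
    using *[THEN conjunct2, rule_format, of B] by (simp only: sym_part_symmetric[OF that])
qed

lemma nearest_diagonalizer_in: "transpose B = B \<Longrightarrow> nearest_diagonalizer B \<in> diagonalizers B"
  using nearest_diagonalizer_minimizes by (force simp: minimizers_def)

lemma nearest_diagonalizer_le:
  "transpose B = B \<Longrightarrow> W \<in> diagonalizers B \<Longrightarrow> norm (nearest_diagonalizer B - mat 1) \<le> norm (W - mat 1)"
  using nearest_diagonalizer_minimizes by (force simp: minimizers_def)

section \<open>Perturbation of a diagonal matrix with distinct entries\<close>

definition diag_matrix :: "('n \<Rightarrow> real) \<Rightarrow> real^'n^'n"
  where "diag_matrix d = (\<chi> i j. if i = j then d i else 0)"

lemma diagonalizers_eigenvalue_entry:
  assumes "W \<in> diagonalizers (B :: real^'n^'n)"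
  shows "(\<Sum>j\<in>UNIV. B $ i $ j * W $ j $ k) = (transpose W ** B ** W) $ k $ k * W $ i $ k"
  using arg_cong[OF diagonalizers_eigenvector[OF assms, of k], of "\<lambda>v. v $ i"]
  by (simp add: matrix_vector_mult_def column_def)

text \<open>Column \<open>k\<close> is an eigenvector of a diagonal matrix with distinct entries, so
  only one of its coordinates can be nonzero.\<close>

lemma diagonalizers_diag_matrix:
  assumes W: "W \<in> diagonalizers (diag_matrix d)" and d: "inj d" and "i \<noteq> j"
  shows "W $ i $ k * W $ j $ k = 0"
proof -
  have "d a * W $ a $ k = (transpose W ** diag_matrix d ** W) $ k $ k * W $ a $ k" for a
    using diagonalizers_eigenvalue_entry[OF W, of a k]
    by (simp add: diag_matrix_def if_distrib[of "\<lambda>x. x * _"] cong: if_cong)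
  from this[of i] this[of j] have "d i = d j" if "W $ i $ k \<noteq> 0" "W $ j $ k \<noteq> 0"
    using that by simp
  then show ?thesis
    using injD[OF d, of i j] \<open>i \<noteq> j\<close> by auto
qed

lemma tendsto_matrix_mult [tendsto_intros]:
  fixes f :: "'a \<Rightarrow> real^'m^'k" and g :: "'a \<Rightarrow> real^'n^'m"
  assumes "(f \<longlongrightarrow> A) F" "(g \<longlongrightarrow> B) F"
  shows "((\<lambda>x. f x ** g x) \<longlongrightarrow> A ** B) F"
  unfolding matrix_matrix_mult_def by (intro tendsto_intros assms)

lemma tendsto_transpose [tendsto_intros]:
  fixes f :: "'a \<Rightarrow> real^'m^'k"
  assumes "(f \<longlongrightarrow> A) F"
  shows "((\<lambda>x. transpose (f x)) \<longlongrightarrow> transpose A) F"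
  unfolding transpose_def by (intro tendsto_intros assms)

text \<open>A limit \<open>W\<close> of diagonalisers is a signed permutation matrix, so that multiplying the
  diagonalisers by \<open>W\<^sup>T\<close> gives diagonalisers that converge to the identity.\<close>

lemma nearest_diagonalizer_near_1:
  fixes d :: "'n::finite \<Rightarrow> real"
  assumes d: "inj d" and "\<epsilon> > 0"
  shows "\<exists>\<delta>>0. \<forall>B. transpose B = B \<longrightarrow> norm (B - diag_matrix d) < \<delta>
    \<longrightarrow> norm (nearest_diagonalizer B - mat 1) < \<epsilon>"
proof (rule ccontr)
  assume neg: "\<not> ?thesis"
  have "\<exists>B. transpose B = B \<and> norm (B - diag_matrix d) < 1 / real (Suc n)
      \<and> norm (nearest_diagonalizer B - mat 1) \<ge> \<epsilon>" for n
  proof -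
    have "1 / real (Suc n) > 0" by simp
    then show ?thesis using neg by (meson linorder_not_less)
  qed
  then obtain B where sym: "\<And>n. transpose (B n) = B n"
    and lim: "\<And>n. norm (B n - diag_matrix d) < 1 / real (Suc n)"
    and far: "\<And>n. norm (nearest_diagonalizer (B n) - mat 1) \<ge> \<epsilon>"
    by metis
  have "(\<lambda>n. norm (B n - diag_matrix d)) \<longlonglongrightarrow> 0"
    by (rule tendsto_sandwich[OF _ _ tendsto_const LIMSEQ_Suc[OF lim_1_over_n]])
      (use lim in \<open>auto intro!: always_eventually less_imp_le\<close>)
  then have B: "B \<longlonglongrightarrow> diag_matrix d"
    by (rule LIM_zero_cancel[OF tendsto_norm_zero_cancel])
  define V where "V n = nearest_diagonalizer (B n)" for n
  have V: "V n \<in> diagonalizers (B n)" for n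
    unfolding V_def by (rule nearest_diagonalizer_in[OF sym])
  then obtain W r where W: "orthogonal_matrix W" and r: "strict_mono r" and VW: "(V \<circ> r) \<longlonglongrightarrow> W"
    using compact_orthogonal_matrices[unfolded compact_def, rule_format, of V]
    by (auto simp: diagonalizers_def)
  have Vr: "(\<lambda>n. V (r n)) \<longlonglongrightarrow> W" using VW by (simp add: comp_def)
  have Br: "(\<lambda>n. B (r n)) \<longlonglongrightarrow> diag_matrix d"
    using LIMSEQ_subseq_LIMSEQ[OF B r] by (simp add: comp_def)
  have "(transpose W ** diag_matrix d ** W) $ i $ j = 0" if "i \<noteq> j" for i j
  proof -
    have "(\<lambda>n. (transpose (V (r n)) ** B (r n) ** V (r n)) $ i $ j)
        \<longlonglongrightarrow> (transpose W ** diag_matrix d ** W) $ i $ j"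
      by (intro tendsto_intros Vr Br)
    moreover have "(transpose (V (r n)) ** B (r n) ** V (r n)) $ i $ j = 0" for n
      using V that by (auto simp: diagonalizers_def)
    ultimately show ?thesis
      by (simp add: LIMSEQ_const_iff)
  qed
  then have Wd: "W \<in> diagonalizers (diag_matrix d)"
    using W by (simp add: diagonalizers_def)
  define U where "U n = V (r n) ** transpose W" for n
  have "U n \<in> diagonalizers (B (r n))" for n
  proof -
    define D where "D = transpose (V (r n)) ** B (r n) ** V (r n)"
    have D: "D $ a $ b = 0" if "a \<noteq> b" for a b
      using V that by (auto simp: diagonalizers_def D_def)
    have "transpose (U n) ** B (r n) ** U n = W ** D ** transpose W"
      by (simp add: U_def D_def matrix_transpose_mul matrix_mul_assoc)
    \<comment> \<open>Conjugation by a signed permutation matrix only permutes the diagonal entries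
      of \<open>D\<close>.\<close>
    moreover have "(W ** D ** transpose W) $ i $ j = 0" if "i \<noteq> j" for i j
    proof -
      have "(W ** D ** transpose W) $ i $ j
          = (\<Sum>b\<in>UNIV. (\<Sum>a\<in>UNIV. W $ i $ a * D $ a $ b) * W $ j $ b)"
        by (simp add: matrix_matrix_mult_def transpose_def)
      also have "\<dots> = (\<Sum>b\<in>UNIV. W $ i $ b * D $ b $ b * W $ j $ b)"
      proof (intro sum.cong refl)
        fix b
        have "(\<Sum>a\<in>UNIV. W $ i $ a * D $ a $ b) = (\<Sum>a\<in>{b}. W $ i $ a * D $ a $ b)"
          by (rule sum.mono_neutral_right) (use D in auto)
        then show "(\<Sum>a\<in>UNIV. W $ i $ a * D $ a $ b) * W $ j $ b = W $ i $ b * D $ b $ b * W $ j $ b"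
          by simp
      qed
      also have "\<dots> = 0"
        using diagonalizers_diag_matrix[OF Wd d that]
        by (intro sum.neutral) (auto simp: mult.assoc mult.left_commute[of _ "D $ _ $ _"])
      finally show ?thesis .
    qed
    moreover have "orthogonal_matrix (U n)"
      unfolding U_def using V[of "r n"] W
      by (intro orthogonal_matrix_mul) (auto simp: diagonalizers_def)
    ultimately show ?thesis by (simp add: diagonalizers_def)
  qed
  \<comment> \<open>By minimality \<open>V (r n)\<close> is no farther from the identity than
    \<open>U n\<close>. The latter tends to the identity, which contradicts the distance
    \<epsilon>.\<close>
  then have "norm (V (r n) - mat 1) \<le> norm (U n - mat 1)" for n
    unfolding V_def by (rule nearest_diagonalizer_le[OF sym])
  then have ge: "norm (U n - mat 1) \<ge> \<epsilon>" for n
    using far[of "r n"] by (metis V_def order_trans)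
  have "(\<lambda>n. norm (U n - mat 1)) \<longlonglongrightarrow> norm (W ** transpose W - mat 1)"
    unfolding U_def by (intro tendsto_intros Vr)
  then have "(\<lambda>n. norm (U n - mat 1)) \<longlonglongrightarrow> 0"
    using W by (simp add: orthogonal_matrix_def)
  then have "\<epsilon> \<le> 0"
    by (rule LIMSEQ_le_const) (use ge in auto)
  then show False using \<open>\<epsilon> > 0\<close> by simp
qed

lemma abs_entry_le_norm: "\<bar>(A :: real^'n^'m) $ i $ j\<bar> \<le> norm A"
  using component_le_norm_cart[of "A $ i" j] Finite_Cartesian_Product.norm_nth_le[of A i] by linarith

lemma orthogonal_matrix_column_sq:
  assumes "orthogonal_matrix (W :: real^'n^'n)"
  shows "(\<Sum>i\<in>UNIV. (W $ i $ k)\<^sup>2) = 1"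
proof -
  have "(norm (column k W))\<^sup>2 = 1"
    using assms by (simp add: orthogonal_matrix_orthonormal_columns)
  then show ?thesis
    by (simp add: power2_norm_eq_inner inner_vec_def column_def) (simp add: power2_eq_square)
qed

lemma orthogonal_matrix_abs_entry_le:
  assumes "orthogonal_matrix (W :: real^'n^'n)"
  shows "\<bar>W $ i $ k\<bar> \<le> 1"
proof -
  have "(W $ i $ k)\<^sup>2 \<le> (\<Sum>i\<in>UNIV. (W $ i $ k)\<^sup>2)"
    by (intro member_le_sum) auto
  then show ?thesis
    using orthogonal_matrix_column_sq[OF assms, of k] by (simp add: abs_square_le_1)
qed

text \<open>With \<mu> the eigenvalue of column \<open>k\<close> and \<open>E\<close> the
  perturbation, the eigenvalue equation reads
  \<open>(E ** W) $ i $ k = (\<mu> - d i) * W $ i $ k\<close>. Replacing \<open>W\<close> by the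
  identity on the left costs one multiple of \<open>CARD('n)\<close> * \<eta> * \<open>h\<close>.
  Replacing \<mu> by \<open>d k\<close> on the right costs two, since row \<open>k\<close> of the
  same equation and \<open>W $ k $ k \<ge> 1/2\<close> bound the difference of \<mu> and
  \<open>d k\<close> by \<open>2 * CARD('n) * h\<close>.\<close>

lemma diagonalizer_offdiag_bound:
  fixes B W :: "real^'n^'n" and d :: "'n \<Rightarrow> real"
  assumes W: "W \<in> diagonalizers B" and near: "norm (W - mat 1) \<le> 1/2" and "i \<noteq> k"
  defines "h \<equiv> norm (B - diag_matrix d)" and "\<eta> \<equiv> norm (W - mat 1)"
  shows "\<bar>(d k - d i) * W $ i $ k - (B - diag_matrix d) $ i $ k\<bar> \<le> 3 * real CARD('n) * \<eta> * h"
proof -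
  define E where "E = B - diag_matrix d"
  define \<mu> where "\<mu> = (transpose W ** B ** W) $ k $ k"
  have E: "\<bar>E $ a $ b\<bar> \<le> h" for a b
    unfolding E_def h_def by (rule abs_entry_le_norm)
  have h: "h \<ge> 0" and \<eta>: "\<eta> \<ge> 0" by (auto simp: h_def \<eta>_def)
  have W1: "\<bar>W $ a $ b\<bar> \<le> 1" for a b
    using W by (intro orthogonal_matrix_abs_entry_le) (simp add: diagonalizers_def)
  have WI: "\<bar>W $ a $ b - (if a = b then 1 else 0)\<bar> \<le> \<eta>" for a b
    using abs_entry_le_norm[of "W - mat 1" a b] by (auto simp: mat_def \<eta>_def)
  have eq: "(\<Sum>j\<in>UNIV. E $ a $ j * W $ j $ k) = (\<mu> - d a) * W $ a $ k" for a
    using diagonalizers_eigenvalue_entry[OF W, of a k]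
    by (simp add: E_def \<mu>_def diag_matrix_def left_diff_distrib sum_subtractf
        if_distrib[of "\<lambda>x. x * _"] cong: if_cong)
  have sum_le: "\<bar>\<Sum>j\<in>UNIV. E $ a $ j * y j\<bar> \<le> real CARD('n) * (h * c)"
    if "\<And>j. \<bar>y j\<bar> \<le> c" for a y c
  proof -
    have "\<bar>\<Sum>j\<in>UNIV. E $ a $ j * y j\<bar> \<le> (\<Sum>j\<in>(UNIV :: 'n set). h * c)"
    proof (rule order_trans[OF sum_abs], rule sum_mono)
      show "\<bar>E $ a $ j * y j\<bar> \<le> h * c" for j
        unfolding abs_mult by (intro mult_mono E that h) auto
    qed
    then show ?thesis by simp
  qed
  have "W $ k $ k \<ge> 1/2"
    using WI[of k k] near by (simp add: \<eta>_def[symmetric])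
  then have "\<bar>\<mu> - d k\<bar> * (1/2) \<le> \<bar>\<mu> - d k\<bar> * \<bar>W $ k $ k\<bar>"
    by (intro mult_left_mono) auto
  also have "\<dots> \<le> real CARD('n) * (h * 1)"
    using sum_le[of "\<lambda>j. W $ j $ k" 1 k] W1 by (simp add: eq abs_mult)
  finally have \<mu>: "\<bar>\<mu> - d k\<bar> \<le> 2 * real CARD('n) * h" by simp
  have "(\<Sum>j\<in>UNIV. E $ i $ j * (W $ j $ k - (if j = k then 1 else 0)))
      = (\<mu> - d i) * W $ i $ k - E $ i $ k"
    by (simp add: right_diff_distrib sum_subtractf eq if_distrib[of "\<lambda>x. _ * x"] cong: if_cong)
  then have 1: "\<bar>(\<mu> - d i) * W $ i $ k - E $ i $ k\<bar> \<le> real CARD('n) * (h * \<eta>)"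
    using sum_le[of "\<lambda>j. W $ j $ k - (if j = k then 1 else 0)" \<eta> i] WI by simp
  have "\<bar>\<mu> - d k\<bar> * \<bar>W $ i $ k\<bar> \<le> (2 * real CARD('n) * h) * \<eta>"
    using \<mu> WI[of i k] \<open>i \<noteq> k\<close> h by (intro mult_mono) auto
  then have 2: "\<bar>(\<mu> - d k) * W $ i $ k\<bar> \<le> 2 * real CARD('n) * h * \<eta>"
    by (simp add: abs_mult)
  have "(d k - d i) * W $ i $ k - E $ i $ k
      = ((\<mu> - d i) * W $ i $ k - E $ i $ k) - (\<mu> - d k) * W $ i $ k"
    by (simp add: algebra_simps)
  then have "\<bar>(d k - d i) * W $ i $ k - E $ i $ k\<bar>
      \<le> real CARD('n) * (h * \<eta>) + 2 * real CARD('n) * h * \<eta>"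
    using 1 2 by linarith
  then show ?thesis
    by (simp add: E_def algebra_simps)
qed

lemma nearest_diagonalizer_diag_matrix:
  fixes d :: "'n::finite \<Rightarrow> real"
  shows "nearest_diagonalizer (diag_matrix d) = mat 1"
proof -
  have "transpose (diag_matrix d) = diag_matrix d"
    by (auto simp: diag_matrix_def transpose_def vec_eq_iff)
  moreover have "mat 1 \<in> diagonalizers (diag_matrix d)"
    by (auto simp: diagonalizers_def orthogonal_matrix_id transpose_mat diag_matrix_def)
  ultimately have "norm (nearest_diagonalizer (diag_matrix d) - mat 1) \<le> norm (mat 1 - mat 1 :: real^'n^'n)"
    by (rule nearest_diagonalizer_le)
  then show ?thesis by simp
qed

text \<open>Off the diagonal, the preceding bound is divided by the spectral gap; its factor \<eta>
  tends to 0 with \<open>h\<close>, so the error is of smaller order than \<open>h\<close>. On the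
  diagonal, the unit length of column \<open>k\<close> controls \<open>1 - W $ k $ k\<close> by the
  squares of the other entries.\<close>

lemma has_derivative_nearest_diagonalizer:
  fixes d :: "'n::finite \<Rightarrow> real"
  assumes d: "inj d"
  shows "((\<lambda>B. nearest_diagonalizer B $ i $ k) has_derivative
      (\<lambda>E. if i = k then 0 else E $ i $ k / (d k - d i)))
    (at (diag_matrix d) within {B. transpose B = B})"
proof -
  define p where "p = real CARD('n)"
  have p: "p \<ge> 1" by (simp add: p_def Suc_le_eq)
  \<comment> \<open>The smallest gap between the entries of \<open>d\<close>, capped at 1; the
    inserted 1 keeps the set nonempty in dimension one.\<close>
  define m where "m = Min (insert 1 ((\<lambda>(a, b). \<bar>d a - d b\<bar>) ` {(a, b). a \<noteq> b}))"
  have m: "m > 0"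
    unfolding m_def using d by (subst Min_gr_iff) (auto simp: inj_def)
  have gap: "m \<le> \<bar>d a - d b\<bar>" if "a \<noteq> b" for a b
    unfolding m_def using that by (intro Min_le) auto
  \<comment> \<open>The sum of the constants of the diagonal and the off-diagonal case, so that one
    \<delta> serves both.\<close>
  define C where "C = p * (1 + 3 * p) + 3 * p"
  have C: "C > 0" "3 * p \<le> C" "p * (1 + 3 * p) \<le> C"
    using p by (auto simp: C_def intro: add_pos_pos)
  define L where "L E = (if i = k then 0 else E $ i $ k / (d k - d i))" for E :: "real^'n^'n"
  let ?V = "nearest_diagonalizer :: real^'n^'n \<Rightarrow> real^'n^'n"
  have center: "?V (diag_matrix d) = mat 1"
    by (rule nearest_diagonalizer_diag_matrix)
  have "bounded_linear L"
  proof (cases "i = k")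
    case False
    then have "L = (\<lambda>E. E $ i $ k / (d k - d i))" by (auto simp: L_def)
    moreover have "bounded_linear (\<lambda>E :: real^'n^'n. E $ i $ k / (d k - d i))"
      using bounded_linear_compose[OF bounded_linear_divide
          bounded_linear_compose[OF bounded_linear_vec_nth bounded_linear_vec_nth]] .
    ultimately show ?thesis by simp
  next
    case True
    then have "L = (\<lambda>E. 0)" by (auto simp: L_def)
    then show ?thesis by (simp add: bounded_linear_zero)
  qed
  moreover have "\<exists>\<delta>>0. \<forall>B\<in>{B. transpose B = B}. norm (B - diag_matrix d) < \<delta> \<longrightarrow>
      norm (?V B $ i $ k - ?V (diag_matrix d) $ i $ k - L (B - diag_matrix d)) \<le> e * norm (B - diag_matrix d)"
    if "e > 0" for e
  proof -
    define \<epsilon> where "\<epsilon> = min (1/2) (e * m / C)"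
    have "\<epsilon> > 0" using that m C by (simp add: \<epsilon>_def)
    then obtain \<delta> where \<delta>: "\<delta> > 0" and near: "\<And>B. transpose B = B \<Longrightarrow> norm (B - diag_matrix d) < \<delta>
        \<Longrightarrow> norm (?V B - mat 1) < \<epsilon>"
      using nearest_diagonalizer_near_1[OF d] by blast
    have "norm (?V B $ i $ k - ?V (diag_matrix d) $ i $ k - L (B - diag_matrix d)) \<le> e * norm (B - diag_matrix d)"
      if B: "transpose B = B" "norm (B - diag_matrix d) < \<delta>" for B
    proof -
      define W where "W = ?V B"
      define h where "h = norm (B - diag_matrix d)"
      define \<eta> where "\<eta> = norm (W - mat 1)"
      have W: "W \<in> diagonalizers B"
        unfolding W_def using B(1) by (rule nearest_diagonalizer_in)
      have \<eta>: "0 \<le> \<eta>" "\<eta> \<le> 1/2" "\<eta> \<le> e * m / C" and h: "0 \<le> h"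
        using near[OF B] by (auto simp: \<epsilon>_def \<eta>_def W_def h_def)
      have "C * \<eta> \<le> e * m"
        using \<eta>(3) C by (simp add: field_simps)
      from mult_right_mono[OF this h] have C\<eta>: "C * \<eta> * h / m \<le> e * h"
        using m by (simp add: pos_divide_le_eq mult_ac)
      have off: "\<bar>(d b - d a) * W $ a $ b - (B - diag_matrix d) $ a $ b\<bar> \<le> 3 * p * \<eta> * h" if "a \<noteq> b" for a b
        using diagonalizer_offdiag_bound[OF W _ that, of d] \<eta> by (simp add: p_def \<eta>_def h_def)
      show ?thesis
      proof (cases "i = k")
        case False
        define D where "D = d k - d i"
        have D: "m \<le> \<bar>D\<bar>" "D \<noteq> 0"
          using gap[of k i] False m by (auto simp: D_def)
        have "\<bar>W $ i $ k - (B - diag_matrix d) $ i $ k / D\<bar> = \<bar>D * W $ i $ k - (B - diag_matrix d) $ i $ k\<bar> / \<bar>D\<bar>"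
          using D by (simp add: abs_divide[symmetric] diff_divide_distrib)
        also have "\<dots> \<le> (C * \<eta> * h) / m"
        proof (rule frac_le)
          have "3 * p * (\<eta> * h) \<le> C * (\<eta> * h)"
            using C \<eta> h by (intro mult_right_mono) auto
          then show "\<bar>D * W $ i $ k - (B - diag_matrix d) $ i $ k\<bar> \<le> C * \<eta> * h"
            using off[OF False] by (simp add: D_def mult.assoc)
        qed (use D m C \<eta> h in auto)
        also note C\<eta>
        finally show ?thesis
          using False by (simp add: center L_def D_def W_def h_def mat_def)
      next
        case True
        \<comment> \<open>An off-diagonal entry is bounded both by a multiple of \<open>h\<close>
          and by \<eta>. Taking one bound for each factor makes its square of smaller order than
          \<open>h\<close>.\<close>
        have Wjk: "\<bar>W $ j $ k\<bar> \<le> (1 + 3 * p) * h / m" if "j \<noteq> k" for j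
        proof -
          have "m * \<bar>W $ j $ k\<bar> \<le> \<bar>(d k - d j) * W $ j $ k\<bar>"
            using gap[of k j] that by (simp add: abs_mult mult_right_mono)
          also have "\<dots> \<le> 3 * p * \<eta> * h + h"
            using off[OF that] abs_entry_le_norm[of "B - diag_matrix d" j k] unfolding h_def by linarith
          also have "3 * p * \<eta> * h \<le> 3 * p * 1 * h"
            using \<eta> h p by (intro mult_mono) auto
          finally show ?thesis using m by (simp add: field_simps)
        qed
        have Wsq: "(W $ j $ k)\<^sup>2 \<le> \<eta> * ((1 + 3 * p) * h / m)" if "j \<noteq> k" for j
        proof -
          have "\<bar>W $ j $ k\<bar> \<le> \<eta>"
            using abs_entry_le_norm[of "W - mat 1" j k] that by (simp add: \<eta>_def mat_def)
          then have "\<bar>W $ j $ k\<bar> * \<bar>W $ j $ k\<bar> \<le> \<eta> * ((1 + 3 * p) * h / m)"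
            using Wjk[OF that] \<eta> by (intro mult_mono) auto
          then show ?thesis by (simp add: power2_eq_square)
        qed
        have orth: "orthogonal_matrix W" using W by (simp add: diagonalizers_def)
        have ge: "W $ k $ k \<ge> 1/2"
          using abs_entry_le_norm[of "W - mat 1" k k] \<eta> by (simp add: \<eta>_def mat_def)
        have le1: "W $ k $ k \<le> 1"
          using orthogonal_matrix_abs_entry_le[OF orth, of k k] by simp
        \<comment> \<open>Multiplying by \<open>1 + W $ k $ k \<ge> 1\<close> produces
          \<open>1 - (W $ k $ k)\<^sup>2\<close>, the sum of the other squares in a unit
          column.\<close>
        have "1 - W $ k $ k \<le> (1 - W $ k $ k) * (1 + W $ k $ k)"
          using ge le1 by (intro mult_right_mono[of 1, simplified] mult_left_mono[of 1 _ "1 - W $ k $ k", simplified]) auto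
        also have "\<dots> = (\<Sum>j\<in>UNIV. (W $ j $ k)\<^sup>2) - (W $ k $ k)\<^sup>2"
          using orthogonal_matrix_column_sq[OF orth, of k] by (simp add: power2_eq_square algebra_simps)
        also have "\<dots> = (\<Sum>j\<in>UNIV - {k}. (W $ j $ k)\<^sup>2)"
          by (subst sum.remove[of _ k]) auto
        also have "\<dots> \<le> (\<Sum>j\<in>UNIV - {k}. \<eta> * ((1 + 3 * p) * h / m))"
          using Wsq by (intro sum_mono) auto
        also have "\<dots> \<le> (\<Sum>j\<in>(UNIV :: 'n set). \<eta> * ((1 + 3 * p) * h / m))"
          using \<eta> h m p by (intro sum_mono2) auto
        also have "\<dots> = p * (1 + 3 * p) * (\<eta> * h / m)"
          by (simp add: p_def)
        also have "\<dots> \<le> C * (\<eta> * h / m)"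
          using C \<eta> h m by (intro mult_right_mono) auto
        also have "\<dots> \<le> e * h" using C\<eta> by (simp add: mult.assoc)
        finally show ?thesis
          using True le1 by (simp add: center L_def W_def h_def mat_def)
      qed
    qed
    then show ?thesis using \<delta> by blast
  qed
  ultimately show ?thesis
    unfolding has_derivative_within_alt L_def by blast
qed

section \<open>Stochastic orders of magnitude\<close>

lemma borel_measurable_matrixI:
  fixes f :: "'a \<Rightarrow> real^'n^'m"
  assumes "\<And>i j. (\<lambda>x. f x $ i $ j) \<in> borel_measurable N"
  shows "f \<in> borel_measurable N"
proof (subst borel_measurable_euclidean_space, intro ballI)
  fix b :: "real^'n^'m" assume "b \<in> Basis"
  then obtain i j where "b = axis i (axis j 1)"
    by (auto simp: Basis_vec_def)
  then show "(\<lambda>x. f x \<bullet> b) \<in> borel_measurable N"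
    using assms by (simp add: inner_axis)
qed

definition bounded_in_prob :: "'w measure \<Rightarrow> (nat \<Rightarrow> 'w \<Rightarrow> real) \<Rightarrow> bool"
  where "bounded_in_prob M X \<longleftrightarrow> (\<forall>n. X n \<in> borel_measurable M) \<and>
    (\<forall>e>0. \<exists>K>0. \<forall>\<^sub>F n in sequentially. measure M {\<omega> \<in> space M. K < \<bar>X n \<omega>\<bar>} < e)"

text \<open>\<open>lin_exp M X c L\<close> means \<open>X = c + L + o\<^sub>P(n\<^bsup>-1/2\<^esup>)\<close> with \<open>L = O\<^sub>P(n\<^bsup>-1/2\<^esup>)\<close>. Such
  expansions are added and multiplied like dual numbers.\<close>

definition lin_exp :: "'w measure \<Rightarrow> (nat \<Rightarrow> 'w \<Rightarrow> real) \<Rightarrow> real \<Rightarrow> (nat \<Rightarrow> 'w \<Rightarrow> real) \<Rightarrow> bool"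
  where "lin_exp M X c L \<longleftrightarrow> (\<forall>n. X n \<in> borel_measurable M) \<and>
    bounded_in_prob M (\<lambda>n \<omega>. sqrt (real n) * L n \<omega>) \<and>
    little_oP1 M (\<lambda>n \<omega>. sqrt (real n) * (X n \<omega> - c - L n \<omega>))"

lemma little_oP1_iff:
  "little_oP1 M X \<longleftrightarrow> (\<forall>n. X n \<in> borel_measurable M) \<and>
    (\<forall>e>0. \<forall>d>0. \<forall>\<^sub>F n in sequentially. measure M {\<omega> \<in> space M. e < \<bar>X n \<omega>\<bar>} < d)"
  unfolding little_oP1_def tendsto_in_prob_def tendsto_iff by (auto simp: dist_real_def)

context prob_space
begin

lemma measure_union_bound:
  assumes "\<And>\<omega>. \<omega> \<in> space M \<Longrightarrow> R \<omega> \<Longrightarrow> P \<omega> \<or> Q \<omega>"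
    and "{\<omega> \<in> space M. P \<omega>} \<in> sets M" "{\<omega> \<in> space M. Q \<omega>} \<in> sets M"
  shows "measure M {\<omega> \<in> space M. R \<omega>} \<le> measure M {\<omega> \<in> space M. P \<omega>} + measure M {\<omega> \<in> space M. Q \<omega>}"
proof -
  have "measure M {\<omega> \<in> space M. R \<omega>} \<le> measure M ({\<omega> \<in> space M. P \<omega>} \<union> {\<omega> \<in> space M. Q \<omega>})"
    using assms by (intro finite_measure_mono) auto
  also have "\<dots> \<le> measure M {\<omega> \<in> space M. P \<omega>} + measure M {\<omega> \<in> space M. Q \<omega>}"
    using assms by (intro measure_Un_le)
  finally show ?thesis .
qed

lemma little_oP1_if_abs_le:
  assumes X: "little_oP1 M X" and Y: "\<And>n. Y n \<in> borel_measurable M"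
    and le: "\<And>n \<omega>. \<omega> \<in> space M \<Longrightarrow> \<bar>Y n \<omega>\<bar> \<le> \<bar>X n \<omega>\<bar>"
  shows "little_oP1 M Y"
  unfolding little_oP1_iff
proof (intro conjI allI impI Y)
  fix e d :: real assume "e > 0" "d > 0"
  with X have "\<forall>\<^sub>F n in sequentially. measure M {\<omega> \<in> space M. e < \<bar>X n \<omega>\<bar>} < d"
    by (simp add: little_oP1_iff)
  then show "\<forall>\<^sub>F n in sequentially. measure M {\<omega> \<in> space M. e < \<bar>Y n \<omega>\<bar>} < d"
  proof eventually_elim
    case (elim n)
    have [measurable]: "X n \<in> borel_measurable M" using X by (simp add: little_oP1_iff)
    have "measure M {\<omega> \<in> space M. e < \<bar>Y n \<omega>\<bar>} \<le> measure M {\<omega> \<in> space M. e < \<bar>X n \<omega>\<bar>}"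
      using le by (intro finite_measure_mono) (auto intro: order_less_le_trans)
    then show ?case using elim by simp
  qed
qed

lemma little_oP1_cong:
  assumes "little_oP1 M X" "\<And>n \<omega>. \<omega> \<in> space M \<Longrightarrow> Y n \<omega> = X n \<omega>"
  shows "little_oP1 M Y"
proof -
  have "Y n \<in> borel_measurable M \<longleftrightarrow> X n \<in> borel_measurable M" for n
    by (rule measurable_cong) (use assms(2) in auto)
  then show ?thesis
    using assms by (intro little_oP1_if_abs_le[OF assms(1)]) (auto simp: little_oP1_iff)
qed

lemma little_oP1_zero: "little_oP1 M (\<lambda>n \<omega>. 0)"
  by (simp add: little_oP1_iff)

lemma little_oP1_add:
  assumes X: "little_oP1 M X" and Y: "little_oP1 M Y"
  shows "little_oP1 M (\<lambda>n \<omega>. X n \<omega> + Y n \<omega>)"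
proof -
  have [measurable]: "X n \<in> borel_measurable M" "Y n \<in> borel_measurable M" for n
    using assms by (auto simp: little_oP1_iff)
  show ?thesis
    unfolding little_oP1_iff
  proof (intro conjI allI impI)
    fix e d :: real assume "e > 0" "d > 0"
    then have "e/2 > 0" "d/2 > 0" by auto
    then have "\<forall>\<^sub>F n in sequentially. measure M {\<omega> \<in> space M. e/2 < \<bar>X n \<omega>\<bar>} < d/2"
      "\<forall>\<^sub>F n in sequentially. measure M {\<omega> \<in> space M. e/2 < \<bar>Y n \<omega>\<bar>} < d/2"
      using assms unfolding little_oP1_iff by blast+
    then show "\<forall>\<^sub>F n in sequentially. measure M {\<omega> \<in> space M. e < \<bar>X n \<omega> + Y n \<omega>\<bar>} < d"
    proof eventually_elim
      case (elim n)
      have "measure M {\<omega> \<in> space M. e < \<bar>X n \<omega> + Y n \<omega>\<bar>}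
        \<le> measure M {\<omega> \<in> space M. e/2 < \<bar>X n \<omega>\<bar>} + measure M {\<omega> \<in> space M. e/2 < \<bar>Y n \<omega>\<bar>}"
        by (rule measure_union_bound) auto
      then show ?case using elim by simp
    qed
  qed measurable
qed

lemma bounded_in_prob_add:
  assumes X: "bounded_in_prob M X" and Y: "bounded_in_prob M Y"
  shows "bounded_in_prob M (\<lambda>n \<omega>. X n \<omega> + Y n \<omega>)"
proof -
  have [measurable]: "X n \<in> borel_measurable M" "Y n \<in> borel_measurable M" for n
    using assms by (auto simp: bounded_in_prob_def)
  show ?thesis
    unfolding bounded_in_prob_def
  proof (intro conjI allI impI)
    fix e :: real assume "e > 0"
    then have "e/2 > 0" by simp
    then obtain K L where K: "K > 0" "\<forall>\<^sub>F n in sequentially. measure M {\<omega> \<in> space M. K < \<bar>X n \<omega>\<bar>} < e/2"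
      and L: "L > 0" "\<forall>\<^sub>F n in sequentially. measure M {\<omega> \<in> space M. L < \<bar>Y n \<omega>\<bar>} < e/2"
      using assms unfolding bounded_in_prob_def by meson
    from K(2) L(2) have "\<forall>\<^sub>F n in sequentially. measure M {\<omega> \<in> space M. K + L < \<bar>X n \<omega> + Y n \<omega>\<bar>} < e"
    proof eventually_elim
      case (elim n)
      have "measure M {\<omega> \<in> space M. K + L < \<bar>X n \<omega> + Y n \<omega>\<bar>}
        \<le> measure M {\<omega> \<in> space M. K < \<bar>X n \<omega>\<bar>} + measure M {\<omega> \<in> space M. L < \<bar>Y n \<omega>\<bar>}"
        by (rule measure_union_bound) auto
      then show ?case using elim by simp
    qed
    then show "\<exists>K>0. \<forall>\<^sub>F n in sequentially. measure M {\<omega> \<in> space M. K < \<bar>X n \<omega> + Y n \<omega>\<bar>} < e"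
      using K(1) L(1) by (intro exI[of _ "K + L"]) auto
  qed measurable
qed

lemma bounded_in_prob_mult:
  assumes X: "bounded_in_prob M X" and Y: "bounded_in_prob M Y"
  shows "bounded_in_prob M (\<lambda>n \<omega>. X n \<omega> * Y n \<omega>)"
proof -
  have [measurable]: "X n \<in> borel_measurable M" "Y n \<in> borel_measurable M" for n
    using assms by (auto simp: bounded_in_prob_def)
  show ?thesis
    unfolding bounded_in_prob_def
  proof (intro conjI allI impI)
    fix e :: real assume "e > 0"
    then have "e/2 > 0" by simp
    then obtain K L where K: "K > 0" "\<forall>\<^sub>F n in sequentially. measure M {\<omega> \<in> space M. K < \<bar>X n \<omega>\<bar>} < e/2"
      and L: "L > 0" "\<forall>\<^sub>F n in sequentially. measure M {\<omega> \<in> space M. L < \<bar>Y n \<omega>\<bar>} < e/2"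
      using assms unfolding bounded_in_prob_def by meson
    from K(2) L(2) have "\<forall>\<^sub>F n in sequentially. measure M {\<omega> \<in> space M. K * L < \<bar>X n \<omega> * Y n \<omega>\<bar>} < e"
    proof eventually_elim
      case (elim n)
      have "measure M {\<omega> \<in> space M. K * L < \<bar>X n \<omega> * Y n \<omega>\<bar>}
        \<le> measure M {\<omega> \<in> space M. K < \<bar>X n \<omega>\<bar>} + measure M {\<omega> \<in> space M. L < \<bar>Y n \<omega>\<bar>}"
      proof (rule measure_union_bound)
        show "K < \<bar>X n \<omega>\<bar> \<or> L < \<bar>Y n \<omega>\<bar>" if "K * L < \<bar>X n \<omega> * Y n \<omega>\<bar>" for \<omega>
          using that mult_mono[of "\<bar>X n \<omega>\<bar>" K "\<bar>Y n \<omega>\<bar>" L] K(1) by (force simp: abs_mult)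
      qed auto
      then show ?case using elim by simp
    qed
    then show "\<exists>K>0. \<forall>\<^sub>F n in sequentially. measure M {\<omega> \<in> space M. K < \<bar>X n \<omega> * Y n \<omega>\<bar>} < e"
      using K(1) L(1) by (intro exI[of _ "K * L"]) auto
  qed measurable
qed

lemma little_oP1_mult:
  assumes X: "little_oP1 M X" and Y: "bounded_in_prob M Y"
  shows "little_oP1 M (\<lambda>n \<omega>. X n \<omega> * Y n \<omega>)"
proof -
  have [measurable]: "X n \<in> borel_measurable M" "Y n \<in> borel_measurable M" for n
    using assms by (auto simp: bounded_in_prob_def little_oP1_iff)
  show ?thesis
    unfolding little_oP1_iff
  proof (intro conjI allI impI)
    fix e d :: real assume "e > 0" "d > 0"
    then have d2: "d/2 > 0" by simp
    then obtain L where L: "L > 0" "\<forall>\<^sub>F n in sequentially. measure M {\<omega> \<in> space M. L < \<bar>Y n \<omega>\<bar>} < d/2"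
      using Y unfolding bounded_in_prob_def by meson
    have "\<forall>\<^sub>F n in sequentially. measure M {\<omega> \<in> space M. e/L < \<bar>X n \<omega>\<bar>} < d/2"
      using X divide_pos_pos[OF \<open>e > 0\<close> \<open>L > 0\<close>] d2 unfolding little_oP1_iff by blast
    with L(2) show "\<forall>\<^sub>F n in sequentially. measure M {\<omega> \<in> space M. e < \<bar>X n \<omega> * Y n \<omega>\<bar>} < d"
    proof eventually_elim
      case (elim n)
      have "measure M {\<omega> \<in> space M. e < \<bar>X n \<omega> * Y n \<omega>\<bar>}
        \<le> measure M {\<omega> \<in> space M. e/L < \<bar>X n \<omega>\<bar>} + measure M {\<omega> \<in> space M. L < \<bar>Y n \<omega>\<bar>}"
      proof (rule measure_union_bound)
        show "e/L < \<bar>X n \<omega>\<bar> \<or> L < \<bar>Y n \<omega>\<bar>" if "e < \<bar>X n \<omega> * Y n \<omega>\<bar>" for \<omega>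
          using that mult_mono[of "\<bar>X n \<omega>\<bar>" "e/L" "\<bar>Y n \<omega>\<bar>" L] L(1) \<open>e > 0\<close> by (force simp: abs_mult)
      qed auto
      then show ?case using elim by simp
    qed
  qed measurable
qed

lemma little_oP1_imp_bounded: "little_oP1 M X \<Longrightarrow> bounded_in_prob M X"
  unfolding little_oP1_iff bounded_in_prob_def by (meson zero_less_one)

lemma bounded_in_prob_const: "bounded_in_prob M (\<lambda>n \<omega>. c)"
  unfolding bounded_in_prob_def by (auto intro!: exI[of _ "\<bar>c\<bar> + 1"])

lemma little_oP1_cmult: "little_oP1 M X \<Longrightarrow> little_oP1 M (\<lambda>n \<omega>. c * X n \<omega>)"
  using little_oP1_mult[OF _ bounded_in_prob_const, of X c] by (simp add: mult.commute)

lemma bounded_in_prob_cmult: "bounded_in_prob M X \<Longrightarrow> bounded_in_prob M (\<lambda>n \<omega>. c * X n \<omega>)"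
  by (intro bounded_in_prob_mult bounded_in_prob_const)

lemma bounded_in_prob_sum:
  "finite I \<Longrightarrow> (\<And>i. i \<in> I \<Longrightarrow> bounded_in_prob M (X i)) \<Longrightarrow> bounded_in_prob M (\<lambda>n \<omega>. \<Sum>i\<in>I. X i n \<omega>)"
  by (induction rule: finite_induct) (auto intro: bounded_in_prob_add bounded_in_prob_const)

lemma little_oP1_inverse_sqrt: "little_oP1 M (\<lambda>n \<omega>. 1 / sqrt (real n))"
  unfolding little_oP1_iff
proof (intro conjI allI impI)
  fix e d :: real assume "e > 0" "d > 0"
  have "(\<lambda>n. 1 / sqrt (real n)) \<longlonglongrightarrow> 0"
    by (intro tendsto_divide_0[OF tendsto_const] filterlim_at_top_imp_at_infinity
        filterlim_compose[OF sqrt_at_top filterlim_real_sequentially])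
  then have "\<forall>\<^sub>F n in sequentially. \<bar>1 / sqrt (real n)\<bar> < e"
    using \<open>e > 0\<close> by (auto simp: tendsto_iff dist_real_def)
  then show "\<forall>\<^sub>F n in sequentially. measure M {\<omega> \<in> space M. e < \<bar>1 / sqrt (real n)\<bar>} < d"
    by eventually_elim (use \<open>d > 0\<close> in auto)
qed auto

section \<open>Stochastic expansions to first order\<close>

lemma lin_exp_bounded:
  assumes "lin_exp M X c L"
  shows "bounded_in_prob M (\<lambda>n \<omega>. sqrt (real n) * (X n \<omega> - c))"
proof -
  have "bounded_in_prob M (\<lambda>n \<omega>. sqrt (real n) * (X n \<omega> - c - L n \<omega>) + sqrt (real n) * L n \<omega>)"
    using assms unfolding lin_exp_def
    by (intro bounded_in_prob_add[OF little_oP1_imp_bounded]) auto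
  then show ?thesis by (simp add: algebra_simps)
qed

lemma lin_exp_const: "lin_exp M (\<lambda>n \<omega>. c) c (\<lambda>n \<omega>. 0)"
  by (simp add: lin_exp_def little_oP1_zero bounded_in_prob_const)

lemma lin_exp_add:
  assumes "lin_exp M X c L" "lin_exp M Y d K"
  shows "lin_exp M (\<lambda>n \<omega>. X n \<omega> + Y n \<omega>) (c + d) (\<lambda>n \<omega>. L n \<omega> + K n \<omega>)"
proof -
  have "bounded_in_prob M (\<lambda>n \<omega>. sqrt (real n) * L n \<omega> + sqrt (real n) * K n \<omega>)"
    "little_oP1 M (\<lambda>n \<omega>. sqrt (real n) * (X n \<omega> - c - L n \<omega>) + sqrt (real n) * (Y n \<omega> - d - K n \<omega>))"
    using assms unfolding lin_exp_def by (auto intro!: bounded_in_prob_add little_oP1_add)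
  moreover have "(\<lambda>\<omega>. X n \<omega> + Y n \<omega>) \<in> borel_measurable M" for n
    using assms by (intro borel_measurable_add) (auto simp: lin_exp_def)
  ultimately show ?thesis
    by (simp add: lin_exp_def algebra_simps)
qed

lemma lin_exp_sum:
  "finite I \<Longrightarrow> (\<And>i. i \<in> I \<Longrightarrow> lin_exp M (X i) (c i) (L i)) \<Longrightarrow>
    lin_exp M (\<lambda>n \<omega>. \<Sum>i\<in>I. X i n \<omega>) (\<Sum>i\<in>I. c i) (\<lambda>n \<omega>. \<Sum>i\<in>I. L i n \<omega>)"
  by (induction rule: finite_induct) (auto intro: lin_exp_add lin_exp_const)

lemma lin_exp_mult:
  assumes X: "lin_exp M X c L" and Y: "lin_exp M Y d K"
  shows "lin_exp M (\<lambda>n \<omega>. X n \<omega> * Y n \<omega>) (c * d) (\<lambda>n \<omega>. c * K n \<omega> + d * L n \<omega>)"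
proof -
  have [measurable]: "X n \<in> borel_measurable M" "Y n \<in> borel_measurable M" for n
    using assms by (auto simp: lin_exp_def)
  have "bounded_in_prob M (\<lambda>n \<omega>. c * (sqrt (real n) * K n \<omega>) + d * (sqrt (real n) * L n \<omega>))"
    using assms unfolding lin_exp_def by (intro bounded_in_prob_add bounded_in_prob_cmult) auto
  then have 1: "bounded_in_prob M (\<lambda>n \<omega>. sqrt (real n) * (c * K n \<omega> + d * L n \<omega>))"
    by (simp add: algebra_simps)
  \<comment> \<open>The product of the two deviations, rescaled, is \<open>1 / sqrt n\<close> times
    a product of two sequences bounded in probability. It is the only term of second order.\<close>
  define R where "R n \<omega> = 1 / sqrt (real n) * ((sqrt (real n) * (X n \<omega> - c)) * (sqrt (real n) * (Y n \<omega> - d)))"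
    for n \<omega>
  have "little_oP1 M R"
    unfolding R_def
    by (intro little_oP1_mult little_oP1_inverse_sqrt bounded_in_prob_mult lin_exp_bounded[OF X] lin_exp_bounded[OF Y])
  then have "little_oP1 M (\<lambda>n \<omega>. R n \<omega> + c * (sqrt (real n) * (Y n \<omega> - d - K n \<omega>))
      + d * (sqrt (real n) * (X n \<omega> - c - L n \<omega>)))"
    using assms unfolding lin_exp_def by (intro little_oP1_add little_oP1_cmult) auto
  moreover have "sqrt (real n) * (X n \<omega> * Y n \<omega> - c * d - (c * K n \<omega> + d * L n \<omega>))
    = R n \<omega> + c * (sqrt (real n) * (Y n \<omega> - d - K n \<omega>)) + d * (sqrt (real n) * (X n \<omega> - c - L n \<omega>))" for n \<omega>
  \<comment> \<open>For \<open>n = 0\<close> both sides are 0, because \<open>sqrt 0 = 0\<close>;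
    otherwise the square roots in \<open>R\<close> cancel.\<close>
  proof (cases "n = 0")
    case False
    then have "R n \<omega> = sqrt (real n) * ((X n \<omega> - c) * (Y n \<omega> - d))"
      by (simp add: R_def)
    then show ?thesis by (simp add: algebra_simps)
  qed (simp add: R_def)
  ultimately show ?thesis
    using 1 by (simp add: lin_exp_def)
qed

lemma lin_exp_cmult:
  "lin_exp M X c L \<Longrightarrow> lin_exp M (\<lambda>n \<omega>. a * X n \<omega>) (a * c) (\<lambda>n \<omega>. a * L n \<omega>)"
  using lin_exp_mult[OF lin_exp_const, of X c L a] by simp

lemma lin_exp_diff:
  assumes "lin_exp M X c L" "lin_exp M Y d K"
  shows "lin_exp M (\<lambda>n \<omega>. X n \<omega> - Y n \<omega>) (c - d) (\<lambda>n \<omega>. L n \<omega> - K n \<omega>)"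
  using lin_exp_add[OF assms(1) lin_exp_cmult[OF assms(2), of "- 1"]] by simp

lemma lin_exp_cong:
  assumes "lin_exp M X c L" "\<And>n \<omega>. \<omega> \<in> space M \<Longrightarrow> X' n \<omega> = X n \<omega>" "c' = c"
    "\<And>n \<omega>. \<omega> \<in> space M \<Longrightarrow> L' n \<omega> = L n \<omega>"
  shows "lin_exp M X' c' L'"
proof -
  have "X' n \<in> borel_measurable M \<longleftrightarrow> X n \<in> borel_measurable M" for n
    by (rule measurable_cong) (use assms in auto)
  moreover have "bounded_in_prob M (\<lambda>n \<omega>. sqrt (real n) * L' n \<omega>)"
  proof -
    have "(\<lambda>\<omega>. sqrt (real n) * L' n \<omega>) \<in> borel_measurable M \<longleftrightarrow> (\<lambda>\<omega>. sqrt (real n) * L n \<omega>) \<in> borel_measurable M" for n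
      by (rule measurable_cong) (use assms in auto)
    moreover have "{\<omega> \<in> space M. K < \<bar>sqrt (real n) * L' n \<omega>\<bar>} = {\<omega> \<in> space M. K < \<bar>sqrt (real n) * L n \<omega>\<bar>}" for n K
      using assms by auto
    ultimately show ?thesis
      using assms(1) unfolding lin_exp_def bounded_in_prob_def by simp
  qed
  moreover have "little_oP1 M (\<lambda>n \<omega>. sqrt (real n) * (X' n \<omega> - c' - L' n \<omega>))"
    by (rule little_oP1_cong[of "\<lambda>n \<omega>. sqrt (real n) * (X n \<omega> - c - L n \<omega>)"])
      (use assms in \<open>auto simp: lin_exp_def\<close>)
  ultimately show ?thesis
    using assms(1) by (simp add: lin_exp_def)
qed

lemma lin_exp_tendsto_in_prob:
  assumes X: "lin_exp M X c L"
  shows "little_oP1 M (\<lambda>n \<omega>. X n \<omega> - c)"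
proof -
  have [measurable]: "X n \<in> borel_measurable M" for n using X by (simp add: lin_exp_def)
  have "little_oP1 M (\<lambda>n \<omega>. 1 / sqrt (real n) * (sqrt (real n) * (X n \<omega> - c)))"
    by (intro little_oP1_mult little_oP1_inverse_sqrt lin_exp_bounded[OF X])
  then have "\<forall>\<^sub>F n in sequentially. measure M {\<omega> \<in> space M. e < \<bar>X n \<omega> - c\<bar>} < d"
    if "e > 0" "d > 0" for e d
  proof -
    have "\<forall>\<^sub>F n in sequentially. measure M {\<omega> \<in> space M. e < \<bar>1 / sqrt (real n) * (sqrt (real n) * (X n \<omega> - c))\<bar>} < d"
      using \<open>little_oP1 M (\<lambda>n \<omega>. 1 / sqrt (real n) * (sqrt (real n) * (X n \<omega> - c)))\<close> that
      unfolding little_oP1_iff by blast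
    then show ?thesis
      using eventually_gt_at_top[of 0] by eventually_elim simp
  qed
  then show ?thesis by (simp add: little_oP1_iff)
qed

text \<open>Delta method with differentiability at one point. On the likely event that the scaled
  deviation is at most \<open>K\<close>, the point is within \<delta> of \<open>x0\<close> once
  \<open>sqrt n > K / \<delta>\<close>; there the remainder is at most \<open>e / K\<close> times
  the distance, hence at most \<open>e\<close> after scaling. The set \<open>S\<close> later
  consists of the symmetric matrices.\<close>

lemma little_oP1_delta:
  fixes f :: "'b::euclidean_space \<Rightarrow> real"
  assumes X: "\<And>n. X n \<in> borel_measurable M" "\<And>n \<omega>. \<omega> \<in> space M \<Longrightarrow> X n \<omega> \<in> S"
    and bdd: "bounded_in_prob M (\<lambda>n \<omega>. sqrt (real n) * norm (X n \<omega> - x0))"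
    and f: "f \<in> borel_measurable borel" and deriv: "(f has_derivative f') (at x0 within S)"
  shows "little_oP1 M (\<lambda>n \<omega>. sqrt (real n) * (f (X n \<omega>) - f x0 - f' (X n \<omega> - x0)))"
  unfolding little_oP1_iff
proof (intro conjI allI impI)
  have f': "f' \<in> borel_measurable borel"
    using has_derivative_bounded_linear[OF deriv]
    by (intro borel_measurable_continuous_onI linear_continuous_on)
  have [measurable]: "(\<lambda>\<omega>. f (X n \<omega>)) \<in> borel_measurable M" "X n \<in> borel_measurable M" for n
    using measurable_compose[OF X(1) f] X(1) by auto
  have [measurable]: "(\<lambda>\<omega>. f' (X n \<omega> - x0)) \<in> borel_measurable M" for n
    by (rule measurable_compose[OF _ f']) measurable
  show "(\<lambda>\<omega>. sqrt (real n) * (f (X n \<omega>) - f x0 - f' (X n \<omega> - x0))) \<in> borel_measurable M" for n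
    by measurable
  fix e d :: real assume "e > 0" "d > 0"
  obtain K where K: "K > 0"
    "\<forall>\<^sub>F n in sequentially. measure M {\<omega> \<in> space M. K < \<bar>sqrt (real n) * norm (X n \<omega> - x0)\<bar>} < d"
    using bdd \<open>d > 0\<close> unfolding bounded_in_prob_def by meson
  have "e / K > 0" using \<open>e > 0\<close> K by simp
  then obtain \<delta> where \<delta>: "\<delta> > 0" "\<And>x. x \<in> S \<Longrightarrow> norm (x - x0) < \<delta> \<Longrightarrow>
      norm (f x - f x0 - f' (x - x0)) \<le> e / K * norm (x - x0)"
    using deriv unfolding has_derivative_within_alt by meson
  have "\<forall>\<^sub>F n in sequentially. K / \<delta> < sqrt (real n)"
    using filterlim_compose[OF sqrt_at_top filterlim_real_sequentially]
    by (simp add: filterlim_at_top_dense)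
  with K(2) show "\<forall>\<^sub>F n in sequentially.
      measure M {\<omega> \<in> space M. e < \<bar>sqrt (real n) * (f (X n \<omega>) - f x0 - f' (X n \<omega> - x0))\<bar>} < d"
  proof eventually_elim
    case (elim n)
    have "\<bar>sqrt (real n) * (f (X n \<omega>) - f x0 - f' (X n \<omega> - x0))\<bar> \<le> e"
      if \<omega>: "\<omega> \<in> space M" and le: "sqrt (real n) * norm (X n \<omega> - x0) \<le> K" for \<omega>
    proof -
      have "K < sqrt (real n) * \<delta>" using elim(2) \<delta>(1) by (simp add: field_simps)
      then have "sqrt (real n) * norm (X n \<omega> - x0) < sqrt (real n) * \<delta>" using le by simp
      then have "norm (X n \<omega> - x0) < \<delta>"
        by (metis mult_less_cancel_left not_less real_sqrt_ge_zero of_nat_0_le_iff)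
      then have "\<bar>f (X n \<omega>) - f x0 - f' (X n \<omega> - x0)\<bar> \<le> e / K * norm (X n \<omega> - x0)"
        using \<delta>(2) X(2)[OF \<omega>] by simp
      then have "sqrt (real n) * \<bar>f (X n \<omega>) - f x0 - f' (X n \<omega> - x0)\<bar> \<le> sqrt (real n) * (e / K * norm (X n \<omega> - x0))"
        by (intro mult_left_mono) auto
      also have "\<dots> = e / K * (sqrt (real n) * norm (X n \<omega> - x0))" by simp
      also have "\<dots> \<le> e / K * K"
        using \<open>e / K > 0\<close> le by (intro mult_left_mono) auto
      finally show ?thesis using K by (simp add: abs_mult)
    qed
    then have "measure M {\<omega> \<in> space M. e < \<bar>sqrt (real n) * (f (X n \<omega>) - f x0 - f' (X n \<omega> - x0))\<bar>}
      \<le> measure M {\<omega> \<in> space M. K < \<bar>sqrt (real n) * norm (X n \<omega> - x0)\<bar>}"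
      by (intro finite_measure_mono) (auto simp: not_le[symmetric] abs_mult)
    then show ?case using elim(1) by simp
  qed
qed

lemma bounded_in_prob_norm_matrix:
  fixes X :: "nat \<Rightarrow> 'a \<Rightarrow> real^'n^'m"
  assumes "\<And>i j. lin_exp M (\<lambda>n \<omega>. X n \<omega> $ i $ j) (x0 $ i $ j) (L i j)" and X: "\<And>n. X n \<in> borel_measurable M"
  shows "bounded_in_prob M (\<lambda>n \<omega>. sqrt (real n) * norm (X n \<omega> - x0))"
proof -
  let ?Y = "\<lambda>n \<omega>. \<Sum>i\<in>UNIV. \<Sum>j\<in>UNIV. 1 * \<bar>sqrt (real n) * (X n \<omega> $ i $ j - x0 $ i $ j)\<bar>"
  have "bounded_in_prob M (\<lambda>n \<omega>. \<bar>sqrt (real n) * (X n \<omega> $ i $ j - x0 $ i $ j)\<bar>)" for i j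
    using lin_exp_bounded[OF assms(1)[of i j]] unfolding bounded_in_prob_def
    by (simp add: borel_measurable_abs)
  then have Y: "bounded_in_prob M ?Y"
    by (intro bounded_in_prob_sum bounded_in_prob_cmult) auto
  have le: "\<bar>sqrt (real n) * norm (X n \<omega> - x0)\<bar> \<le> \<bar>?Y n \<omega>\<bar>" for n \<omega>
  proof -
    have "norm (X n \<omega> - x0) \<le> (\<Sum>i\<in>UNIV. norm ((X n \<omega> - x0) $ i))"
      by (simp add: norm_vec_def L2_set_le_sum)
    also have "\<dots> \<le> (\<Sum>i\<in>UNIV. \<Sum>j\<in>UNIV. \<bar>(X n \<omega> - x0) $ i $ j\<bar>)"
      by (intro sum_mono norm_le_l1_cart)
    finally have "sqrt (real n) * norm (X n \<omega> - x0) \<le> sqrt (real n) * (\<Sum>i\<in>UNIV. \<Sum>j\<in>UNIV. \<bar>(X n \<omega> - x0) $ i $ j\<bar>)"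
      by (intro mult_left_mono) auto
    also have "\<dots> = ?Y n \<omega>"
      by (simp add: sum_distrib_left abs_mult)
    finally show ?thesis by simp
  qed
  have [measurable]: "X n \<in> borel_measurable M" for n by (rule X)
  have Ym[measurable]: "?Y n \<in> borel_measurable M" for n using Y unfolding bounded_in_prob_def by blast
  show ?thesis
    unfolding bounded_in_prob_def
  proof (intro conjI allI impI)
    fix e :: real assume "e > 0"
    then obtain K where K: "K > 0" "\<forall>\<^sub>F n in sequentially. measure M {\<omega> \<in> space M. K < \<bar>?Y n \<omega>\<bar>} < e"
      using Y unfolding bounded_in_prob_def by meson
    from K(2) have "\<forall>\<^sub>F n in sequentially. measure M {\<omega> \<in> space M. K < \<bar>sqrt (real n) * norm (X n \<omega> - x0)\<bar>} < e"
    proof eventually_elim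
      case (elim n)
      have "measure M {\<omega> \<in> space M. K < \<bar>sqrt (real n) * norm (X n \<omega> - x0)\<bar>} \<le> measure M {\<omega> \<in> space M. K < \<bar>?Y n \<omega>\<bar>}"
      proof (rule finite_measure_mono)
        show "{\<omega> \<in> space M. K < \<bar>sqrt (real n) * norm (X n \<omega> - x0)\<bar>} \<subseteq> {\<omega> \<in> space M. K < \<bar>?Y n \<omega>\<bar>}"
          using le[of n] by (blast intro: order_less_le_trans)
        show "{\<omega> \<in> space M. K < \<bar>?Y n \<omega>\<bar>} \<in> sets M"
          by measurable
      qed
      then show ?case using elim by linarith
    qed
    then show "\<exists>K>0. \<forall>\<^sub>F n in sequentially. measure M {\<omega> \<in> space M. K < \<bar>sqrt (real n) * norm (X n \<omega> - x0)\<bar>} < e"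
      using K(1) by blast
  qed measurable
qed

lemma little_oP1_norm_matrix:
  fixes X :: "nat \<Rightarrow> 'a \<Rightarrow> real^'n^'m"
  assumes "\<And>i j. lin_exp M (\<lambda>n \<omega>. X n \<omega> $ i $ j) (x0 $ i $ j) (L i j)"
  shows "little_oP1 M (\<lambda>n \<omega>. norm (X n \<omega> - x0))"
proof -
  have [measurable]: "X n \<in> borel_measurable M" for n
    using assms by (intro borel_measurable_matrixI) (auto simp: lin_exp_def)
  \<comment> \<open>The norm serves as its own linear part around 0, so the remainder vanishes and
    consistency follows from the rule for expansions.\<close>
  have "lin_exp M (\<lambda>n \<omega>. norm (X n \<omega> - x0)) 0 (\<lambda>n \<omega>. norm (X n \<omega> - x0))"
    using bounded_in_prob_norm_matrix[OF assms] by (auto simp: lin_exp_def little_oP1_zero)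
  from lin_exp_tendsto_in_prob[OF this] show ?thesis by simp
qed

text \<open>A derivative that reads a single entry is enough: at their centres, both the inverse
  root and the nearest diagonaliser respond entrywise to first order.\<close>

lemma lin_exp_delta:
  fixes X :: "nat \<Rightarrow> 'a \<Rightarrow> real^'n^'m"
  assumes X: "\<And>n. X n \<in> borel_measurable M" "\<And>n \<omega>. \<omega> \<in> space M \<Longrightarrow> X n \<omega> \<in> S"
    and exp: "\<And>i j. lin_exp M (\<lambda>n \<omega>. X n \<omega> $ i $ j) (x0 $ i $ j) (L i j)"
    and f: "f \<in> borel_measurable borel" and deriv: "(f has_derivative (\<lambda>E. c * E $ i $ j)) (at x0 within S)"
  shows "lin_exp M (\<lambda>n \<omega>. f (X n \<omega>)) (f x0) (\<lambda>n \<omega>. c * L i j n \<omega>)"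
proof -
  have "little_oP1 M (\<lambda>n \<omega>. sqrt (real n) * (f (X n \<omega>) - f x0 - c * (X n \<omega> - x0) $ i $ j)
      + c * (sqrt (real n) * (X n \<omega> $ i $ j - x0 $ i $ j - L i j n \<omega>)))"
    using exp[of i j] unfolding lin_exp_def
    by (intro little_oP1_add little_oP1_cmult
        little_oP1_delta[OF X bounded_in_prob_norm_matrix[OF exp X(1)] f deriv]) auto
  moreover have "bounded_in_prob M (\<lambda>n \<omega>. c * (sqrt (real n) * L i j n \<omega>))"
    using exp[of i j] unfolding lin_exp_def by (intro bounded_in_prob_cmult) auto
  ultimately show ?thesis
    using measurable_compose[OF X(1) f] by (simp add: lin_exp_def algebra_simps)
qed

section \<open>Sample means\<close>

lemma expectation_sq_sum_indep:
  fixes Y :: "nat \<Rightarrow> 'a \<Rightarrow> real"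
  assumes indep: "indep_vars (\<lambda>_. borel) Y UNIV" and sq: "\<And>i. integrable M (\<lambda>\<omega>. (Y i \<omega>)\<^sup>2)"
    and mean: "\<And>i. expectation (Y i) = 0" and var: "\<And>i. expectation (\<lambda>\<omega>. (Y i \<omega>)\<^sup>2) = v"
  shows "integrable M (\<lambda>\<omega>. (\<Sum>i<n. Y i \<omega>)\<^sup>2) \<and> expectation (\<lambda>\<omega>. (\<Sum>i<n. Y i \<omega>)\<^sup>2) = real n * v"
proof (induction n)
  case (Suc n)
  have meas: "Y i \<in> borel_measurable M" for i
    using indep by (auto simp: indep_vars_def)
  have int: "integrable M (Y i)" for i
    using square_integrable_imp_integrable[OF meas sq] .
  let ?S = "\<lambda>\<omega>. \<Sum>i<n. Y i \<omega>"
  have ind: "indep_var borel (Y n) borel ?S"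
    by (rule indep_vars_sum) (auto intro: indep_vars_subset[OF indep])
  have S: "integrable M ?S"
    by (intro Bochner_Integration.integrable_sum int)
  have prod: "integrable M (\<lambda>\<omega>. Y n \<omega> * ?S \<omega>)" "expectation (\<lambda>\<omega>. Y n \<omega> * ?S \<omega>) = 0"
    using indep_var_integrable[OF ind int S] indep_var_lebesgue_integral[OF ind int S] mean by auto
  have eq: "(\<Sum>i<Suc n. Y i \<omega>)\<^sup>2 = (?S \<omega>)\<^sup>2 + 2 * (Y n \<omega> * ?S \<omega>) + (Y n \<omega>)\<^sup>2" for \<omega>
    by (simp add: power2_sum)
  show ?case
    unfolding eq using Suc prod sq var by (simp add: algebra_simps)
qed simp

end

text \<open>The linear part is the whole deviation, so the remainder is 0 and only boundedness in
  probability is at stake. The variance of the scaled deviation is the same \<open>v\<close> for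
  every positive sample size, which gives the tail bound \<open>v / K\<^sup>2\<close>.\<close>

lemma (in prob_space) lin_exp_sample_mean:
  fixes Zs :: "nat \<Rightarrow> 'a \<Rightarrow> 'b::topological_space" and g :: "'b \<Rightarrow> real"
  assumes Z: "Z \<in> borel_measurable M" and indep: "indep_vars (\<lambda>_. borel) Zs UNIV"
    and distr: "\<And>i. distr M borel (Zs i) = distr M borel Z"
    and g: "g \<in> borel_measurable borel" and sq: "integrable M (\<lambda>\<omega>. (g (Z \<omega>))\<^sup>2)"
  defines "\<mu> \<equiv> expectation (\<lambda>\<omega>. g (Z \<omega>))"
  shows "lin_exp M (\<lambda>n \<omega>. 1 / real n * (\<Sum>i<n. g (Zs i \<omega>))) \<mu>
    (\<lambda>n \<omega>. 1 / real n * (\<Sum>i<n. g (Zs i \<omega>)) - \<mu>)"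
proof -
  have Zs: "Zs i \<in> borel_measurable M" for i
    using indep by (auto simp: indep_vars_def)
  have [measurable]: "(\<lambda>\<omega>. g (Zs i \<omega>)) \<in> borel_measurable M" "(\<lambda>\<omega>. g (Z \<omega>)) \<in> borel_measurable M" for i
    using measurable_compose[OF Zs g] measurable_compose[OF Z g] by auto
  define Y where "Y i \<omega> = g (Zs i \<omega>) - \<mu>" for i \<omega>
  have [measurable]: "Y i \<in> borel_measurable M" for i
    unfolding Y_def by measurable
  have transfer: "integrable M (\<lambda>\<omega>. f (Zs i \<omega>)) \<longleftrightarrow> integrable M (\<lambda>\<omega>. f (Z \<omega>))"
    "expectation (\<lambda>\<omega>. f (Zs i \<omega>)) = expectation (\<lambda>\<omega>. f (Z \<omega>))"
    if f: "f \<in> borel_measurable borel" for f :: "'b \<Rightarrow> real" and i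
    using integrable_distr_eq[OF Zs f, of i] integrable_distr_eq[OF Z f]
      integral_distr[OF Zs f, of i] integral_distr[OF Z f] distr by simp_all
  have int: "integrable M (\<lambda>\<omega>. g (Z \<omega>))"
    by (rule square_integrable_imp_integrable[OF _ sq]) measurable
  define v where "v = expectation (\<lambda>\<omega>. (g (Z \<omega>) - \<mu>)\<^sup>2)"
  have int2: "integrable M (\<lambda>\<omega>. (g (Z \<omega>) - \<mu>)\<^sup>2)"
    using int sq by (simp add: power2_diff)
  have "indep_vars (\<lambda>_. borel) Y UNIV"
    unfolding Y_def by (rule indep_vars_compose2[OF indep]) (use g in measurable)
  moreover have "integrable M (\<lambda>\<omega>. (Y i \<omega>)\<^sup>2)" "expectation (\<lambda>\<omega>. (Y i \<omega>)\<^sup>2) = v" for i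
    using transfer[of "\<lambda>x. (g x - \<mu>)\<^sup>2" i] int2 g unfolding Y_def v_def by simp_all
  moreover have "expectation (Y i) = 0" for i
    using transfer[of "\<lambda>x. g x - \<mu>" i] int g unfolding Y_def by (simp add: \<mu>_def prob_space)
  ultimately have S: "integrable M (\<lambda>\<omega>. (\<Sum>i<n. Y i \<omega>)\<^sup>2)"
    "expectation (\<lambda>\<omega>. (\<Sum>i<n. Y i \<omega>)\<^sup>2) = real n * v" for n
    using expectation_sq_sum_indep[of Y v n] by blast+
  have v: "v \<ge> 0" unfolding v_def by (intro integral_nonneg_AE) auto
  have cheb: "measure M {\<omega> \<in> space M. K < \<bar>sqrt (real n) * (1 / real n * (\<Sum>i<n. g (Zs i \<omega>)) - \<mu>)\<bar>} \<le> v / K\<^sup>2"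
    if "K > 0" "n > 0" for K n
  proof -
    have eq: "(sqrt (real n) * (1 / real n * (\<Sum>i<n. g (Zs i \<omega>)) - \<mu>))\<^sup>2 = (\<Sum>i<n. Y i \<omega>)\<^sup>2 / real n" for \<omega>
    proof -
      have "1 / real n * (\<Sum>i<n. g (Zs i \<omega>)) - \<mu> = (\<Sum>i<n. Y i \<omega>) / real n"
        using that by (simp add: Y_def sum_subtractf diff_divide_distrib)
      then show ?thesis
        using that by (simp add: power_mult_distrib power_divide power2_eq_square[of "real n"])
    qed
    have "measure M {\<omega> \<in> space M. K < \<bar>sqrt (real n) * (1 / real n * (\<Sum>i<n. g (Zs i \<omega>)) - \<mu>)\<bar>}
        \<le> measure M {\<omega> \<in> space M. (\<Sum>i<n. Y i \<omega>)\<^sup>2 / real n \<ge> K\<^sup>2}"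
    proof (rule finite_measure_mono)
      show "{\<omega> \<in> space M. K < \<bar>sqrt (real n) * (1 / real n * (\<Sum>i<n. g (Zs i \<omega>)) - \<mu>)\<bar>}
          \<subseteq> {\<omega> \<in> space M. (\<Sum>i<n. Y i \<omega>)\<^sup>2 / real n \<ge> K\<^sup>2}"
        unfolding eq[symmetric] using \<open>K > 0\<close> by (auto simp: abs_le_square_iff[symmetric])
    qed measurable
    also have "\<dots> \<le> expectation (\<lambda>\<omega>. (\<Sum>i<n. Y i \<omega>)\<^sup>2 / real n) / K\<^sup>2"
      using S(1) \<open>K > 0\<close> by (intro integral_Markov_inequality_measure[where A = "{}"]) auto
    also have "\<dots> = v / K\<^sup>2"
      using S(2) \<open>n > 0\<close> by simp
    finally show ?thesis .
  qed
  have "bounded_in_prob M (\<lambda>n \<omega>. sqrt (real n) * (1 / real n * (\<Sum>i<n. g (Zs i \<omega>)) - \<mu>))"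
    unfolding bounded_in_prob_def
  proof (intro conjI allI impI)
    fix e :: real assume "e > 0"
    \<comment> \<open>The summand 1 makes \<open>v / K\<^sup>2 < e\<close> strict and keeps
      \<open>K\<close> positive when \<open>v = 0\<close>.\<close>
    define K where "K = sqrt (v / e) + 1"
    have K: "K > 0" using v \<open>e > 0\<close> by (simp add: K_def add_nonneg_pos)
    have "v / e < K\<^sup>2"
    proof -
      have "v / e \<ge> 0" using v \<open>e > 0\<close> by simp
      then have "K\<^sup>2 = v / e + 2 * sqrt (v / e) + 1" "sqrt (v / e) \<ge> 0"
        by (simp_all only: K_def power2_sum real_sqrt_pow2 real_sqrt_ge_zero) auto
      then show ?thesis by linarith
    qed
    then have "v / K\<^sup>2 < e" using K \<open>e > 0\<close> by (simp add: field_simps)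
    then have "\<forall>\<^sub>F n in sequentially. measure M {\<omega> \<in> space M. K < \<bar>sqrt (real n) * (1 / real n * (\<Sum>i<n. g (Zs i \<omega>)) - \<mu>)\<bar>} < e"
      by (intro eventually_mono[OF eventually_gt_at_top[of "0 :: nat"]] le_less_trans[OF cheb[OF K]])
    then show "\<exists>K>0. \<forall>\<^sub>F n in sequentially. measure M {\<omega> \<in> space M. K < \<bar>sqrt (real n) * (1 / real n * (\<Sum>i<n. g (Zs i \<omega>)) - \<mu>)\<bar>} < e"
      using K by blast
  qed measurable
  then show ?thesis
    by (simp add: lin_exp_def little_oP1_zero)
qed

section \<open>Empirical moments about the sample mean, and monomials in the entries\<close>

lemma mean_centered_product2:
  fixes a b :: "nat \<Rightarrow> real" and n :: nat
  defines "E \<equiv> \<lambda>f. 1 / real n * (\<Sum>i<n. f i)"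
  shows "E (\<lambda>i. (a i - E a) * (b i - E b)) = E (\<lambda>i. a i * b i) - E a * E b"
proof (cases "n = 0")
  case False
  have E: "E (\<lambda>i. f i + g i) = E f + E g" "E (\<lambda>i. f i - g i) = E f - E g" "E (\<lambda>i. c * f i) = c * E f"
    "E (\<lambda>i. c) = c" for f g c
    using False by (simp_all add: E_def sum.distrib sum_subtractf sum_distrib_left add_divide_distrib diff_divide_distrib)
  have "(\<lambda>i. (a i - E a) * (b i - E b)) = (\<lambda>i. a i * b i - E a * b i - E b * a i + E a * E b)"
    by (simp add: fun_eq_iff algebra_simps)
  then show ?thesis by (simp add: E)
qed (simp add: E_def)

text \<open>In the expanded product, each of the four terms of third degree in the means averages to
  minus the product of all four means. The term of fourth degree adds that product once, which
  leaves the coefficient -3.\<close>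

lemma mean_centered_product4:
  fixes a b c d :: "nat \<Rightarrow> real" and n :: nat
  defines "E \<equiv> \<lambda>f. 1 / real n * (\<Sum>i<n. f i)"
  shows "E (\<lambda>i. (a i - E a) * (b i - E b) * (c i - E c) * (d i - E d)) =
    E (\<lambda>i. a i * b i * c i * d i)
    - E a * E (\<lambda>i. b i * c i * d i) - E b * E (\<lambda>i. a i * c i * d i)
    - E c * E (\<lambda>i. a i * b i * d i) - E d * E (\<lambda>i. a i * b i * c i)
    + E a * E b * E (\<lambda>i. c i * d i) + E a * E c * E (\<lambda>i. b i * d i) + E a * E d * E (\<lambda>i. b i * c i)
    + E b * E c * E (\<lambda>i. a i * d i) + E b * E d * E (\<lambda>i. a i * c i) + E c * E d * E (\<lambda>i. a i * b i)
    - 3 * (E a * E b * E c * E d)"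
proof (cases "n = 0")
  case False
  have E: "E (\<lambda>i. f i + g i) = E f + E g" "E (\<lambda>i. f i - g i) = E f - E g" "E (\<lambda>i. c * f i) = c * E f"
    "E (\<lambda>i. c) = c" for f g c
    using False by (simp_all add: E_def sum.distrib sum_subtractf sum_distrib_left add_divide_distrib diff_divide_distrib)
  have expand: "(w - A) * (x - B) * (y - C) * (z - D) = w * x * y * z
    - A * (x * y * z) - B * (w * y * z) - C * (w * x * z) - D * (w * x * y)
    + A * B * (y * z) + A * C * (x * z) + A * D * (x * y)
    + B * C * (w * z) + B * D * (w * y) + C * D * (w * x)
    - A * B * C * z - A * B * D * y - A * C * D * x - B * C * D * w + A * B * C * D"
    for w x y z A B C D :: real
    by algebra
  show ?thesis
    unfolding expand E by algebra
qed (simp add: E_def)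

text \<open>Positions as pairs form one finite index type, so that monomials can be named by lists
  of positions.\<close>

definition entry :: "real^'q^'p \<Rightarrow> 'p \<times> 'q \<Rightarrow> real"
  where "entry x e = x $ fst e $ snd e"

lemma entry_Pair [simp]: "entry x (k, l) = x $ k $ l"
  by (simp add: entry_def)

text \<open>Collecting repeated positions turns a monomial into a product of powers of distinct
  entries, the form to which independence applies.\<close>

lemma prod_list_map_eq_prod_count:
  fixes f :: "'b::finite \<Rightarrow> 'c::comm_monoid_mult"
  shows "prod_list (map f es) = (\<Prod>e\<in>UNIV. f e ^ count_list es e)"
proof (induction es)
  case (Cons e es)
  have "(\<Prod>a\<in>UNIV. f a ^ count_list (e # es) a)
      = (\<Prod>a\<in>UNIV. (if a = e then f a else 1) * f a ^ count_list es a)"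
    by (intro prod.cong) auto
  also have "\<dots> = f e * (\<Prod>a\<in>UNIV. f a ^ count_list es a)"
    by (subst prod.distrib) simp
  finally show ?case using Cons by simp
qed simp

section \<open>Moments of the sample\<close>

locale iid_matrix_sample = prob_space M
  for M :: "'w measure" +
  fixes Z :: "'w \<Rightarrow> real^'q^'p" and Zs :: "nat \<Rightarrow> 'w \<Rightarrow> real^'q^'p"
  assumes Z_rv: "Z \<in> borel_measurable M"
    and sample_indep: "indep_vars (\<lambda>_. borel) Zs UNIV"
    and sample_distr: "\<And>i. distr M borel (Zs i) = distr M borel Z"
    and eighth_moments: "\<And>k l. integrable M (\<lambda>\<omega>. (Z \<omega> $ k $ l) ^ 8)"
    and components_indep: "indep_vars (\<lambda>_. borel) (\<lambda>(k, l) \<omega>. Z \<omega> $ k $ l) UNIV"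
    and mean_zero: "\<And>k l. expectation (\<lambda>\<omega>. Z \<omega> $ k $ l) = 0"
    and variance_one: "\<And>k l. variance (\<lambda>\<omega>. Z \<omega> $ k $ l) = 1"
begin

definition moment :: "('p \<times> 'q) list \<Rightarrow> real"
  where "moment es = expectation (\<lambda>\<omega>. prod_list (map (entry (Z \<omega>)) es))"

definition raw_moment :: "('p \<times> 'q) list \<Rightarrow> nat \<Rightarrow> 'w \<Rightarrow> real"
  where "raw_moment es n \<omega> = 1 / real n * (\<Sum>i<n. prod_list (map (entry (Zs i \<omega>)) es))"

lemma borel_measurable_entry: "(\<lambda>x :: real^'q^'p. entry x e) \<in> borel_measurable borel"
  unfolding entry_def by (intro borel_measurable_continuous_onI continuous_intros)

lemma indep_entries: "indep_vars (\<lambda>_. borel) (\<lambda>e \<omega>. entry (Z \<omega>) e) UNIV"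
  using components_indep by (simp add: entry_def case_prod_beta')

lemma entry_Z_measurable [measurable]: "(\<lambda>\<omega>. entry (Z \<omega>) e) \<in> borel_measurable M"
  by (rule measurable_compose[OF Z_rv borel_measurable_entry])

lemma integrable_entry_power:
  assumes "j \<le> 8"
  shows "integrable M (\<lambda>\<omega>. entry (Z \<omega>) e ^ j)"
proof (rule Bochner_Integration.integrable_bound)
  show "integrable M (\<lambda>\<omega>. 1 + entry (Z \<omega>) e ^ 8)"
    using eighth_moments[of "fst e" "snd e"] by (simp add: entry_def)
  have "\<bar>x\<bar> ^ j \<le> 1 + \<bar>x\<bar> ^ 8" for x :: real
  proof (cases "\<bar>x\<bar> \<le> 1")
    case True
    then have "\<bar>x\<bar> ^ j \<le> 1" by (intro power_le_one) auto
    then show ?thesis by (simp add: add_increasing2)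
  next
    case False
    then have "\<bar>x\<bar> ^ j \<le> \<bar>x\<bar> ^ 8" using assms by (intro power_increasing) auto
    then show ?thesis by simp
  qed
  then show "AE \<omega> in M. norm (entry (Z \<omega>) e ^ j) \<le> norm (1 + entry (Z \<omega>) e ^ 8)"
    by (simp add: power_abs)
qed measurable

lemma prod_powers:
  assumes "\<And>e. k e \<le> 8"
  shows integrable_prod_powers: "integrable M (\<lambda>\<omega>. \<Prod>e\<in>UNIV. entry (Z \<omega>) e ^ k e)"
    and expectation_prod_powers:
      "expectation (\<lambda>\<omega>. \<Prod>e\<in>UNIV. entry (Z \<omega>) e ^ k e) = (\<Prod>e\<in>UNIV. expectation (\<lambda>\<omega>. entry (Z \<omega>) e ^ k e))"
proof -
  have "indep_vars (\<lambda>_. borel) (\<lambda>e \<omega>. entry (Z \<omega>) e ^ k e) UNIV"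
    by (rule indep_vars_compose2[OF indep_entries]) measurable
  then show "integrable M (\<lambda>\<omega>. \<Prod>e\<in>UNIV. entry (Z \<omega>) e ^ k e)"
    "expectation (\<lambda>\<omega>. \<Prod>e\<in>UNIV. entry (Z \<omega>) e ^ k e) = (\<Prod>e\<in>UNIV. expectation (\<lambda>\<omega>. entry (Z \<omega>) e ^ k e))"
    using assms by (auto intro!: indep_vars_integrable indep_vars_lebesgue_integral integrable_entry_power)
qed

text \<open>Here the eighth moments are spent: the square of a monomial of degree at most 4 contains
  an entry to a power of at most 8.\<close>

lemma lin_exp_raw_moment:
  assumes "length es \<le> 4"
  shows "lin_exp M (raw_moment es) (moment es) (\<lambda>n \<omega>. raw_moment es n \<omega> - moment es)"
  unfolding raw_moment_def moment_def
proof (rule lin_exp_sample_mean[OF Z_rv sample_indep sample_distr])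
  show "(\<lambda>x. prod_list (map (entry x) es)) \<in> borel_measurable borel"
    by (induction es) (simp_all add: borel_measurable_times borel_measurable_entry)
  have "count_list es e * 2 \<le> 8" for e
    using count_le_length[of es e] assms by simp
  then have "integrable M (\<lambda>\<omega>. \<Prod>e\<in>UNIV. entry (Z \<omega>) e ^ (count_list es e * 2))"
    by (rule integrable_prod_powers)
  then show "integrable M (\<lambda>\<omega>. (prod_list (map (entry (Z \<omega>)) es))\<^sup>2)"
    by (simp add: prod_list_map_eq_prod_count prod_power_distrib power_mult)
qed

definition entry_moment :: "nat \<Rightarrow> 'p \<times> 'q \<Rightarrow> real"
  where "entry_moment j e = expectation (\<lambda>\<omega>. entry (Z \<omega>) e ^ j)"

lemma entry_moment_0: "entry_moment 0 e = 1"
  by (simp add: entry_moment_def prob_space)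

text \<open>The exponents here and below are spelled with \<open>Suc\<close> to match the evaluation
  of \<open>count_list\<close> by \<open>simp\<close>.\<close>

lemma entry_moment_1: "entry_moment (Suc 0) e = 0"
  using mean_zero by (simp add: entry_moment_def entry_def)

lemma entry_moment_2: "entry_moment (Suc (Suc 0)) e = 1"
proof -
  have "expectation (\<lambda>\<omega>. (Z \<omega> $ fst e $ snd e)\<^sup>2) = 1"
    using variance_one[of "fst e" "snd e"] by (simp add: mean_zero)
  then show ?thesis by (simp add: entry_moment_def entry_def numeral_2_eq_2)
qed

lemma entry_moment_3: "entry_moment (Suc (Suc (Suc 0))) e = gamma_mom M Z (fst e) (snd e)"
  by (simp add: entry_moment_def gamma_mom_def entry_def numeral_3_eq_3)

lemma entry_moment_4: "entry_moment (Suc (Suc (Suc (Suc 0)))) e = beta_mom M Z (fst e) (snd e)"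
  by (simp add: entry_moment_def beta_mom_def entry_def numeral_eq_Suc)

lemma moment_eq_prod:
  assumes "length es \<le> 8"
  shows "moment es = (\<Prod>e\<in>set es. entry_moment (count_list es e) e)"
proof -
  have "moment es = (\<Prod>e\<in>UNIV. entry_moment (count_list es e) e)"
    unfolding moment_def prod_list_map_eq_prod_count entry_moment_def
    using order_trans[OF count_le_length assms] by (intro expectation_prod_powers)
  also have "\<dots> = (\<Prod>e\<in>set es. entry_moment (count_list es e) e)"
    by (rule prod.mono_neutral_right) (auto simp: entry_moment_0 count_list_0_iff)
  finally show ?thesis .
qed

lemma moment1: "moment [e] = 0"
  by (simp add: moment_eq_prod entry_moment_1)

lemma moment2: "moment [e1, e2] = (if e1 = e2 then 1 else 0)"
  by (auto simp: moment_eq_prod entry_moment_1 entry_moment_2)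

lemma moment3: "moment [e1, e2, e3] = (if e1 = e2 \<and> e1 = e3 then gamma_mom M Z (fst e1) (snd e1) else 0)"
  by (cases "e1 = e2"; cases "e1 = e3"; cases "e2 = e3")
    (simp_all add: moment_eq_prod entry_moment_1 entry_moment_2 entry_moment_3)

text \<open>The three pairings of Gaussian fourth moments, plus a correction. If all four positions
  coincide, every pairing counts, so the correction is the excess kurtosis.\<close>

lemma moment4: "moment [e1, e2, e3, e4] =
    of_bool (e1 = e2 \<and> e3 = e4) + of_bool (e1 = e3 \<and> e2 = e4) + of_bool (e1 = e4 \<and> e2 = e3)
    + (beta_mom M Z (fst e1) (snd e1) - 3) * of_bool (e1 = e2 \<and> e1 = e3 \<and> e1 = e4)"
  by (cases "e1 = e2"; cases "e1 = e3"; cases "e1 = e4"; cases "e2 = e3"; cases "e2 = e4"; cases "e3 = e4")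
    (simp_all add: moment_eq_prod entry_moment_1 entry_moment_2 entry_moment_3 entry_moment_4 prod.insert_if)

text \<open>The terms of second and higher order in the sample mean do not contribute to the first-order
  expansion.\<close>

definition centered_moment2 :: "'p \<times> 'q \<Rightarrow> 'p \<times> 'q \<Rightarrow> nat \<Rightarrow> 'w \<Rightarrow> real"
  where "centered_moment2 e1 e2 n \<omega> = 1 / real n * (\<Sum>i<n. entry (centered n (\<lambda>i. Zs i \<omega>) i) e1
    * entry (centered n (\<lambda>i. Zs i \<omega>) i) e2)"

definition centered_moment4 :: "'p \<times> 'q \<Rightarrow> 'p \<times> 'q \<Rightarrow> 'p \<times> 'q \<Rightarrow> 'p \<times> 'q \<Rightarrow> nat \<Rightarrow> 'w \<Rightarrow> real"
  where "centered_moment4 e1 e2 e3 e4 n \<omega> = 1 / real n * (\<Sum>i<n. entry (centered n (\<lambda>i. Zs i \<omega>) i) e1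
    * entry (centered n (\<lambda>i. Zs i \<omega>) i) e2 * entry (centered n (\<lambda>i. Zs i \<omega>) i) e3
    * entry (centered n (\<lambda>i. Zs i \<omega>) i) e4)"

lemma entry_centered: "entry (centered n (\<lambda>i. Zs i \<omega>) i) e = entry (Zs i \<omega>) e - 1 / real n * (\<Sum>i<n. entry (Zs i \<omega>) e)"
  by (simp add: entry_def centered_def sample_mean_def)

lemma centered_moment2_eq: "centered_moment2 e1 e2 n \<omega> = raw_moment [e1, e2] n \<omega> - raw_moment [e1] n \<omega> * raw_moment [e2] n \<omega>"
  unfolding centered_moment2_def entry_centered by (subst mean_centered_product2) (simp add: raw_moment_def)

lemma centered_moment4_eq: "centered_moment4 e1 e2 e3 e4 n \<omega> = raw_moment [e1, e2, e3, e4] n \<omega>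
    - raw_moment [e1] n \<omega> * raw_moment [e2, e3, e4] n \<omega> - raw_moment [e2] n \<omega> * raw_moment [e1, e3, e4] n \<omega>
    - raw_moment [e3] n \<omega> * raw_moment [e1, e2, e4] n \<omega> - raw_moment [e4] n \<omega> * raw_moment [e1, e2, e3] n \<omega>
    + raw_moment [e1] n \<omega> * raw_moment [e2] n \<omega> * raw_moment [e3, e4] n \<omega> + raw_moment [e1] n \<omega> * raw_moment [e3] n \<omega> * raw_moment [e2, e4] n \<omega>
    + raw_moment [e1] n \<omega> * raw_moment [e4] n \<omega> * raw_moment [e2, e3] n \<omega> + raw_moment [e2] n \<omega> * raw_moment [e3] n \<omega> * raw_moment [e1, e4] n \<omega>
    + raw_moment [e2] n \<omega> * raw_moment [e4] n \<omega> * raw_moment [e1, e3] n \<omega> + raw_moment [e3] n \<omega> * raw_moment [e4] n \<omega> * raw_moment [e1, e2] n \<omega>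
    - 3 * (raw_moment [e1] n \<omega> * raw_moment [e2] n \<omega> * raw_moment [e3] n \<omega> * raw_moment [e4] n \<omega>)"
  unfolding centered_moment4_def entry_centered by (subst mean_centered_product4) (simp add: raw_moment_def mult.assoc)

lemma lin_exp_raw_moment1: "lin_exp M (raw_moment [e]) 0 (raw_moment [e])"
  using lin_exp_raw_moment[of "[e]"] by (simp add: moment1)

lemma lin_exp_centered_moment2:
  "lin_exp M (centered_moment2 e1 e2) (if e1 = e2 then 1 else 0) (\<lambda>n \<omega>. raw_moment [e1, e2] n \<omega> - (if e1 = e2 then 1 else 0))"
proof -
  have "lin_exp M (raw_moment [e1, e2]) (moment [e1, e2]) (\<lambda>n \<omega>. raw_moment [e1, e2] n \<omega> - moment [e1, e2])"
    by (rule lin_exp_raw_moment) simp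
  from lin_exp_diff[OF this lin_exp_mult[OF lin_exp_raw_moment1[of e1] lin_exp_raw_moment1[of e2]]]
  show ?thesis
    by (rule lin_exp_cong) (simp_all add: centered_moment2_eq moment2)
qed

text \<open>The products of a sample mean with a third moment are what centring contributes to first
  order. They later supply the \<open>gamma_mom\<close> terms of \<open>q_bar2\<close>.\<close>

lemma lin_exp_centered_moment4:
  "lin_exp M (centered_moment4 e1 e2 e3 e4) (moment [e1, e2, e3, e4]) (\<lambda>n \<omega>. raw_moment [e1, e2, e3, e4] n \<omega> - moment [e1, e2, e3, e4]
    - (raw_moment [e1] n \<omega> * moment [e2, e3, e4] + raw_moment [e2] n \<omega> * moment [e1, e3, e4]
      + raw_moment [e3] n \<omega> * moment [e1, e2, e4] + raw_moment [e4] n \<omega> * moment [e1, e2, e3]))"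
proof -
  note r1 = lin_exp_raw_moment1
  have r2: "lin_exp M (raw_moment [a, b]) (moment [a, b]) (\<lambda>n \<omega>. raw_moment [a, b] n \<omega> - moment [a, b])" for a b
    by (rule lin_exp_raw_moment) simp
  have r3: "lin_exp M (raw_moment [a, b, c]) (moment [a, b, c]) (\<lambda>n \<omega>. raw_moment [a, b, c] n \<omega> - moment [a, b, c])" for a b c
    by (rule lin_exp_raw_moment) simp
  have r4: "lin_exp M (raw_moment [a, b, c, d]) (moment [a, b, c, d]) (\<lambda>n \<omega>. raw_moment [a, b, c, d] n \<omega> - moment [a, b, c, d])" for a b c d
    by (rule lin_exp_raw_moment) simp
  show ?thesis
    \<comment> \<open>Spelling out the polynomial lets the rules build its constant and linear part
      structurally; the closing \<open>simp\<close> identifies them with the stated ones, first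
      moments being 0.\<close>
    by (rule lin_exp_cong[where X = "\<lambda>n \<omega>. raw_moment [e1, e2, e3, e4] n \<omega>
    - raw_moment [e1] n \<omega> * raw_moment [e2, e3, e4] n \<omega> - raw_moment [e2] n \<omega> * raw_moment [e1, e3, e4] n \<omega>
    - raw_moment [e3] n \<omega> * raw_moment [e1, e2, e4] n \<omega> - raw_moment [e4] n \<omega> * raw_moment [e1, e2, e3] n \<omega>
    + raw_moment [e1] n \<omega> * raw_moment [e2] n \<omega> * raw_moment [e3, e4] n \<omega> + raw_moment [e1] n \<omega> * raw_moment [e3] n \<omega> * raw_moment [e2, e4] n \<omega>
    + raw_moment [e1] n \<omega> * raw_moment [e4] n \<omega> * raw_moment [e2, e3] n \<omega> + raw_moment [e2] n \<omega> * raw_moment [e3] n \<omega> * raw_moment [e1, e4] n \<omega>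
    + raw_moment [e2] n \<omega> * raw_moment [e4] n \<omega> * raw_moment [e1, e3] n \<omega> + raw_moment [e3] n \<omega> * raw_moment [e4] n \<omega> * raw_moment [e1, e2] n \<omega>
    - 3 * (raw_moment [e1] n \<omega> * raw_moment [e2] n \<omega> * raw_moment [e3] n \<omega> * raw_moment [e4] n \<omega>)"],
        (rule r1 r2 r3 r4 lin_exp_diff lin_exp_add lin_exp_cmult lin_exp_mult)+)
      (simp_all add: centered_moment4_eq)
qed

end

section \<open>The sample matrices\<close>

lemma sum_split_two:
  fixes f :: "'p::finite \<Rightarrow> real"
  assumes "k \<noteq> k'"
  shows "(\<Sum>c\<in>UNIV. f c) = f k + f k' + (\<Sum>c\<in>UNIV - {k, k'}. f c)"
proof -
  have "(\<Sum>c\<in>UNIV. f c) = (\<Sum>c\<in>{k, k'}. f c) + (\<Sum>c\<in>UNIV - {k, k'}. f c)"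
    by (rule sum.subset_diff[THEN trans]) (auto simp: add.commute)
  then show ?thesis using assms by simp
qed

lemma sum_split_diagonal:
  fixes g :: "'q::finite \<Rightarrow> 'q \<Rightarrow> real"
  shows "(\<Sum>l\<in>UNIV. \<Sum>m\<in>UNIV. g l m) = (\<Sum>l\<in>UNIV. g l l) + (\<Sum>(l, m)\<in>{(l, m). l \<noteq> m}. g l m)"
proof -
  have "(\<Sum>l\<in>UNIV. \<Sum>m\<in>UNIV. g l m) = (\<Sum>z\<in>UNIV. g (fst z) (snd z))"
    by (simp add: sum.cartesian_product UNIV_Times_UNIV case_prod_beta')
  also have "\<dots> = (\<Sum>z\<in>range (\<lambda>l. (l, l)). g (fst z) (snd z)) + (\<Sum>z\<in>UNIV - range (\<lambda>l. (l, l)). g (fst z) (snd z))"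
    by (rule sum.subset_diff[THEN trans]) (auto simp: add.commute)
  also have "UNIV - range (\<lambda>l. (l, l)) = {(l :: 'q, m). l \<noteq> m}"
    by auto
  also have "(\<Sum>z\<in>range (\<lambda>l. (l, l)). g (fst z) (snd z)) = (\<Sum>l\<in>UNIV. g l l)"
    by (subst sum.reindex) (auto simp: inj_on_def)
  finally show ?thesis by (simp add: case_prod_beta')
qed

lemma sum_pick:
  fixes f :: "'p::finite \<Rightarrow> 'p \<Rightarrow> real"
  shows "(\<Sum>c\<in>UNIV. \<Sum>c'\<in>UNIV. if c = a then if c' = b then f c c' else 0 else 0) = f a b"
proof -
  have "(\<Sum>c'\<in>UNIV. if c = a then if c' = b then f c c' else 0 else 0) = (if c = a then f a b else 0)" for c
    by (cases "c = a") auto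
  then show ?thesis by simp
qed

lemma sum_offdiag_swap:
  "(\<Sum>(l, m)\<in>{(l, m). l \<noteq> m}. g l m) = (\<Sum>(l, m)\<in>{(l :: 'q::finite, m). l \<noteq> m}. g m l)"
  by (rule sum.reindex_bij_witness[of _ prod.swap prod.swap]) auto

definition avg :: "nat \<Rightarrow> (nat \<Rightarrow> real) \<Rightarrow> real"
  where "avg n f = 1 / real n * (\<Sum>i<n. f i)"

lemma avg_sum: "avg n (\<lambda>i. \<Sum>j\<in>J. f j i) = (\<Sum>j\<in>J. avg n (f j))"
  unfolding avg_def by (subst sum.swap) (simp add: sum_distrib_left)

lemma avg_cmult: "avg n (\<lambda>i. c * f i) = c * avg n f"
  unfolding avg_def by (simp add: sum_distrib_left)

text \<open>One summand of \<open>B_left N\<close>, with arbitrary matrices in place of the two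
  inverse roots, so that it also makes sense where these do not exist.\<close>

definition B_term :: "nat \<Rightarrow> real^'p^'p \<Rightarrow> real^'q^'p \<Rightarrow> real^'q^'q \<Rightarrow> real^'p^'p"
  where "B_term N A x D = (let Y = A ** x ** D in
    if N = 0 then Y ** transpose Y ** Y ** transpose Y else (norm Y)\<^sup>2 *\<^sub>R (Y ** transpose Y))"

lemma transpose_scaleR: "transpose (c *\<^sub>R A) = c *\<^sub>R transpose (A :: real^'n^'m)"
  by (simp add: transpose_def vec_eq_iff)

lemma transpose_B_term: "transpose (B_term N A x D) = B_term N A x D"
  by (simp add: B_term_def Let_def matrix_transpose_mul transpose_scaleR matrix_mul_assoc)

text \<open>With \<open>Q = x ** (D ** D) ** transpose x\<close>, whose entries are
  \<open>P\<close>, the Gram matrix of \<open>Y\<close> is \<open>A ** Q ** A\<close>. The summand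
  is therefore \<open>A ** R ** A\<close> with \<open>R = Q ** (A ** A) ** Q\<close> for
  \<open>N = 0\<close>, and \<open>R\<close> the multiple of \<open>Q\<close> by the trace of
  \<open>A ** A ** Q\<close> otherwise. The sums are nested in the order in which they are expanded
  later.\<close>

lemma B_term_entry:
  fixes A :: "real^'p^'p" and D :: "real^'q^'q" and x :: "real^'q^'p"
  assumes A: "transpose A = A" and D: "transpose D = D"
  defines "P \<equiv> \<lambda>a b. \<Sum>l\<in>UNIV. \<Sum>l'\<in>UNIV. (D ** D) $ l $ l' * (x $ a $ l * x $ b $ l')"
  shows "B_term N A x D $ k $ k' = (\<Sum>a\<in>UNIV. A $ k $ a * (\<Sum>b\<in>UNIV. A $ b $ k' *
    (\<Sum>c\<in>UNIV. \<Sum>c'\<in>UNIV. (A ** A) $ c $ c' *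
      (if N = 0 then P a c * P c' b else P c c' * P a b))))"
proof -
  define Y where "Y = A ** x ** D"
  define Q where "Q = x ** (D ** D) ** transpose x"
  have Q: "Q $ a $ b = P a b" for a b
  proof -
    have "Q $ a $ b = (\<Sum>l'\<in>UNIV. \<Sum>l\<in>UNIV. x $ a $ l * (D ** D) $ l $ l' * x $ b $ l')"
      unfolding Q_def matrix_matrix_mult_def[of _ "transpose x"] matrix_matrix_mult_def[of x]
      by (simp add: transpose_def sum_distrib_right)
    then show ?thesis
      unfolding P_def by (subst sum.swap) (simp add: mult_ac)
  qed
  have Qsym: "transpose Q = Q"
    by (simp add: Q_def matrix_transpose_mul D matrix_mul_assoc)
  have YY: "Y ** transpose Y = A ** Q ** A"
    by (simp add: Y_def Q_def matrix_transpose_mul A D matrix_mul_assoc)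
  have nY: "(norm Y)\<^sup>2 = (\<Sum>c\<in>UNIV. \<Sum>c'\<in>UNIV. (A ** A) $ c $ c' * P c c')"
  proof -
    have "(norm Y)\<^sup>2 = (\<Sum>r\<in>UNIV. (Y ** transpose Y) $ r $ r)"
      unfolding norm_matrix_sq_rows by (simp add: matrix_matrix_mult_def transpose_def power2_eq_square)
    also have "\<dots> = (\<Sum>r\<in>UNIV. \<Sum>c'\<in>UNIV. \<Sum>c\<in>UNIV. A $ r $ c * P c c' * A $ c' $ r)"
      unfolding YY by (simp add: matrix_matrix_mult_def Q[symmetric] sum_distrib_right)
    also have "\<dots> = (\<Sum>c'\<in>UNIV. \<Sum>c\<in>UNIV. \<Sum>r\<in>UNIV. A $ r $ c * P c c' * A $ c' $ r)"
      by (subst sum.swap, rule sum.cong[OF refl], rule sum.swap)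
    also have "\<dots> = (\<Sum>c'\<in>UNIV. \<Sum>c\<in>UNIV. (A ** A) $ c' $ c * P c c')"
      by (simp add: matrix_matrix_mult_def sum_distrib_left mult_ac)
    also have "\<dots> = (\<Sum>c'\<in>UNIV. \<Sum>c\<in>UNIV. (A ** A) $ c' $ c * P c' c)"
      using Qsym by (simp add: Q[symmetric] transpose_def vec_eq_iff)
    finally show ?thesis .
  qed
  define R where "R = (if N = 0 then Q ** (A ** A) ** Q else (norm Y)\<^sup>2 *\<^sub>R Q)"
  have R: "R $ a $ b = (\<Sum>c\<in>UNIV. \<Sum>c'\<in>UNIV. (A ** A) $ c $ c' *
      (if N = 0 then P a c * P c' b else P c c' * P a b))" for a b
  proof (cases "N = 0")
    case True
    have "(Q ** (A ** A) ** Q) $ a $ b = (\<Sum>c'\<in>UNIV. \<Sum>c\<in>UNIV. P a c * (A ** A) $ c $ c' * P c' b)"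
      unfolding matrix_matrix_mult_def[of _ Q] matrix_matrix_mult_def[of Q]
      by (simp add: Q sum_distrib_right)
    then show ?thesis
      using True unfolding R_def by (subst sum.swap) (simp add: mult_ac)
  next
    case False
    then show ?thesis
      unfolding R_def nY by (simp add: Q sum_distrib_right mult.assoc)
  qed
  have "B_term N A x D = A ** R ** A"
  proof (cases "N = 0")
    case True
    have "Y ** transpose Y ** Y ** transpose Y = (Y ** transpose Y) ** (Y ** transpose Y)"
      by (simp add: matrix_mul_assoc)
    then show ?thesis
      using True by (simp add: B_term_def Y_def[symmetric] YY R_def matrix_mul_assoc)
  next
    case False
    then show ?thesis
      by (simp add: B_term_def Y_def[symmetric] YY R_def matrix_scalar_ac scalar_matrix_assoc[symmetric])
  qed
  also have "(A ** R ** A) $ k $ k' = (\<Sum>b\<in>UNIV. \<Sum>a\<in>UNIV. A $ k $ a * R $ a $ b * A $ b $ k')"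
    by (simp add: matrix_matrix_mult_def sum_distrib_right)
  also have "\<dots> = (\<Sum>a\<in>UNIV. A $ k $ a * (\<Sum>b\<in>UNIV. A $ b $ k' * R $ a $ b))"
    by (subst sum.swap) (simp add: sum_distrib_left mult_ac)
  finally show ?thesis unfolding R .
qed

lemma B_left_eq_B_term:
  fixes x :: "nat \<Rightarrow> real^'q^'p"
  assumes "standardizable n x"
  shows "B_left N n x = (1 / (real n * real CARD('q))) *\<^sub>R
    (\<Sum>i<n. B_term N (inv_sqrt_total (S_left n x)) (centered n x i) (inv_sqrt_total (S_right n x)))"
proof -
  have "transpose (inv_sqrt_matrix (S_right n x)) = inv_sqrt_total (S_right n x)"
    "inv_sqrt_matrix (S_left n x) = inv_sqrt_total (S_left n x)"
    using assms transpose_inv_sqrt_total[of "S_right n x"] by (auto simp: standardizable_def inv_sqrt_total_def)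
  then have "standardized n x i = inv_sqrt_total (S_left n x) ** centered n x i ** inv_sqrt_total (S_right n x)" for i
    by (simp add: standardized_def)
  then show ?thesis
    by (simp add: B_left_def B0_left_def B1_left_def B_term_def Let_def)
qed

text \<open>Pairing with a perturbed unit vector selects one component and adds the perturbation
  weighted by the limits of all components.\<close>

lemma (in prob_space) lin_exp_contract:
  fixes j0 :: "'j::finite"
  assumes X: "\<And>j. lin_exp M (X j) (if j = j0 then 1 else 0) (x j)"
    and Y: "\<And>j. lin_exp M (Y j) (y0 j) (y j)"
  shows "lin_exp M (\<lambda>n \<omega>. \<Sum>j\<in>UNIV. X j n \<omega> * Y j n \<omega>) (y0 j0) (\<lambda>n \<omega>. y j0 n \<omega> + (\<Sum>j\<in>UNIV. y0 j * x j n \<omega>))"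
proof (rule lin_exp_cong)
  show "lin_exp M (\<lambda>n \<omega>. \<Sum>j\<in>UNIV. X j n \<omega> * Y j n \<omega>) (\<Sum>j\<in>UNIV. (if j = j0 then 1 else 0) * y0 j)
      (\<lambda>n \<omega>. \<Sum>j\<in>UNIV. (if j = j0 then 1 else 0) * y j n \<omega> + y0 j * x j n \<omega>)"
    by (intro lin_exp_sum lin_exp_mult X Y) auto
qed (simp_all add: sum.distrib if_distrib[of "\<lambda>x. x * _"] cong: if_cong)

text \<open>The same with a perturbed identity matrix, which takes a trace in the limit.\<close>

lemma (in prob_space) lin_exp_contract2:
  fixes X Y :: "'j::finite \<Rightarrow> 'j \<Rightarrow> _"
  assumes X: "\<And>i j. lin_exp M (X i j) (if i = j then 1 else 0) (x i j)"
    and Y: "\<And>i j. lin_exp M (Y i j) (y0 i j) (y i j)"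
  shows "lin_exp M (\<lambda>n \<omega>. \<Sum>i\<in>UNIV. \<Sum>j\<in>UNIV. X i j n \<omega> * Y i j n \<omega>) (\<Sum>i\<in>UNIV. y0 i i)
    (\<lambda>n \<omega>. \<Sum>i\<in>UNIV. y i i n \<omega> + (\<Sum>j\<in>UNIV. y0 i j * x i j n \<omega>))"
  using X Y by (intro lin_exp_sum lin_exp_contract) (auto simp: eq_commute)

lemma (in prob_space) lin_exp_inv_sqrt_total:
  fixes X :: "nat \<Rightarrow> 'a \<Rightarrow> real^'n^'n"
  assumes "\<And>i j. lin_exp M (\<lambda>n \<omega>. X n \<omega> $ i $ j) (mat 1 $ i $ j) (L i j)" "\<And>n \<omega>. transpose (X n \<omega>) = X n \<omega>"
  shows "lin_exp M (\<lambda>n \<omega>. inv_sqrt_total (X n \<omega>) $ i $ j) (if i = j then 1 else 0) (\<lambda>n \<omega>. - (1/2) * L i j n \<omega>)"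
proof -
  have one: "inv_sqrt_total (mat 1 :: real^'n^'n) = mat 1"
    using inv_sqrt_total_expansion[of "mat 1 :: real^'n^'n"] by simp
  have "bounded_linear (\<lambda>E :: real^'n^'n. E $ i $ j)"
    by (rule bounded_linear_compose[OF bounded_linear_vec_nth bounded_linear_vec_nth])
  from bounded_linear.has_derivative[OF this has_derivative_inv_sqrt_total]
  have deriv: "((\<lambda>S :: real^'n^'n. inv_sqrt_total S $ i $ j) has_derivative (\<lambda>E. - (1/2) * E $ i $ j))
      (at (mat 1) within {S. transpose S = S})"
    by simp
  have meas: "(\<lambda>S :: real^'n^'n. inv_sqrt_total S $ i $ j) \<in> borel_measurable borel"
    using borel_measurable_inv_sqrt_total
    by (rule measurable_compose) (intro borel_measurable_continuous_onI continuous_intros)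
  have "lin_exp M (\<lambda>n \<omega>. inv_sqrt_total (X n \<omega>) $ i $ j) (inv_sqrt_total (mat 1) $ i $ j) (\<lambda>n \<omega>. - (1/2) * L i j n \<omega>)"
    by (rule lin_exp_delta[OF _ _ assms(1) meas deriv])
      (use assms in \<open>auto intro!: borel_measurable_matrixI simp: lin_exp_def\<close>)
  moreover have "mat 1 $ i $ j = (if i = j then 1 else 0 :: real)"
    by (simp add: mat_def)
  ultimately show ?thesis by (simp only: one)
qed

lemma (in prob_space) lin_exp_square:
  fixes X :: "nat \<Rightarrow> 'a \<Rightarrow> real^'n^'n"
  assumes "\<And>i j. lin_exp M (\<lambda>n \<omega>. X n \<omega> $ i $ j) (if i = j then 1 else 0) (L i j)"
  shows "lin_exp M (\<lambda>n \<omega>. (X n \<omega> ** X n \<omega>) $ i $ j) (if i = j then 1 else 0) (\<lambda>n \<omega>. 2 * L i j n \<omega>)"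
proof (rule lin_exp_cong)
  have eq: "lin_exp M (\<lambda>n \<omega>. X n \<omega> $ i $ k) (if k = i then 1 else 0) (L i k)" for k
    using assms[of i k] by (cases "i = k") auto
  show "lin_exp M (\<lambda>n \<omega>. \<Sum>k\<in>UNIV. X n \<omega> $ i $ k * X n \<omega> $ k $ j) (if i = j then 1 else 0)
     (\<lambda>n \<omega>. L i j n \<omega> + (\<Sum>k\<in>UNIV. (if k = j then 1 else 0) * L i k n \<omega>))"
    by (rule lin_exp_contract[OF eq assms])
qed (simp_all add: matrix_matrix_mult_def if_distrib[of "\<lambda>x. x * _"] cong: if_cong)

section \<open>The standardising matrices and the entries of the matrix to be diagonalised\<close>

context iid_matrix_sample
begin

lemma S_left_entry: "S_left n (\<lambda>i. Zs i \<omega>) $ k $ k' = 1 / real CARD('q) * (\<Sum>l\<in>UNIV. centered_moment2 (k, l) (k', l) n \<omega>)"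
  unfolding S_left_def centered_moment2_def
  by (simp add: matrix_matrix_mult_def transpose_def sum_distrib_left[symmetric])
    (subst sum.swap, simp add: sum_divide_distrib[symmetric])

lemma S_right_entry: "S_right n (\<lambda>i. Zs i \<omega>) $ l $ l' = 1 / real CARD('p) * (\<Sum>k\<in>UNIV. centered_moment2 (k, l) (k, l') n \<omega>)"
  unfolding S_right_def centered_moment2_def
  by (simp add: matrix_matrix_mult_def transpose_def sum_distrib_left[symmetric])
    (subst sum.swap, simp add: sum_divide_distrib[symmetric])

lemma centered_moment2_commute: "centered_moment2 e1 e2 n \<omega> = centered_moment2 e2 e1 n \<omega>"
  by (simp add: centered_moment2_def mult.commute)

lemma transpose_S_left: "transpose (S_left n (\<lambda>i. Zs i \<omega>)) = S_left n (\<lambda>i. Zs i \<omega>)"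
  unfolding vec_eq_iff transpose_def vec_lambda_beta S_left_entry
  by (intro allI arg_cong2[of _ _ _ _ "(*)"] sum.cong refl centered_moment2_commute)

lemma transpose_S_right: "transpose (S_right n (\<lambda>i. Zs i \<omega>)) = S_right n (\<lambda>i. Zs i \<omega>)"
  unfolding vec_eq_iff transpose_def vec_lambda_beta S_right_entry
  by (intro allI arg_cong2[of _ _ _ _ "(*)"] sum.cong refl centered_moment2_commute)

definition A_hat :: "nat \<Rightarrow> 'w \<Rightarrow> real^'p^'p"
  where "A_hat n \<omega> = inv_sqrt_total (S_left n (\<lambda>i. Zs i \<omega>))"

definition D_hat :: "nat \<Rightarrow> 'w \<Rightarrow> real^'q^'q"
  where "D_hat n \<omega> = inv_sqrt_total (S_right n (\<lambda>i. Zs i \<omega>))"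

definition s_dev :: "'p \<Rightarrow> 'p \<Rightarrow> nat \<Rightarrow> 'w \<Rightarrow> real"
  where "s_dev k k' n \<omega> = s_bar n (\<lambda>i. Zs i \<omega>) k k' - (if k = k' then 1 else 0)"

lemma lin_exp_S_left:
  "lin_exp M (\<lambda>n \<omega>. S_left n (\<lambda>i. Zs i \<omega>) $ k $ k') (mat 1 $ k $ k') (s_dev k k')"
proof (rule lin_exp_cong)
  show "lin_exp M (\<lambda>n \<omega>. 1 / real CARD('q) * (\<Sum>l\<in>UNIV. centered_moment2 (k, l) (k', l) n \<omega>))
    (1 / real CARD('q) * (\<Sum>l\<in>(UNIV :: 'q set). if (k, l) = (k', l) then 1 else 0))
    (\<lambda>n \<omega>. 1 / real CARD('q) * (\<Sum>l\<in>UNIV. raw_moment [(k, l), (k', l)] n \<omega> - (if (k, l) = (k', l) then 1 else 0)))"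
    by (intro lin_exp_cmult lin_exp_sum lin_exp_centered_moment2 finite)
qed (simp_all add: S_left_entry mat_def s_dev_def s_bar_def raw_moment_def sum_subtractf diff_divide_distrib)

text \<open>The linear part stays anonymous, because it cancels from the off-diagonal expansion for
  any value it may take.\<close>

lemma lin_exp_S_right:
  "\<exists>L. \<forall>l l'. lin_exp M (\<lambda>n \<omega>. S_right n (\<lambda>i. Zs i \<omega>) $ l $ l') (mat 1 $ l $ l') (L l l')"
proof (intro exI allI)
  fix l l'
  show "lin_exp M (\<lambda>n \<omega>. S_right n (\<lambda>i. Zs i \<omega>) $ l $ l') (mat 1 $ l $ l')
    (\<lambda>n \<omega>. 1 / real CARD('p) * (\<Sum>k\<in>UNIV. raw_moment [(k, l), (k, l')] n \<omega> - (if (k, l) = (k, l') then 1 else 0)))"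
  proof (rule lin_exp_cong)
    show "lin_exp M (\<lambda>n \<omega>. 1 / real CARD('p) * (\<Sum>k\<in>UNIV. centered_moment2 (k, l) (k, l') n \<omega>))
      (1 / real CARD('p) * (\<Sum>k\<in>(UNIV :: 'p set). if (k, l) = (k, l') then 1 else 0))
      (\<lambda>n \<omega>. 1 / real CARD('p) * (\<Sum>k\<in>UNIV. raw_moment [(k, l), (k, l')] n \<omega> - (if (k, l) = (k, l') then 1 else 0)))"
      by (intro lin_exp_cmult lin_exp_sum lin_exp_centered_moment2 finite)
  qed (simp_all add: S_right_entry mat_def)
qed

lemma lin_exp_A_hat:
  "lin_exp M (\<lambda>n \<omega>. A_hat n \<omega> $ k $ k') (if k = k' then 1 else 0) (\<lambda>n \<omega>. - (1/2) * s_dev k k' n \<omega>)"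
  unfolding A_hat_def by (rule lin_exp_inv_sqrt_total[OF lin_exp_S_left transpose_S_left])

text \<open>Coincides with \<open>B_left N\<close> on standardizable samples, and is symmetric and
  measurable on the whole probability space.\<close>

definition B_hat :: "nat \<Rightarrow> nat \<Rightarrow> 'w \<Rightarrow> real^'p^'p"
  where "B_hat N n \<omega> = (1 / (real n * real CARD('q))) *\<^sub>R
    (\<Sum>i<n. B_term N (A_hat n \<omega>) (centered n (\<lambda>i. Zs i \<omega>) i) (D_hat n \<omega>))"

text \<open>The sample average of a product of two entries, \<open>(a, b)\<close> and
  \<open>(c, d)\<close>, of the matrix \<open>x ** (D ** D) ** transpose x\<close>, for centred
  observations \<open>x\<close>.\<close>

definition V_hat :: "'p \<Rightarrow> 'p \<Rightarrow> 'p \<Rightarrow> 'p \<Rightarrow> nat \<Rightarrow> 'w \<Rightarrow> real"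
  where "V_hat a b c d n \<omega> = (\<Sum>l\<in>UNIV. \<Sum>l'\<in>UNIV. (D_hat n \<omega> ** D_hat n \<omega>) $ l $ l' *
    (\<Sum>m\<in>UNIV. \<Sum>m'\<in>UNIV. (D_hat n \<omega> ** D_hat n \<omega>) $ m $ m' * centered_moment4 (a, l) (b, l') (c, m) (d, m') n \<omega>))"

text \<open>The averaged inner factor of the matrix, after the two outer copies of the left root are
  stripped off.\<close>

definition Psi_hat :: "nat \<Rightarrow> 'p \<Rightarrow> 'p \<Rightarrow> nat \<Rightarrow> 'w \<Rightarrow> real"
  where "Psi_hat N a b n \<omega> = (\<Sum>c\<in>UNIV. \<Sum>c'\<in>UNIV. (A_hat n \<omega> ** A_hat n \<omega>) $ c $ c' *
    (if N = 0 then V_hat a c c' b n \<omega> else V_hat c c' a b n \<omega>))"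

lemma transpose_A_hat: "transpose (A_hat n \<omega>) = A_hat n \<omega>"
  and transpose_D_hat: "transpose (D_hat n \<omega>) = D_hat n \<omega>"
  by (simp_all add: A_hat_def D_hat_def transpose_inv_sqrt_total)

lemma transpose_B_hat: "transpose (B_hat N n \<omega>) = B_hat N n \<omega>"
proof -
  have "transpose (\<Sum>i<m. B_term N A (x i) D) = (\<Sum>i<m. B_term N A (x i) D)"
    for m A D and x :: "nat \<Rightarrow> real^'q^'p"
    using transpose_B_term[of N A _ D] by (simp add: transpose_def vec_eq_iff)
  then show ?thesis
    by (simp add: B_hat_def transpose_scaleR)
qed

lemma B_left_eq_B_hat:
  "standardizable n (\<lambda>i. Zs i \<omega>) \<Longrightarrow> B_left N n (\<lambda>i. Zs i \<omega>) = B_hat N n \<omega>"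
  by (simp add: B_left_eq_B_term B_hat_def A_hat_def D_hat_def)

text \<open>The weights from \<open>A_hat\<close> and \<open>D_hat\<close> are common to all
  observations, so the average passes inward to monomials of degree four.\<close>

lemma B_hat_entry: "B_hat N n \<omega> $ k $ k' = 1 / real CARD('q) *
    (\<Sum>a\<in>UNIV. A_hat n \<omega> $ k $ a * (\<Sum>b\<in>UNIV. A_hat n \<omega> $ b $ k' * Psi_hat N a b n \<omega>))"
proof -
  define D2 where "D2 = D_hat n \<omega> ** D_hat n \<omega>"
  define x where "x i = centered n (\<lambda>i. Zs i \<omega>) i" for i
  define P where "P i a b = (\<Sum>l\<in>UNIV. \<Sum>l'\<in>UNIV. D2 $ l $ l' * (x i $ a $ l * x i $ b $ l'))" for i a b
  have V: "avg n (\<lambda>i. P i a b * P i c d) = V_hat a b c d n \<omega>" for a b c d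
  proof -
    have "P i a b * P i c d = (\<Sum>l\<in>UNIV. \<Sum>l'\<in>UNIV. D2 $ l $ l' * (\<Sum>m\<in>UNIV. \<Sum>m'\<in>UNIV. D2 $ m $ m' *
        (x i $ a $ l * x i $ b $ l' * x i $ c $ m * x i $ d $ m')))" for i
      unfolding P_def[of i a b] sum_distrib_right
      by (intro sum.cong refl) (simp add: P_def sum_distrib_left mult_ac)
    then have "avg n (\<lambda>i. P i a b * P i c d) = (\<Sum>l\<in>UNIV. \<Sum>l'\<in>UNIV. D2 $ l $ l' * (\<Sum>m\<in>UNIV. \<Sum>m'\<in>UNIV. D2 $ m $ m' *
        avg n (\<lambda>i. x i $ a $ l * x i $ b $ l' * x i $ c $ m * x i $ d $ m')))"
      by (simp only: avg_sum avg_cmult)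
    then show ?thesis
      by (simp add: V_hat_def centered_moment4_def avg_def D2_def x_def)
  qed
  have "B_hat N n \<omega> $ k $ k' = 1 / real CARD('q) * avg n (\<lambda>i. B_term N (A_hat n \<omega>) (x i) (D_hat n \<omega>) $ k $ k')"
    by (simp add: B_hat_def avg_def x_def)
  also have "\<dots> = 1 / real CARD('q) * avg n (\<lambda>i. \<Sum>a\<in>UNIV. A_hat n \<omega> $ k $ a * (\<Sum>b\<in>UNIV. A_hat n \<omega> $ b $ k' *
      (\<Sum>c\<in>UNIV. \<Sum>c'\<in>UNIV. (A_hat n \<omega> ** A_hat n \<omega>) $ c $ c' *
      (if N = 0 then P i a c * P i c' b else P i c c' * P i a b))))"
    unfolding B_term_entry[OF transpose_A_hat transpose_D_hat] P_def D2_def by simp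
  also have "\<dots> = 1 / real CARD('q) * (\<Sum>a\<in>UNIV. A_hat n \<omega> $ k $ a * (\<Sum>b\<in>UNIV. A_hat n \<omega> $ b $ k' *
      (\<Sum>c\<in>UNIV. \<Sum>c'\<in>UNIV. (A_hat n \<omega> ** A_hat n \<omega>) $ c $ c' *
      avg n (\<lambda>i. if N = 0 then P i a c * P i c' b else P i c c' * P i a b))))"
    by (simp only: avg_sum avg_cmult)
  also have "\<dots> = 1 / real CARD('q) *
    (\<Sum>a\<in>UNIV. A_hat n \<omega> $ k $ a * (\<Sum>b\<in>UNIV. A_hat n \<omega> $ b $ k' * Psi_hat N a b n \<omega>))"
    unfolding Psi_hat_def by (cases "N = 0") (simp_all add: V)
  finally show ?thesis .
qed

section \<open>Limits and linear parts of the fourth-order statistics\<close>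

definition centered_moment4_lin :: "'p \<times> 'q \<Rightarrow> 'p \<times> 'q \<Rightarrow> 'p \<times> 'q \<Rightarrow> 'p \<times> 'q \<Rightarrow> nat \<Rightarrow> 'w \<Rightarrow> real"
  where "centered_moment4_lin e1 e2 e3 e4 n \<omega> = raw_moment [e1, e2, e3, e4] n \<omega> - moment [e1, e2, e3, e4]
    - (raw_moment [e1] n \<omega> * moment [e2, e3, e4] + raw_moment [e2] n \<omega> * moment [e1, e3, e4]
      + raw_moment [e3] n \<omega> * moment [e1, e2, e4] + raw_moment [e4] n \<omega> * moment [e1, e2, e3])"

lemma lin_exp_centered_moment4_lin: "lin_exp M (centered_moment4 e1 e2 e3 e4) (moment [e1, e2, e3, e4]) (centered_moment4_lin e1 e2 e3 e4)"
  unfolding centered_moment4_lin_def[abs_def] by (rule lin_exp_centered_moment4)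

definition V_limit :: "'p \<Rightarrow> 'p \<Rightarrow> 'p \<Rightarrow> 'p \<Rightarrow> real"
  where "V_limit a b c d = (\<Sum>l\<in>UNIV. \<Sum>m\<in>UNIV. moment [(a, l), (b, l), (c, m), (d, m)])"

text \<open>The first pairing of \<open>moment4\<close> leaves both column indices free and yields
  \<open>q\<^sup>2\<close>. The other two pairings and the kurtosis term force \<open>l = m\<close>
  and yield multiples of \<open>q\<close>.\<close>

lemma V_limit_eq: "V_limit a b c d = (real CARD('q))\<^sup>2 * of_bool (a = b \<and> c = d)
    + real CARD('q) * (of_bool (a = c \<and> b = d) + of_bool (a = d \<and> b = c)
      + (beta_row M Z a - 3) * of_bool (a = b \<and> a = c \<and> a = d))"
proof -
  have "moment [(a, l), (b, l), (c, m), (d, m)] = of_bool (a = b \<and> c = d)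
      + (if l = m then of_bool (a = c \<and> b = d) else 0) + (if l = m then of_bool (a = d \<and> b = c) else 0)
      + (if l = m then of_bool (a = b \<and> a = c \<and> a = d) * (beta_mom M Z a l - 3) else 0)" for l m
    by (auto simp: moment4)
  moreover have "(\<Sum>l\<in>UNIV. of_bool P * (beta_mom M Z a l - 3)) = real CARD('q) * ((beta_row M Z a - 3) * of_bool P)" for P
    by (cases P) (simp_all add: beta_row_def sum_subtractf right_diff_distrib)
  ultimately show ?thesis
    by (simp add: V_limit_def sum.distrib power2_eq_square distrib_left)
qed

definition Psi_limit :: "nat \<Rightarrow> 'p \<Rightarrow> 'p \<Rightarrow> real"
  where "Psi_limit N a b = (\<Sum>c\<in>UNIV. if N = 0 then V_limit a c c b else V_limit c c a b)"

text \<open>The limiting eigenvalue. For \<open>N = 0\<close>, the trace over \<open>c\<close> gives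
  \<open>q\<^sup>2 + q * (beta_row - 2)\<close> from \<open>c = a\<close> and \<open>p * q\<close>
  from all rows; for \<open>N = 1\<close> it gives \<open>q * (beta_row - 1)\<close> and
  \<open>p * q\<^sup>2\<close>. Division by \<open>q\<close> leaves the constants shown.\<close>

definition eig_limit :: "nat \<Rightarrow> 'p \<Rightarrow> real"
  where "eig_limit N a = beta_row M Z a +
    (if N = 0 then real CARD('q) + real CARD('p) - 2 else real CARD('q) * real CARD('p) - 1)"

lemma Psi_limit_eq: "Psi_limit N a b = (if a = b then real CARD('q) * eig_limit N a else 0)"
proof (cases "a = b")
  case True
  have "V_limit a c c a = (if c = a then (real CARD('q))\<^sup>2 + real CARD('q) * (beta_row M Z a - 2) else 0) + real CARD('q)"
    "V_limit c c a a = (if c = a then real CARD('q) * (beta_row M Z a - 1) else 0) + (real CARD('q))\<^sup>2" for c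
    by (auto simp: V_limit_eq algebra_simps)
  then show ?thesis
    using True by (simp add: Psi_limit_def eig_limit_def sum.distrib) (simp add: power2_eq_square algebra_simps)
next
  case False
  have "(if N = 0 then V_limit a c c b else V_limit c c a b) = 0" for c
    using False by (auto simp: V_limit_eq)
  then show ?thesis using False by (simp add: Psi_limit_def)
qed

lemma raw_moment_perm: "mset es = mset es' \<Longrightarrow> raw_moment es n \<omega> = raw_moment es' n \<omega>"
  unfolding raw_moment_def by (simp add: prod_mset_prod_list[symmetric])

lemma q_bar2_raw: "real CARD('q) * q_bar2 (gamma_mom M Z) n (\<lambda>i. Zs i \<omega>) k k'
    = (\<Sum>l\<in>UNIV. raw_moment [(k, l), (k, l), (k, l), (k', l)] n \<omega> - raw_moment [(k', l)] n \<omega> * gamma_mom M Z k l)"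
  by (simp add: q_bar2_def raw_moment_def left_diff_distrib right_diff_distrib sum_subtractf sum_distrib_left
      diff_divide_distrib power3_eq_cube mult_ac)

lemma q_bar3_raw: "real CARD('q) * q_bar3 n (\<lambda>i. Zs i \<omega>) m k k'
    = (\<Sum>l\<in>UNIV. raw_moment [(m, l), (m, l), (k, l), (k', l)] n \<omega>)"
  by (simp add: q_bar3_def raw_moment_def power2_eq_square mult_ac)

lemma r_bar2_raw: "real CARD('q) * r_bar2 n (\<lambda>i. Zs i \<omega>) k k'
    = (\<Sum>(l, l')\<in>{(l, l'). l \<noteq> l'}. raw_moment [(k, l), (k, l), (k, l'), (k', l')] n \<omega>)"
  by (simp add: r_bar2_def raw_moment_def power2_eq_square mult_ac)

lemma r0_bar3_raw: "real CARD('q) * r0_bar3 n (\<lambda>i. Zs i \<omega>) m k k'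
    = (\<Sum>(l, l')\<in>{(l, l'). l \<noteq> l'}. raw_moment [(k, l), (m, l), (m, l'), (k', l')] n \<omega>)"
  by (simp add: r0_bar3_def raw_moment_def power2_eq_square mult_ac)

lemma r1_bar3_raw: "real CARD('q) * r1_bar3 n (\<lambda>i. Zs i \<omega>) m k k'
    = (\<Sum>(l, l')\<in>{(l, l'). l \<noteq> l'}. raw_moment [(m, l), (m, l), (k, l'), (k', l')] n \<omega>)"
  by (simp add: r1_bar3_def raw_moment_def power2_eq_square mult_ac)

text \<open>The terms with \<open>l = m\<close> form \<open>Q_bar\<close> and those with distinct
  columns form \<open>R_bar\<close>. Within each, the rows \<open>c = k\<close> and
  \<open>c = k'\<close> yield the quantities with two indices, and the other rows those with
  three.\<close>

lemma sum_centered_moment4_lin: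
  assumes "k \<noteq> k'"
  shows "(\<Sum>c\<in>UNIV. \<Sum>l\<in>UNIV. \<Sum>m\<in>UNIV. if N = 0 then centered_moment4_lin (k, l) (c, l) (c, m) (k', m) n \<omega>
      else centered_moment4_lin (c, l) (c, l) (k, m) (k', m) n \<omega>)
    = real CARD('q) * (Q_bar (gamma_mom M Z) n (\<lambda>i. Zs i \<omega>) k k' + R_bar N n (\<lambda>i. Zs i \<omega>) k k')"
proof -
  define r where "r c l m = raw_moment (if N = 0 then [(k, l), (c, l), (c, m), (k', m)] else [(c, l), (c, l), (k, m), (k', m)]) n \<omega>"
    for c l m
  \<comment> \<open>A third moment survives only if its three positions agree, which forces
    \<open>l = m\<close> and \<open>c\<close> to be \<open>k\<close> or \<open>k'\<close>. The
    fourth-moment limit itself vanishes as the two rows differ.\<close>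
  have "(if N = 0 then centered_moment4_lin (k, l) (c, l) (c, m) (k', m) n \<omega> else centered_moment4_lin (c, l) (c, l) (k, m) (k', m) n \<omega>)
    = r c l m - (if l = m then (if c = k' then raw_moment [(k, l)] n \<omega> * gamma_mom M Z k' l else 0) else 0)
      - (if l = m then (if c = k then raw_moment [(k', l)] n \<omega> * gamma_mom M Z k l else 0) else 0)" for c l m
    using assms by (auto simp: centered_moment4_lin_def r_def moment3 moment4)
  then have "(\<Sum>c\<in>UNIV. \<Sum>l\<in>UNIV. \<Sum>m\<in>UNIV. if N = 0 then centered_moment4_lin (k, l) (c, l) (c, m) (k', m) n \<omega>
      else centered_moment4_lin (c, l) (c, l) (k, m) (k', m) n \<omega>)
    = (\<Sum>c\<in>UNIV. (\<Sum>l\<in>UNIV. \<Sum>m\<in>UNIV. r c l m)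
      - (if c = k' then \<Sum>l\<in>UNIV. raw_moment [(k, l)] n \<omega> * gamma_mom M Z k' l else 0)
      - (if c = k then \<Sum>l\<in>UNIV. raw_moment [(k', l)] n \<omega> * gamma_mom M Z k l else 0))"
    by (intro sum.cong refl) (auto simp: sum_subtractf)
  also have "\<dots> = (\<Sum>c\<in>UNIV. \<Sum>l\<in>UNIV. \<Sum>m\<in>UNIV. r c l m)
      - (\<Sum>l\<in>UNIV. raw_moment [(k, l)] n \<omega> * gamma_mom M Z k' l) - (\<Sum>l\<in>UNIV. raw_moment [(k', l)] n \<omega> * gamma_mom M Z k l)"
    by (simp add: sum_subtractf)
  finally have "(\<Sum>c\<in>UNIV. \<Sum>l\<in>UNIV. \<Sum>m\<in>UNIV. if N = 0 then centered_moment4_lin (k, l) (c, l) (c, m) (k', m) n \<omega>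
      else centered_moment4_lin (c, l) (c, l) (k, m) (k', m) n \<omega>) = \<dots>" .
  moreover have "(\<Sum>c\<in>UNIV. \<Sum>l\<in>UNIV. \<Sum>m\<in>UNIV. r c l m)
    = (\<Sum>l\<in>UNIV. r k l l) + (\<Sum>(l, m)\<in>{(l, m). l \<noteq> m}. r k l m)
      + ((\<Sum>l\<in>UNIV. r k' l l) + (\<Sum>(l, m)\<in>{(l, m). l \<noteq> m}. r k' l m))
      + (\<Sum>c\<in>UNIV - {k, k'}. (\<Sum>l\<in>UNIV. r c l l) + (\<Sum>(l, m)\<in>{(l, m). l \<noteq> m}. r c l m))"
    by (simp only: sum_split_two[OF assms] sum_split_diagonal)
  moreover have "(\<Sum>(l, m)\<in>{(l, m). l \<noteq> m}. r k l m) = real CARD('q) * r_bar2 n (\<lambda>i. Zs i \<omega>) k k'"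
    by (simp add: r_bar2_raw r_def)
  moreover have "(\<Sum>(l, m)\<in>{(l, m). l \<noteq> m}. r k' l m) = real CARD('q) * r_bar2 n (\<lambda>i. Zs i \<omega>) k' k"
  proof (cases "N = 0")
    case True
    \<comment> \<open>For \<open>N = 0\<close> the repeated entry stands in the second column index,
      whereas \<open>r_bar2\<close> has its square in the first, so the two columns are
      exchanged.\<close>
    show ?thesis
      unfolding r_bar2_raw by (subst sum_offdiag_swap) (auto simp: r_def True intro!: sum.cong raw_moment_perm)
  next
    case False
    then show ?thesis
      unfolding r_bar2_raw by (auto simp: r_def intro!: sum.cong raw_moment_perm)
  qed
  moreover have "(\<Sum>l\<in>UNIV. r k l l) = real CARD('q) * q_bar2 (gamma_mom M Z) n (\<lambda>i. Zs i \<omega>) k k'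
      + (\<Sum>l\<in>UNIV. raw_moment [(k', l)] n \<omega> * gamma_mom M Z k l)"
    by (simp add: q_bar2_raw r_def sum_subtractf)
  moreover have "(\<Sum>l\<in>UNIV. r k' l l) = real CARD('q) * q_bar2 (gamma_mom M Z) n (\<lambda>i. Zs i \<omega>) k' k
      + (\<Sum>l\<in>UNIV. raw_moment [(k, l)] n \<omega> * gamma_mom M Z k' l)"
    by (simp add: q_bar2_raw sum_subtractf) (auto simp: r_def intro!: sum.cong raw_moment_perm)
  moreover have "(\<Sum>l\<in>UNIV. r c l l) = real CARD('q) * q_bar3 n (\<lambda>i. Zs i \<omega>) c k k'" for c
    unfolding q_bar3_raw by (auto simp: r_def intro!: sum.cong raw_moment_perm)
  moreover have "(\<Sum>(l, m)\<in>{(l, m). l \<noteq> m}. r c l m) = real CARD('q) * r_bar3 N n (\<lambda>i. Zs i \<omega>) c k k'" for c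
    by (simp add: r_bar3_def r0_bar3_raw r1_bar3_raw r_def)
  ultimately show ?thesis
    by (simp only: Q_bar_def R_bar_def sum.distrib) (simp add: sum_distrib_left distrib_left)
qed

lemma s_dev_commute: "s_dev k k' n \<omega> = s_dev k' k n \<omega>"
  by (simp add: s_dev_def s_bar_def mult.commute)

text \<open>The factor of \<open>- s/2\<close> caused by the inner square of the left root. That
  square deviates by \<open>- s\<close>; its weights add up to \<open>q\<^sup>2 + q\<close> for
  \<open>N = 0\<close> and to \<open>2 * q\<close> otherwise, before division by
  \<open>q\<close>.\<close>

definition s_coeff :: "nat \<Rightarrow> real"
  where "s_coeff N = (if N = 0 then 2 * real CARD('q) + 2 else 4)"

text \<open>For distinct \<open>k\<close> and \<open>k'\<close> only the index pairs
  \<open>(k, k')\<close> and \<open>(k', k)\<close> have nonzero weight, and symmetry of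
  \<open>s_dev\<close> merges them.\<close>

lemma sum_V_limit_s_dev:
  assumes "k \<noteq> k'"
  shows "(\<Sum>c\<in>UNIV. \<Sum>c'\<in>UNIV. (if N = 0 then V_limit k c c' k' else V_limit c c' k k') * (2 * (- (1/2) * s_dev c c' n \<omega>)))
    = real CARD('q) * (s_coeff N * (- (1/2) * s_dev k k' n \<omega>))"
proof (cases "N = 0")
  case True
  have "V_limit k c c' k' = (if c = k then if c' = k' then (real CARD('q))\<^sup>2 else 0 else 0)
     + (if c = k' then if c' = k then real CARD('q) else 0 else 0)" for c c'
    using assms by (auto simp: V_limit_eq)
  then have "V_limit k c c' k' * y = (if c = k then if c' = k' then (real CARD('q))\<^sup>2 * y else 0 else 0)
     + (if c = k' then if c' = k then real CARD('q) * y else 0 else 0)" for c c' y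
    using assms by auto
  then have eq: "(\<Sum>c\<in>UNIV. \<Sum>c'\<in>UNIV. V_limit k c c' k' * t c c') = (real CARD('q))\<^sup>2 * t k k' + real CARD('q) * t k' k" for t
    by (simp only: sum.distrib sum_pick)
  show ?thesis
    unfolding if_P[OF True] eq using True s_dev_commute[of k' k n \<omega>] by (simp add: s_coeff_def power2_eq_square algebra_simps)
next
  case False
  have "V_limit c c' k k' * y = (if c = k then if c' = k' then real CARD('q) * y else 0 else 0)
     + (if c = k' then if c' = k then real CARD('q) * y else 0 else 0)" for c c' y
    using assms by (auto simp: V_limit_eq)
  then have eq: "(\<Sum>c\<in>UNIV. \<Sum>c'\<in>UNIV. V_limit c c' k k' * t c c') = real CARD('q) * t k k' + real CARD('q) * t k' k" for t
    by (simp only: sum.distrib sum_pick)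
  show ?thesis
    unfolding if_not_P[OF False] eq using False s_dev_commute[of k' k n \<omega>] by (simp add: s_coeff_def algebra_simps)
qed

text \<open>In the coefficient of \<open>s_dev\<close>, the two eigenvalues stem from the outer
  copies of the left root and \<open>s_coeff\<close> from the inner square.\<close>

definition B_lin :: "nat \<Rightarrow> 'p \<Rightarrow> 'p \<Rightarrow> nat \<Rightarrow> 'w \<Rightarrow> real"
  where "B_lin N k k' n \<omega> = Q_bar (gamma_mom M Z) n (\<lambda>i. Zs i \<omega>) k k' + R_bar N n (\<lambda>i. Zs i \<omega>) k k'
    + (s_coeff N + eig_limit N k + eig_limit N k') * (- (1/2) * s_dev k k' n \<omega>)"

text \<open>On the diagonal only the limit matters, since the derivative of the nearest diagonaliser
  reads off-diagonal entries alone; the linear part is identified just there.\<close>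

lemma lin_exp_B_hat:
  "\<exists>L. lin_exp M (\<lambda>n \<omega>. B_hat N n \<omega> $ k $ k') (if k = k' then eig_limit N k else 0) L \<and>
    (k \<noteq> k' \<longrightarrow> L = B_lin N k k')"
proof -
  obtain LS where LS: "\<And>l l'. lin_exp M (\<lambda>n \<omega>. S_right n (\<lambda>i. Zs i \<omega>) $ l $ l') (mat 1 $ l $ l') (LS l l')"
    using lin_exp_S_right by blast
  define dd where "dd l l' n \<omega> = 2 * (- (1/2) * LS l l' n \<omega>)" for l l' n \<omega>
  have D2: "lin_exp M (\<lambda>n \<omega>. (D_hat n \<omega> ** D_hat n \<omega>) $ l $ l') (if l = l' then 1 else 0) (dd l l')" for l l'
    unfolding dd_def D_hat_def by (rule lin_exp_square[OF lin_exp_inv_sqrt_total[OF LS transpose_S_right]])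
  define VL where "VL a b c d n \<omega> = (\<Sum>l\<in>UNIV.
      (\<Sum>m\<in>UNIV. centered_moment4_lin (a, l) (b, l) (c, m) (d, m) n \<omega>
        + (\<Sum>m'\<in>UNIV. moment [(a, l), (b, l), (c, m), (d, m')] * dd m m' n \<omega>))
      + (\<Sum>l'\<in>UNIV. (\<Sum>m\<in>UNIV. moment [(a, l), (b, l'), (c, m), (d, m)]) * dd l l' n \<omega>))" for a b c d n \<omega>
  have V: "lin_exp M (V_hat a b c d) (V_limit a b c d) (VL a b c d)" for a b c d
    unfolding V_hat_def[abs_def] V_limit_def VL_def[abs_def]
    by (rule lin_exp_contract2[OF D2 lin_exp_contract2[OF D2 lin_exp_centered_moment4_lin]])
  have A2: "lin_exp M (\<lambda>n \<omega>. (A_hat n \<omega> ** A_hat n \<omega>) $ c $ c') (if c = c' then 1 else 0)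
      (\<lambda>n \<omega>. 2 * (- (1/2) * s_dev c c' n \<omega>))" for c c'
    by (rule lin_exp_square[OF lin_exp_A_hat])
  define PL where "PL a b n \<omega> = (\<Sum>c\<in>UNIV. (if N = 0 then VL a c c b n \<omega> else VL c c a b n \<omega>)
      + (\<Sum>c'\<in>UNIV. (if N = 0 then V_limit a c c' b else V_limit c c' a b) * (2 * (- (1/2) * s_dev c c' n \<omega>))))" for a b n \<omega>
  have Psi: "lin_exp M (Psi_hat N a b) (Psi_limit N a b) (PL a b)" for a b
  proof -
    have "lin_exp M (\<lambda>n \<omega>. if N = 0 then V_hat a c c' b n \<omega> else V_hat c c' a b n \<omega>)
      (if N = 0 then V_limit a c c' b else V_limit c c' a b) (\<lambda>n \<omega>. if N = 0 then VL a c c' b n \<omega> else VL c c' a b n \<omega>)" for c c'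
      using V by simp
    then show ?thesis
      unfolding Psi_hat_def[abs_def] Psi_limit_def PL_def[abs_def]
      by (rule lin_exp_contract2[OF A2])
  qed
  have A': "lin_exp M (\<lambda>n \<omega>. A_hat n \<omega> $ k $ a) (if a = k then 1 else 0) (\<lambda>n \<omega>. - (1/2) * s_dev k a n \<omega>)" for k a
    using lin_exp_A_hat[of k a] by (cases "k = a") auto
  define L where "L n \<omega> = 1 / real CARD('q) * (PL k k' n \<omega> + (\<Sum>b\<in>UNIV. Psi_limit N k b * (- (1/2) * s_dev b k' n \<omega>))
      + (\<Sum>a\<in>UNIV. Psi_limit N a k' * (- (1/2) * s_dev k a n \<omega>)))" for n \<omega>
  have "lin_exp M (\<lambda>n \<omega>. B_hat N n \<omega> $ k $ k') (1 / real CARD('q) * Psi_limit N k k') L"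
    unfolding B_hat_entry L_def[abs_def]
    by (rule lin_exp_cmult[OF lin_exp_contract[OF A' lin_exp_contract[OF lin_exp_A_hat Psi]]])
  then have "lin_exp M (\<lambda>n \<omega>. B_hat N n \<omega> $ k $ k') (if k = k' then eig_limit N k else 0) L"
    by (simp add: Psi_limit_eq split: if_splits)
  moreover have "L = B_lin N k k'" if kk': "k \<noteq> k'"
  proof (intro ext)
    fix n \<omega>
    \<comment> \<open>These moments are the coefficients of \<open>dd\<close> in \<open>PL\<close>.
      In each of them some entry of row \<open>k\<close> or \<open>k'\<close> occurs alone and
      contributes its mean, 0.\<close>
    have z: "moment [(k, l), (c, l), (c, m), (k', m')] = 0" "moment [(k, l), (c, l'), (c, m), (k', m)] = 0"
      "moment [(c, l), (c, l), (k, m), (k', m')] = 0" "moment [(c, l), (c, l'), (k, m), (k', m)] = 0" for c l l' m m'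
      using kk' by (auto simp: moment4)
    have "PL k k' n \<omega> = (\<Sum>c\<in>UNIV. \<Sum>l\<in>UNIV. \<Sum>m\<in>UNIV. if N = 0 then centered_moment4_lin (k, l) (c, l) (c, m) (k', m) n \<omega>
        else centered_moment4_lin (c, l) (c, l) (k, m) (k', m) n \<omega>)
      + (\<Sum>c\<in>UNIV. \<Sum>c'\<in>UNIV. (if N = 0 then V_limit k c c' k' else V_limit c c' k k') * (2 * (- (1/2) * s_dev c c' n \<omega>)))"
      unfolding PL_def VL_def by (cases "N = 0") (simp_all only: z sum.distrib, simp_all)
    also have "\<dots> = real CARD('q) * (Q_bar (gamma_mom M Z) n (\<lambda>i. Zs i \<omega>) k k' + R_bar N n (\<lambda>i. Zs i \<omega>) k k'
      + s_coeff N * (- (1/2) * s_dev k k' n \<omega>))"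
      unfolding sum_centered_moment4_lin[OF kk'] sum_V_limit_s_dev[OF kk'] by (simp only: distrib_left)
    finally have PL: "PL k k' n \<omega> = \<dots>" .
    have psi: "(\<Sum>b\<in>UNIV. Psi_limit N k b * t b) = real CARD('q) * (eig_limit N k * t k)"
      "(\<Sum>a\<in>UNIV. Psi_limit N a k' * t a) = real CARD('q) * (eig_limit N k' * t k')" for t
      by (simp_all add: Psi_limit_eq if_distrib[of "\<lambda>x. x * _"] cong: if_cong)
    show "L n \<omega> = B_lin N k k' n \<omega>"
      unfolding L_def PL psi B_lin_def by (simp add: field_simps)
  qed
  ultimately show ?thesis by blast
qed

section \<open>The estimate, its admissibility and its expansion\<close>

lemma prob_standardizable:
  "(\<lambda>n. prob {\<omega> \<in> space M. standardizable n (\<lambda>i. Zs i \<omega>)}) \<longlonglongrightarrow> 1"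
proof -
  obtain LS where LS: "\<And>l l'. lin_exp M (\<lambda>n \<omega>. S_right n (\<lambda>i. Zs i \<omega>) $ l $ l') (mat 1 $ l $ l') (LS l l')"
    using lin_exp_S_right by blast
  define SL where "SL n \<omega> = S_left n (\<lambda>i. Zs i \<omega>)" for n \<omega>
  define SR where "SR n \<omega> = S_right n (\<lambda>i. Zs i \<omega>)" for n \<omega>
  have [measurable]: "SL n \<in> borel_measurable M" "SR n \<in> borel_measurable M" for n
    using lin_exp_S_left LS by (auto intro!: borel_measurable_matrixI simp: SL_def SR_def lin_exp_def)
  have "{\<omega> \<in> space M. pos_def_matrix (SL n \<omega>)} \<in> sets M" "{\<omega> \<in> space M. pos_def_matrix (SR n \<omega>)} \<in> sets M" for n
    using measurable_sets[of "SL n" M borel, OF _ borel_pos_def] measurable_sets[of "SR n" M borel, OF _ borel_pos_def]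
    by (simp_all add: vimage_def Int_def conj_commute)
  then have meas: "{\<omega> \<in> space M. standardizable n (\<lambda>i. Zs i \<omega>)} \<in> sets M" for n
    by (simp add: standardizable_def SL_def[symmetric] SR_def[symmetric] sets.sets_Collect_conj)
  have "\<forall>\<^sub>F n in sequentially. dist (prob {\<omega> \<in> space M. standardizable n (\<lambda>i. Zs i \<omega>)}) 1 < e" if "e > 0" for e
  proof -
    have "e/2 > 0" using that by simp
    have "\<forall>\<^sub>F n in sequentially. prob {\<omega> \<in> space M. 1/2 < \<bar>norm (SL n \<omega> - mat 1)\<bar>} < e/2"
      unfolding SL_def
      by (rule little_oP1_norm_matrix[OF lin_exp_S_left, unfolded little_oP1_iff, THEN conjunct2, rule_format])
        (use \<open>e/2 > 0\<close> in simp_all)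
    moreover have "\<forall>\<^sub>F n in sequentially. prob {\<omega> \<in> space M. 1/2 < \<bar>norm (SR n \<omega> - mat 1)\<bar>} < e/2"
      unfolding SR_def
      by (rule little_oP1_norm_matrix[OF LS, unfolded little_oP1_iff, THEN conjunct2, rule_format])
        (use \<open>e/2 > 0\<close> in simp_all)
    ultimately show ?thesis
    proof eventually_elim
      case (elim n)
      have "prob {\<omega> \<in> space M. \<not> standardizable n (\<lambda>i. Zs i \<omega>)}
        \<le> prob {\<omega> \<in> space M. 1/2 < \<bar>norm (SL n \<omega> - mat 1)\<bar>} + prob {\<omega> \<in> space M. 1/2 < \<bar>norm (SR n \<omega> - mat 1)\<bar>}"
      proof (rule measure_union_bound)
        fix \<omega> assume "\<not> standardizable n (\<lambda>i. Zs i \<omega>)"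
        \<comment> \<open>Symmetric matrices within distance 1 of the identity are positive
          definite, so failure pushes one of the two scatter matrices away from the
          identity.\<close>
        then have "\<not> norm (SL n \<omega> - mat 1) < 1 \<or> \<not> norm (SR n \<omega> - mat 1) < 1"
          using pos_def_matrix_near_1[OF transpose_S_left[of n \<omega>]] pos_def_matrix_near_1[OF transpose_S_right[of n \<omega>]]
          unfolding standardizable_def SL_def SR_def by blast
        then show "1/2 < \<bar>norm (SL n \<omega> - mat 1)\<bar> \<or> 1/2 < \<bar>norm (SR n \<omega> - mat 1)\<bar>"
          by auto
      qed measurable
      then show ?case
        using elim prob_neg[OF meas, of n] prob_le_1[of "{\<omega> \<in> space M. standardizable n (\<lambda>i. Zs i \<omega>)}"]
        by (simp add: dist_real_def)
    qed
  qed
  then show ?thesis by (simp add: tendsto_iff)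
qed

definition Gamma_hat :: "nat \<Rightarrow> nat \<Rightarrow> 'w \<Rightarrow> real^'p^'p"
  where "Gamma_hat N n \<omega> = transpose (nearest_diagonalizer (B_hat N n \<omega>)) ** A_hat n \<omega>"

lemma left_MFOBI_estimate_Gamma_hat:
  assumes "standardizable n (\<lambda>i. Zs i \<omega>)"
  shows "left_MFOBI_estimate N n (\<lambda>i. Zs i \<omega>) (Gamma_hat N n \<omega>)"
  unfolding left_MFOBI_estimate_def
proof (intro exI conjI allI)
  have W: "nearest_diagonalizer (B_hat N n \<omega>) \<in> diagonalizers (B_hat N n \<omega>)"
    by (rule nearest_diagonalizer_in[OF transpose_B_hat])
  then show "orthogonal_matrix (nearest_diagonalizer (B_hat N n \<omega>))"
    by (simp add: diagonalizers_def)
  show "B_left N n (\<lambda>i. Zs i \<omega>) *v column k (nearest_diagonalizer (B_hat N n \<omega>)) =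
      (transpose (nearest_diagonalizer (B_hat N n \<omega>)) ** B_hat N n \<omega> ** nearest_diagonalizer (B_hat N n \<omega>)) $ k $ k
      *\<^sub>R column k (nearest_diagonalizer (B_hat N n \<omega>))" for k
    unfolding B_left_eq_B_hat[OF assms] by (rule diagonalizers_eigenvector[OF W])
  show "Gamma_hat N n \<omega> = transpose (nearest_diagonalizer (B_hat N n \<omega>)) ** inv_sqrt_matrix (S_left n (\<lambda>i. Zs i \<omega>))"
    using assms by (simp add: Gamma_hat_def A_hat_def inv_sqrt_total_def standardizable_def)
qed

text \<open>Both factors are perturbed identities, so the first-order terms add:
  \<open>- s/2\<close> from the root, and the off-diagonal entry of the matrix divided by the
  eigenvalue gap from the diagonaliser.\<close>

lemma lin_exp_Gamma_hat:
  assumes inj: "inj (beta_row M Z)"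
  shows "lin_exp M (\<lambda>n \<omega>. Gamma_hat N n \<omega> $ k $ k') (mat 1 $ k $ k') (\<lambda>n \<omega>. - (1/2) * s_dev k k' n \<omega>
    + (if k = k' then 0 else B_lin N k k' n \<omega> / (beta_row M Z k - beta_row M Z k')))"
proof -
  have diff: "eig_limit N a - eig_limit N b = beta_row M Z a - beta_row M Z b" for a b
    by (simp add: eig_limit_def)
  have inj_eig_limit: "inj (eig_limit N)"
  proof (rule injI)
    fix a b assume "eig_limit N a = eig_limit N b"
    then show "a = b" using diff[of a b] injD[OF inj, of a b] by simp
  qed
  obtain LB where LB: "\<And>a b. lin_exp M (\<lambda>n \<omega>. B_hat N n \<omega> $ a $ b) (if a = b then eig_limit N a else 0) (LB a b)"
    and LB_off: "\<And>a b. a \<noteq> b \<Longrightarrow> LB a b = B_lin N a b"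
    using lin_exp_B_hat[of N] by metis
  have sym: "B_hat N n \<omega> $ a $ b = B_hat N n \<omega> $ b $ a" for n \<omega> a b
    using transpose_B_hat[of N n \<omega>] by (metis transpose_def vec_lambda_beta)
  \<comment> \<open>The indices of \<open>LB\<close> are exchanged on purpose. The transpose in
    \<open>Gamma_hat\<close> calls for the diagonaliser entry \<open>(k', k)\<close>, whereas the
    result is stated with \<open>B_lin N k k'\<close>; symmetry of \<open>B_hat\<close> reconciles
    the two.\<close>
  have B: "lin_exp M (\<lambda>n \<omega>. B_hat N n \<omega> $ a $ b) (diag_matrix (eig_limit N) $ a $ b) (LB b a)" for a b
    using LB[of b a] by (subst sym) (auto simp: diag_matrix_def split: if_splits)
  have W: "lin_exp M (\<lambda>n \<omega>. nearest_diagonalizer (B_hat N n \<omega>) $ j $ k) (if j = k then 1 else 0)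
      (\<lambda>n \<omega>. (if j = k then 0 else 1 / (eig_limit N k - eig_limit N j)) * LB k j n \<omega>)" for j
  proof -
    have "((\<lambda>B. nearest_diagonalizer B $ j $ k) has_derivative
        (\<lambda>E. (if j = k then 0 else 1 / (eig_limit N k - eig_limit N j)) * E $ j $ k))
      (at (diag_matrix (eig_limit N)) within {B. transpose B = B})"
      using has_derivative_nearest_diagonalizer[OF inj_eig_limit, of j k] by (cases "j = k") auto
    moreover have "(\<lambda>B :: real^'p^'p. nearest_diagonalizer B $ j $ k) \<in> borel_measurable borel"
      using borel_measurable_nearest_diagonalizer
      by (rule measurable_compose) (intro borel_measurable_continuous_onI continuous_intros)
    ultimately have "lin_exp M (\<lambda>n \<omega>. nearest_diagonalizer (B_hat N n \<omega>) $ j $ k)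
        (nearest_diagonalizer (diag_matrix (eig_limit N)) $ j $ k)
        (\<lambda>n \<omega>. (if j = k then 0 else 1 / (eig_limit N k - eig_limit N j)) * LB k j n \<omega>)"
      by (intro lin_exp_delta[OF _ _ B])
        (use B transpose_B_hat in \<open>auto intro!: borel_measurable_matrixI simp: lin_exp_def\<close>)
    moreover have "mat 1 $ j $ k = (if j = k then 1 else 0 :: real)"
      by (simp add: mat_def)
    ultimately show ?thesis by (simp only: nearest_diagonalizer_diag_matrix)
  qed
  show ?thesis
  proof (rule lin_exp_cong)
    show "lin_exp M (\<lambda>n \<omega>. \<Sum>j\<in>UNIV. nearest_diagonalizer (B_hat N n \<omega>) $ j $ k * A_hat n \<omega> $ j $ k')
      (if k = k' then 1 else 0) (\<lambda>n \<omega>. - (1/2) * s_dev k k' n \<omega> + (\<Sum>j\<in>UNIV. (if j = k' then 1 else 0) *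
        ((if j = k then 0 else 1 / (eig_limit N k - eig_limit N j)) * LB k j n \<omega>)))"
      by (rule lin_exp_contract[OF W lin_exp_A_hat])
    show "- (1/2) * s_dev k k' n \<omega> + (if k = k' then 0 else B_lin N k k' n \<omega> / (beta_row M Z k - beta_row M Z k'))
      = - (1/2) * s_dev k k' n \<omega> + (\<Sum>j\<in>UNIV. (if j = k' then 1 else 0) *
        ((if j = k then 0 else 1 / (eig_limit N k - eig_limit N j)) * LB k j n \<omega>))" for n \<omega>
      using LB_off[of k k'] by (simp add: if_distrib[of "\<lambda>x. x * _"] diff cong: if_cong)
  qed (simp_all add: Gamma_hat_def matrix_matrix_mult_def transpose_def mat_def)
qed

lemma tendsto_in_prob_Gamma_hat:
  assumes "inj (beta_row M Z)"
  shows "tendsto_in_prob M (Gamma_hat N) (mat 1)"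
  using little_oP1_norm_matrix[OF lin_exp_Gamma_hat[OF assms, of N]]
    lin_exp_Gamma_hat[OF assms, of N]
  by (auto simp: tendsto_in_prob_def little_oP1_def dist_norm lin_exp_def intro!: borel_measurable_matrixI)

lemma Gamma_hat_diagonal_expansion:
  assumes "inj (beta_row M Z)"
  shows "little_oP1 M (\<lambda>n \<omega>. sqrt (real n) * (Gamma_hat N n \<omega> $ k $ k - 1)
    - (- (1/2) * (sqrt (real n) * (s_bar n (\<lambda>i. Zs i \<omega>) k k - 1))))"
proof (rule little_oP1_cong)
  show "little_oP1 M (\<lambda>n \<omega>. sqrt (real n) * (Gamma_hat N n \<omega> $ k $ k - mat 1 $ k $ k
      - (- (1/2) * s_dev k k n \<omega> + (if k = k then 0 else B_lin N k k n \<omega> / (beta_row M Z k - beta_row M Z k)))))"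
    using lin_exp_Gamma_hat[OF assms, of N k k] unfolding lin_exp_def by blast
qed (simp add: mat_def s_dev_def algebra_simps)

lemma Gamma_hat_offdiagonal_expansion:
  assumes inj: "inj (beta_row M Z)" and kk': "k \<noteq> k'"
  shows "little_oP1 M (\<lambda>n \<omega>. sqrt (real n) * Gamma_hat N n \<omega> $ k $ k'
    - (sqrt (real n) * Q_bar (gamma_mom M Z) n (\<lambda>i. Zs i \<omega>) k k'
       + sqrt (real n) * R_bar N n (\<lambda>i. Zs i \<omega>) k k'
       - (beta_row M Z k + b_const N CARD('p) CARD('q)) * (sqrt (real n) * s_bar n (\<lambda>i. Zs i \<omega>) k k'))
      / (beta_row M Z k - beta_row M Z k'))"
proof (rule little_oP1_cong)
  show "little_oP1 M (\<lambda>n \<omega>. sqrt (real n) * (Gamma_hat N n \<omega> $ k $ k' - mat 1 $ k $ k'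
      - (- (1/2) * s_dev k k' n \<omega> + (if k = k' then 0 else B_lin N k k' n \<omega> / (beta_row M Z k - beta_row M Z k')))))"
    using lin_exp_Gamma_hat[OF inj, of N k k'] unfolding lin_exp_def by blast
  fix n \<omega>
  define \<Delta> where "\<Delta> = beta_row M Z k - beta_row M Z k'"
  define s where "s = s_bar n (\<lambda>i. Zs i \<omega>) k k'"
  define QR where "QR = Q_bar (gamma_mom M Z) n (\<lambda>i. Zs i \<omega>) k k' + R_bar N n (\<lambda>i. Zs i \<omega>) k k'"
  have \<Delta>: "\<Delta> \<noteq> 0" using injD[OF inj, of k k'] kk' by (auto simp: \<Delta>_def)
  have s: "s_dev k k' n \<omega> = s" using kk' by (simp add: s_dev_def s_def)
  \<comment> \<open>The extra \<Delta> is the \<open>- s/2\<close> of the left root brought over the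
    common denominator; it replaces row \<open>k'\<close> by a second copy of row
    \<open>k\<close>.\<close>
  have "s_coeff N + eig_limit N k + eig_limit N k' + \<Delta> = 2 * (beta_row M Z k + b_const N CARD('p) CARD('q))"
    by (simp add: s_coeff_def eig_limit_def b_const_def \<Delta>_def)
  then have b: "s_coeff N + eig_limit N k + eig_limit N k' = 2 * (beta_row M Z k + b_const N CARD('p) CARD('q)) - \<Delta>"
    by simp
  have "- (1/2) * s_dev k k' n \<omega> + B_lin N k k' n \<omega> / \<Delta> = (QR - (beta_row M Z k + b_const N CARD('p) CARD('q)) * s) / \<Delta>"
    unfolding B_lin_def b s QR_def[symmetric] using \<Delta> by (simp add: field_simps)
  then show "sqrt (real n) * Gamma_hat N n \<omega> $ k $ k'
    - (sqrt (real n) * Q_bar (gamma_mom M Z) n (\<lambda>i. Zs i \<omega>) k k'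
       + sqrt (real n) * R_bar N n (\<lambda>i. Zs i \<omega>) k k'
       - (beta_row M Z k + b_const N CARD('p) CARD('q)) * (sqrt (real n) * s_bar n (\<lambda>i. Zs i \<omega>) k k'))
      / (beta_row M Z k - beta_row M Z k')
    = sqrt (real n) * (Gamma_hat N n \<omega> $ k $ k' - mat 1 $ k $ k'
      - (- (1/2) * s_dev k k' n \<omega> + (if k = k' then 0 else B_lin N k k' n \<omega> / (beta_row M Z k - beta_row M Z k'))))"
    using kk' by (simp add: mat_def \<Delta>_def[symmetric] s_def[symmetric] QR_def right_diff_distrib algebra_simps)
qed

end

theorem theorem6p3p1:
  fixes M :: "'w measure"
    and Z :: "'w \<Rightarrow> real^'q^'p"
    and Zs :: "nat \<Rightarrow> 'w \<Rightarrow> real^'q^'p"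
    and N :: nat
  assumes "prob_space M"
    and Z_rv: "Z \<in> borel_measurable M"
    and sample_indep: "prob_space.indep_vars M (\<lambda>_. borel) Zs UNIV"
    and sample_distr: "\<And>i. distr M borel (Zs i) = distr M borel Z"
    and eighth_moments: "\<And>k l. integrable M (\<lambda>\<omega>. (Z \<omega> $ k $ l) ^ 8)"
    and components_indep:
      "prob_space.indep_vars M (\<lambda>_. borel) (\<lambda>(k, l) \<omega>. Z \<omega> $ k $ l) (UNIV :: ('p \<times> 'q) set)"
    and mean_zero: "\<And>k l. prob_space.expectation M (\<lambda>\<omega>. Z \<omega> $ k $ l) = 0"
    and variance_one: "\<And>k l. prob_space.variance M (\<lambda>\<omega>. Z \<omega> $ k $ l) = 1"
    and rows_distinct: "inj (beta_row M Z)"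
    and cols_distinct: "inj (beta_col M Z)"
    and N: "N \<in> {0, 1}"
  shows "\<exists>\<Gamma> :: nat \<Rightarrow> 'w \<Rightarrow> real^'p^'p.
    (\<lambda>n. prob_space.prob M {\<omega> \<in> space M. standardizable n (\<lambda>i. Zs i \<omega>)}) \<longlonglongrightarrow> 1 \<and>
    (\<forall>n. \<forall>\<omega> \<in> space M. standardizable n (\<lambda>i. Zs i \<omega>) \<longrightarrow>
       left_MFOBI_estimate N n (\<lambda>i. Zs i \<omega>) (\<Gamma> n \<omega>)) \<and>
    tendsto_in_prob M \<Gamma> (mat 1) \<and>
    (\<forall>k. little_oP1 M (\<lambda>n \<omega>.
       sqrt (real n) * (\<Gamma> n \<omega> $ k $ k - 1)
       - (- (1 / 2) * (sqrt (real n) * (s_bar n (\<lambda>i. Zs i \<omega>) k k - 1))))) \<and>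
    (\<forall>k k'. k \<noteq> k' \<longrightarrow> little_oP1 M (\<lambda>n \<omega>.
       sqrt (real n) * \<Gamma> n \<omega> $ k $ k'
       - (sqrt (real n) * Q_bar (gamma_mom M Z) n (\<lambda>i. Zs i \<omega>) k k'
          + sqrt (real n) * R_bar N n (\<lambda>i. Zs i \<omega>) k k'
          - (beta_row M Z k + b_const N CARD('p) CARD('q))
            * (sqrt (real n) * s_bar n (\<lambda>i. Zs i \<omega>) k k'))
         / (beta_row M Z k - beta_row M Z k')))"
proof -
  interpret iid_matrix_sample M Z Zs
    using assms by (intro iid_matrix_sample.intro iid_matrix_sample_axioms.intro)
  show ?thesis
    using prob_standardizable left_MFOBI_estimate_Gamma_hat tendsto_in_prob_Gamma_hat[OF rows_distinct]
      Gamma_hat_diagonal_expansion[OF rows_distinct] Gamma_hat_offdiagonal_expansion[OF rows_distinct]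
    by (intro exI[of _ "Gamma_hat N"] conjI allI ballI impI)
qed

end
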